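(* Let $(\Delta_n)$ be a sequence of positive numbers. (i) Assume that $n^{2s/(d+4s)}\Delta_n\to\infty$. Then for any $\alpha\in(0,1)$, $$\lim_{n\to\infty}{\rm power}\{\Phi^{\rm HOM}_{n,\nu_n,\alpha};H_1^{\rm HOM}(\Delta_n;s)\}=1,$$ provided that $\nu_n\asymp n^{4/(d+4s)}$. (ii) Conversely, if $\liminf_{n\to\infty}n^{2s/(d+4s)}\Delta_n<\infty$, then there exists some $\alpha\in(0,1)$ such that for any test $\Phi_n$ of level $\alpha$ (asymptotically) based on $X_1,\ldots,X_n\sim p$ and $Y_1,\ldots,Y_m\sim q$, $$\liminf_{n\to\infty}{\rm power}\{\Phi_n;H_1^{\rm HOM}(\Delta_n;s)\}<1.$$
   Context: Fix $d\ge1$, $s>0$, $M>0$. For $f:\mathbb{R}^d\to\mathbb{R}$ let $\mathcal{F}(f)(\omega)=(2\pi)^{-d/2}\int f(x)e^{-ix^\top\omega}dx$ be its Fourier transform, $\|f\|_{L_2}^2=\int f^2$, and $\|f\|_{\mathcal{W}^{s,2}}^2=\int(1+\|\omega\|^2)^s|\mathcal{F}(f)(\omega)|^2d\omega$. $\mathcal{W}^{s,2}$ is the set of $f:\mathbb{R}^d\to\mathbb{R}$ that are almost everywhere continuous with $\|f\|_{\mathcal{W}^{s,2}}<\infty$, and $\mathcal{W}^{s,2}(M)=\{f\in\mathcal{W}^{s,2}:\|f\|_{\mathcal{W}^{s,2}}\le M\}$. The notation $a_n\asymp b_n$ means that $a_n/b_n$ is bounded above and below by positive constants. Two independent samples are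 observed on $\mathbb{R}^d$: $X_1,\dots,X_n$ i.i.d. from $\mathbb{P}$ with density $p$, and $Y_1,\dots,Y_m$ i.i.d. from $\mathbb{Q}$ with density $q$, where $m=m_n$ satisfies $c_0\le m/n\le C_0$ for some constants $0<c_0\le C_0<\infty$. The null hypothesis is $H_0^{\rm HOM}:p=q\in\mathcal{W}^{s,2}(M)$; the alternative $H_1^{\rm HOM}(\Delta_n;s)$ is: $p,q\in\mathcal{W}^{s,2}(M)$ are densities with $\|p-q\|_{L_2}\ge\Delta_n$. The power of a test $\Phi$ is $${\rm power}\{\Phi;H_1^{\rm HOM}(\Delta_n;s)\}=\inf_{p,q\in\mathcal{W}^{s,2}(M),\ \|p-q\|_{L_2}\ge\Delta_n}\mathbb{P}\{\Phi\text{ rejects }H_0^{\rm HOM}\}$$ (the infimum over an empty set being $1$). A sequence of tests $\Phi_n$ has (asymptotic) level $\alpha$ if, for each $p=q$ satisfying $H_0^{\rm HOM}$, the limsup as $n\to\infty$ of its rejection probability is at most $\alpha$. For $\nu>0$, $G_\nu(x,y)=\exp(-\nu\|x-y\|^2)$. Define $$\widehat{\gamma_\nu^2}(\mathbb{P},\mathbb{Q})=\frac1{n(n-1)}\sum_{1\le i\ne j\le n}G_\nu(X_i,X_j)+\frac1{m(m-1)}\sum_{1\le i\ne j\le m}G_\nu(Y_i,Y_j)-\frac2{mn}\sum_{i=1}^n\sum_{j=1}^mG_\nu(X_i,Y_j).$$ Let $N=n+m$, $Z_i=X_i$ for $i\le n$ and $Z_i=Y_{i-n}$ for $n<i\le N$,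 $$\tilde s_{n,m,\nu}^2=\frac1{N(N-1)}\sum_{i\ne j}G_{2\nu}(Z_i,Z_j)-\frac{2(N-3)!}{N!}\sum_{|\{i,j_1,j_2\}|=3}G_\nu(Z_i,Z_{j_1})G_\nu(Z_i,Z_{j_2})+\frac{(N-4)!}{N!}\sum_{|\{i_1,i_2,j_1,j_2\}|=4}G_\nu(Z_{i_1},Z_{j_1})G_\nu(Z_{i_2},Z_{j_2}),$$ with all indices in $\{1,\dots,N\}$, $\hat s_{n,m,\nu}^2=\max\{\tilde s_{n,m,\nu}^2,1/n^2\}$, and $$T_{n,\nu}^{\rm HOM}=\frac{nm}{\sqrt2(n+m)}\,\hat s_{n,m,\nu}^{-1}\,\widehat{\gamma_\nu^2}(\mathbb{P},\mathbb{Q}).$$ The test $\Phi^{\rm HOM}_{n,\nu,\alpha}$ rejects $H_0^{\rm HOM}$ if and only if $T_{n,\nu}^{\rm HOM}>z_\alpha$, where $\Pr(Z>z_\alpha)=\alpha$ for $Z\sim N(0,1)$. *)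

theory Defs
  imports "HOL-Probability.Probability" "HOL-Library.Landau_Symbols"
begin

definition fourier :: "(real ^ 'd \<Rightarrow> real) \<Rightarrow> real ^ 'd \<Rightarrow> complex" where
  "fourier f \<omega> = complex_of_real ((2 * pi) powr (- real CARD('d) / 2)) *
     (LINT x|lborel. complex_of_real (f x) * exp (- (\<i> * complex_of_real (x \<bullet> \<omega>))))"

definition l2_norm :: "(real ^ 'd \<Rightarrow> real) \<Rightarrow> real" where
  "l2_norm f = sqrt (LINT x|lborel. (f x)\<^sup>2)"

definition sobolev_integrand :: "real \<Rightarrow> (real ^ 'd \<Rightarrow> real) \<Rightarrow> real ^ 'd \<Rightarrow> real" where
  "sobolev_integrand s f \<omega> = (1 + (norm \<omega>)\<^sup>2) powr s * (cmod (fourier f \<omega>))\<^sup>2"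

definition sobolev_norm :: "real \<Rightarrow> (real ^ 'd \<Rightarrow> real) \<Rightarrow> real" where
  "sobolev_norm s f = sqrt (LINT \<omega>|lborel. sobolev_integrand s f \<omega>)"

text \<open>Integrability of \<open>f\<close> makes the Fourier integral meaningful (a Bochner integral that does not
  exist is 0, which would give a spurious norm 0). The space is only used for probability densities,
  where this holds anyway. Integrability of the integrand says that the norm is finite. For \<open>s > 0\<close>
  the members are square integrable by Plancherel, so \<open>l2_norm\<close> is the genuine norm on their
  differences.\<close>

definition sobolev :: "real \<Rightarrow> (real ^ 'd \<Rightarrow> real) set" where
  "sobolev s = {f. integrable lborel f \<and> (AE x in lborel. isCont f x) \<and>
     integrable lborel (sobolev_integrand s f)}"

definition sobolev_ball :: "real \<Rightarrow> real \<Rightarrow> (real ^ 'd \<Rightarrow> real) set" where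
  "sobolev_ball s M = {f \<in> sobolev s. sobolev_norm s f \<le> M}"

definition prob_density :: "(real ^ 'd \<Rightarrow> real) \<Rightarrow> bool" where
  "prob_density p \<longleftrightarrow> p \<in> borel_measurable borel \<and> (\<forall>x. 0 \<le> p x) \<and>
     prob_space (density lborel (\<lambda>x. ennreal (p x)))"

text \<open>A (non-randomized) test is given by its rejection predicate on the two samples
  \<open>x 1, \<dots>, x n\<close> and \<open>y 1, \<dots>, y m\<close>.\<close>

type_synonym 'd two_sample_test = "(nat \<Rightarrow> real ^ 'd) \<Rightarrow> (nat \<Rightarrow> real ^ 'd) \<Rightarrow> bool"

definition is_test :: "nat \<Rightarrow> nat \<Rightarrow> 'd::finite two_sample_test \<Rightarrow> bool" where
  "is_test n m \<Phi> \<longleftrightarrow> case_prod \<Phi> \<in>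
     measurable ((\<Pi>\<^sub>M i\<in>{1..n}. borel) \<Otimes>\<^sub>M (\<Pi>\<^sub>M j\<in>{1..m}. borel)) (count_space UNIV)"

text \<open>Joint law of \<open>n\<close> i.i.d. observations with density \<open>p\<close> and, independently of them,
  \<open>m\<close> i.i.d. observations with density \<open>q\<close>.\<close>

definition sample_law :: "(real ^ 'd \<Rightarrow> real) \<Rightarrow> (real ^ 'd \<Rightarrow> real) \<Rightarrow> nat \<Rightarrow> nat \<Rightarrow>
    ((nat \<Rightarrow> real ^ 'd) \<times> (nat \<Rightarrow> real ^ 'd)) measure" where
  "sample_law p q n m =
     (\<Pi>\<^sub>M i\<in>{1..n}. density lborel (\<lambda>x. ennreal (p x))) \<Otimes>\<^sub>M
     (\<Pi>\<^sub>M j\<in>{1..m}. density lborel (\<lambda>x. ennreal (q x)))"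

definition reject_prob :: "(real ^ 'd \<Rightarrow> real) \<Rightarrow> (real ^ 'd \<Rightarrow> real) \<Rightarrow> nat \<Rightarrow> nat \<Rightarrow>
    'd two_sample_test \<Rightarrow> real" where
  "reject_prob p q n m \<Phi> =
     measure (sample_law p q n m) {(x, y) \<in> space (sample_law p q n m). \<Phi> x y}"

definition hom_alternative ::
    "real \<Rightarrow> real \<Rightarrow> real \<Rightarrow> ((real ^ 'd \<Rightarrow> real) \<times> (real ^ 'd \<Rightarrow> real)) set" where
  "hom_alternative s M \<Delta> = {(p, q). p \<in> sobolev_ball s M \<and> q \<in> sobolev_ball s M \<and>
     prob_density p \<and> prob_density q \<and> l2_norm (\<lambda>x. p x - q x) \<ge> \<Delta>}"

text \<open>Inserting 1, an upper bound for all rejection probabilities, only serves to make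
  the infimum over an empty alternative equal to 1.\<close>

definition hom_power :: "real \<Rightarrow> real \<Rightarrow> real \<Rightarrow> nat \<Rightarrow> nat \<Rightarrow> 'd::finite two_sample_test \<Rightarrow> real" where
  "hom_power s M \<Delta> n m \<Phi> =
     Inf (insert 1 ((\<lambda>(p, q). reject_prob p q n m \<Phi>) ` hom_alternative s M \<Delta>))"

definition asymptotic_level ::
    "real \<Rightarrow> real \<Rightarrow> (nat \<Rightarrow> nat) \<Rightarrow> real \<Rightarrow> (nat \<Rightarrow> 'd::finite two_sample_test) \<Rightarrow> bool" where
  "asymptotic_level s M m \<alpha> \<Phi> \<longleftrightarrow> (\<forall>p \<in> sobolev_ball s M. prob_density p \<longrightarrow>
     limsup (\<lambda>n. ereal (reject_prob p p n (m n) (\<Phi> n))) \<le> ereal \<alpha>)"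

definition gauss_kernel :: "real \<Rightarrow> real ^ 'd \<Rightarrow> real ^ 'd \<Rightarrow> real" where
  "gauss_kernel \<nu> x y = exp (- \<nu> * (norm (x - y))\<^sup>2)"

definition mmd_estimate ::
    "real \<Rightarrow> nat \<Rightarrow> nat \<Rightarrow> (nat \<Rightarrow> real ^ 'd) \<Rightarrow> (nat \<Rightarrow> real ^ 'd) \<Rightarrow> real" where
  "mmd_estimate \<nu> n m x y =
     1 / (real n * (real n - 1)) *
       (\<Sum>(i, j) \<in> {(i, j). i \<in> {1..n} \<and> j \<in> {1..n} \<and> i \<noteq> j}. gauss_kernel \<nu> (x i) (x j))
   + 1 / (real m * (real m - 1)) *
       (\<Sum>(i, j) \<in> {(i, j). i \<in> {1..m} \<and> j \<in> {1..m} \<and> i \<noteq> j}. gauss_kernel \<nu> (y i) (y j))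
   - 2 / (real m * real n) * (\<Sum>i = 1..n. \<Sum>j = 1..m. gauss_kernel \<nu> (x i) (y j))"

definition pooled_sample ::
    "nat \<Rightarrow> (nat \<Rightarrow> real ^ 'd) \<Rightarrow> (nat \<Rightarrow> real ^ 'd) \<Rightarrow> nat \<Rightarrow> real ^ 'd" where
  "pooled_sample n x y i = (if i \<le> n then x i else y (i - n))"

text \<open>The truncated subtractions in the factorials are harmless: for \<open>N < 3\<close> resp. \<open>N < 4\<close>
  the sums they multiply are empty.\<close>

definition s_tilde_sq :: "real \<Rightarrow> nat \<Rightarrow> (nat \<Rightarrow> real ^ 'd) \<Rightarrow> real" where
  "s_tilde_sq \<nu> N z =
     1 / (real N * (real N - 1)) *
       (\<Sum>(i, j) \<in> {(i, j). i \<in> {1..N} \<and> j \<in> {1..N} \<and> i \<noteq> j}. gauss_kernel (2 * \<nu>) (z i) (z j))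
   - 2 * fact (N - 3) / fact N *
       (\<Sum>(i, j1, j2) \<in> {(i, j1, j2). {i, j1, j2} \<subseteq> {1..N} \<and> card {i, j1, j2} = 3}.
          gauss_kernel \<nu> (z i) (z j1) * gauss_kernel \<nu> (z i) (z j2))
   + fact (N - 4) / fact N *
       (\<Sum>(i1, i2, j1, j2) \<in> {(i1, i2, j1, j2). {i1, i2, j1, j2} \<subseteq> {1..N} \<and> card {i1, i2, j1, j2} = 4}.
          gauss_kernel \<nu> (z i1) (z j1) * gauss_kernel \<nu> (z i2) (z j2))"

definition s_hat ::
    "real \<Rightarrow> nat \<Rightarrow> nat \<Rightarrow> (nat \<Rightarrow> real ^ 'd) \<Rightarrow> (nat \<Rightarrow> real ^ 'd) \<Rightarrow> real" where
  "s_hat \<nu> n m x y = sqrt (max (s_tilde_sq \<nu> (n + m) (pooled_sample n x y)) (1 / (real n)\<^sup>2))"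

definition hom_statistic ::
    "real \<Rightarrow> nat \<Rightarrow> nat \<Rightarrow> (nat \<Rightarrow> real ^ 'd) \<Rightarrow> (nat \<Rightarrow> real ^ 'd) \<Rightarrow> real" where
  "hom_statistic \<nu> n m x y =
     real n * real m / (sqrt 2 * (real n + real m)) * inverse (s_hat \<nu> n m x y) *
     mmd_estimate \<nu> n m x y"

definition normal_upper_quantile :: "real \<Rightarrow> real" where
  "normal_upper_quantile \<alpha> =
     (THE z. measure (density lborel (\<lambda>t. ennreal (std_normal_density t))) {z<..} = \<alpha>)"

definition hom_test :: "real \<Rightarrow> real \<Rightarrow> nat \<Rightarrow> nat \<Rightarrow> 'd::finite two_sample_test" where
  "hom_test \<nu> \<alpha> n m x y \<longleftrightarrow> hom_statistic \<nu> n m x y > normal_upper_quantile \<alpha>"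

end

theory Submission
  imports Defs "HOL-Real_Asymp.Real_Asymp"
begin

text \<open>
  Write \<open>d\<close> for the dimension and \<open>f = p - q\<close>, and let \<open>E = gauss_energy \<nu> f\<close> be the
  double integral of \<open>f(x) f(y) G\<^sub>\<nu>(x, y)\<close>. The statistic \<open>mmd_estimate\<close> is an unbiased estimator of \<open>E\<close>.

  For the power of the Gaussian test, note that a Gaussian is a mixture of plane waves, so
  \<open>E = (\<pi>/\<nu>)\<^bsup>d/2\<^esup> \<integral> exp(-|\<omega>|\<^sup>2/4\<nu>) |F f(\<omega>)|\<^sup>2 d\<omega>\<close> (\<open>gauss_energy_spectral\<close>). Frequencies up to
  \<open>sqrt \<nu>\<close> are damped by a constant factor at most, and smoothness of order \<open>s\<close> allows at most \<open>\<nu>\<^bsup>-s\<^esup> (2M)\<^sup>2\<close> of the squared norm of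
  \<open>f\<close> above them; hence \<open>E\<close> is at least a constant times \<open>(\<pi>/\<nu>)\<^bsup>d/2\<^esup> (\<Delta>\<^sup>2 - 4M\<^sup>2 \<nu>\<^bsup>-s\<^esup>)\<close>
  (\<open>gauss_energy_lower_bound\<close>). On the other side, the Hoeffding decomposition of the estimator
  (\<open>variance_off_diagonal_sum\<close>) bounds its variance by \<open>4 (\<rho> E + \<rho>\<^sup>2)\<close> for the single noise level
  \<open>\<rho> = (1/n + 1/m) M (\<pi>/\<nu>)\<^bsup>d/4\<^esup>\<close>, and the random threshold of the test is of order \<open>\<rho>\<close> by Markov's inequality,
  because the part of the studentisation that is subtracted only lowers it. Chebyshev's inequality
  then turns \<open>\<rho>/E \<rightarrow> 0\<close> into power tending to one (\<open>reject_prob_ge\<close>), and for \<open>\<nu>\<close> of order \<open>n\<^bsup>4/(d+4s)\<^esup>\<close> the ratio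
  \<open>\<rho>/E\<close> is at most of order \<open>(n\<^bsup>2s/(d+4s)\<^esup> \<Delta>)\<^bsup>-2\<^esup>\<close> (\<open>hom_test_power_tendsto_1\<close>).

  The \<open>L\<^sub>2\<close> norm is compared with the Fourier side by the two inequalities between \<open>\<integral> f\<^sup>2\<close> and \<open>\<integral> |F f|\<^sup>2\<close>. Both
  follow from the spectral formula by letting the width of the Gaussian tend to zero. The first one uses
  Fatou's lemma, since at each point of continuity of \<open>f\<close> the smoothed function converges to \<open>f\<close>.

  To see that no test does better, take a flat Gaussian density \<open>p\<^sub>0\<close> of small Sobolev norm and add to it
  \<open>L\<^sup>d\<close> disjoint copies of a bump, of width \<open>1/L\<close> and height \<open>a = c L\<^bsup>-s\<^esup>\<close>, with arbitrary signs. All these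
  densities lie in the Sobolev ball (\<open>perturbation_sobolev\<close>) and have the same distance, of order \<open>L\<^bsup>-s\<^esup>\<close>, from \<open>p\<^sub>0\<close>.
  For independent random signs the likelihood ratio of the mixture against \<open>p\<^sub>0\<close> has second moment at most
  \<open>exp(C m\<^sup>2 a\<^sup>4 L\<^bsup>-d\<^esup>)\<close>, by the bound \<open>cosh x \<le> exp(x\<^sup>2/2)\<close>. For \<open>L\<close> of order \<open>n\<^bsup>2/(d+4s)\<^esup>\<close> this is a constant \<open>D\<close>,
  and a test whose level is small compared with \<open>1/D\<close> cannot reject the mixture with probability above
  \<open>3/4\<close> (\<open>reject_prob_mixture_le\<close>, \<open>hom_power_le_mixture\<close>, \<open>minimax_lower_bound\<close>).
\<close>

section \<open>Gaussian integrals in several dimensions\<close>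

lemma measurable_vec_lambda:
  "vec_lambda \<in> (\<Pi>\<^sub>M i\<in>(UNIV::'d::finite set). (lborel :: real measure)) \<rightarrow>\<^sub>M borel"
  by (subst borel_measurable_euclidean_space) (auto simp: Basis_vec_def inner_axis)

lemma lborel_vec_eq_distr_PiM:
  "(lborel :: (real ^ 'd::finite) measure) =
     distr (\<Pi>\<^sub>M i\<in>UNIV. lborel) borel vec_lambda"
proof (rule lborel_eqI)
  interpret product_sigma_finite "\<lambda>_::'d. lborel :: real measure" by standard
  have meas: "vec_lambda \<in> (\<Pi>\<^sub>M i\<in>(UNIV::'d set). (lborel :: real measure)) \<rightarrow>\<^sub>M borel"
    by (rule measurable_vec_lambda)
  fix l u :: "real ^ 'd"
  assume le: "\<And>b. b \<in> Basis \<Longrightarrow> l \<bullet> b \<le> u \<bullet> b"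
  have le': "l $ i \<le> u $ i" for i
    using le[of "axis i 1"] by (auto simp: Basis_vec_def inner_axis)
  have Basis: "(Basis :: (real ^ 'd) set) = (\<lambda>i. axis i 1) ` UNIV"
    by (auto simp: Basis_vec_def)
  have inj: "inj (\<lambda>i::'d. axis i (1::real))"
    by (auto simp: inj_on_def axis_eq_axis)
  have "vec_lambda -` box l u \<inter> space (\<Pi>\<^sub>M i\<in>UNIV. lborel) =
    (\<Pi>\<^sub>E i\<in>UNIV. {l $ i <..< u $ i})"
    by (auto simp: space_PiM mem_box_cart PiE_def Pi_def)
  then have "emeasure (distr (\<Pi>\<^sub>M i\<in>UNIV. lborel) borel vec_lambda) (box l u) =
     (\<Prod>i\<in>UNIV. emeasure lborel {l $ i <..< u $ i})"
    using meas by (simp add: emeasure_distr emeasure_PiM)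
  also have "\<dots> = ennreal (\<Prod>i\<in>UNIV. u $ i - l $ i)"
    using le' by (simp add: prod_ennreal)
  also have "(\<Prod>i\<in>UNIV. u $ i - l $ i) = (\<Prod>b\<in>Basis. (u - l) \<bullet> b)"
    unfolding Basis by (subst prod.reindex[OF inj]) (simp add: inner_axis)
  finally show "emeasure (distr (\<Pi>\<^sub>M i\<in>UNIV. lborel) borel vec_lambda) (box l u)
    = ennreal (\<Prod>b\<in>Basis. (u - l) \<bullet> b)" .
qed simp

lemma has_integral_coordinate_product:
  fixes f :: "'d::finite \<Rightarrow> real \<Rightarrow> 'b::{real_normed_field,banach,second_countable_topology}"
  assumes "\<And>i. integrable lborel (f i)"
  shows integrable_coordinate_product: "integrable lborel (\<lambda>x::real^'d. \<Prod>i\<in>UNIV. f i (x $ i))"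
    and integral_coordinate_product: 
      "(LINT x|lborel. (\<Prod>i\<in>UNIV. f i ((x::real^'d) $ i))) = (\<Prod>i\<in>UNIV. LINT t|lborel. f i t)"
proof -
  interpret product_sigma_finite "\<lambda>_::'d. lborel :: real measure" by standard
  have meas: "vec_lambda \<in> (\<Pi>\<^sub>M i\<in>(UNIV::'d set). (lborel :: real measure)) \<rightarrow>\<^sub>M borel"
    by (rule measurable_vec_lambda)
  have [measurable]: "f i \<in> borel_measurable borel" for i
    using borel_measurable_integrable[OF assms[of i]] by simp
  have m: "(\<lambda>x::real^'d. \<Prod>i\<in>UNIV. f i (x $ i)) \<in> borel_measurable borel"
    by measurable
  show "integrable lborel (\<lambda>x::real^'d. \<Prod>i\<in>UNIV. f i (x $ i))"
    unfolding lborel_vec_eq_distr_PiM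
    by (subst integrable_distr_eq[OF meas m]) (simp add: product_integrable_prod assms)
  show "(LINT x|lborel. (\<Prod>i\<in>UNIV. f i ((x::real^'d) $ i))) = (\<Prod>i\<in>UNIV. LINT t|lborel. f i t)"
    unfolding lborel_vec_eq_distr_PiM
    by (subst integral_distr[OF meas m]) (simp add: product_integral_prod assms)
qed

text \<open>The one-dimensional case is the characteristic function of the standard normal law after the substitution
  \<open>u \<mapsto> sqrt (2b) u\<close>.\<close>

lemma has_integral_gauss_cis:
  fixes b t :: real
  assumes "b > 0"
  shows integrable_gauss_cis: "integrable lborel (\<lambda>u. complex_of_real (exp (- b * u\<^sup>2)) * cis (t * u))"
    and integral_gauss_cis: "(LINT u|lborel. complex_of_real (exp (- b * u\<^sup>2)) * cis (t * u))
       = complex_of_real (sqrt (pi / b) * exp (- t\<^sup>2 / (4 * b)))"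
proof -
  define c where "c = sqrt (2 * b)"
  have c: "c > 0" "c\<^sup>2 = 2 * b" using assms by (auto simp: c_def)
  let ?g = "\<lambda>u. complex_of_real (std_normal_density u) * iexp ((t / c) * u)"
  have *: "char std_normal_distribution (t / c) = (LINT u|lborel. ?g u)"
    unfolding char_def by (subst integral_density) (auto simp: scaleR_conv_of_real)
  have int: "integrable lborel ?g"
    by (rule Bochner_Integration.integrable_bound[OF integrable_normal_density[of 1 0]]) 
       (auto simp: norm_mult normal_density_nonneg)
  have eq: "complex_of_real (exp (- b * u\<^sup>2)) * cis (t * u) = sqrt (2 * pi) * ?g (0 + c * u)" for u
  proof -
    have "std_normal_density (c * u) = exp (- b * u\<^sup>2) / sqrt (2 * pi)"
      using c by (simp add: std_normal_density_def power_mult_distrib)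
    moreover have "iexp ((t / c) * (c * u)) = cis (t * u)"
      using c by (simp add: cis_conv_exp)
    ultimately show ?thesis by simp
  qed
  have i2: "integrable lborel (\<lambda>u. ?g (0 + c * u))"
    using int lborel_integrable_real_affine_iff[of c ?g 0] c by simp
  show "integrable lborel (\<lambda>u. complex_of_real (exp (- b * u\<^sup>2)) * cis (t * u))"
    unfolding eq using i2 by (intro integrable_mult_right) auto
  have "(LINT u|lborel. ?g u) = \<bar>c\<bar> *\<^sub>R (LINT u|lborel. ?g (0 + c * u))"
    using c by (intro lborel_integral_real_affine) auto
  then have "(LINT u|lborel. ?g (0 + c * u)) = complex_of_real (exp (- (t / c)\<^sup>2 / 2)) / c"
    using * c by (simp add: char_std_normal_distribution scaleR_conv_of_real field_simps)
  moreover have "sqrt (2 * pi) / c = sqrt (pi / b)"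
    using assms by (simp add: c_def flip: real_sqrt_divide)
  moreover have "- (t / c)\<^sup>2 / 2 = - t\<^sup>2 / (4 * b)"
    using c by (simp add: power_divide)
  ultimately have **: "(LINT u|lborel. ?g (0 + c * u)) = complex_of_real (exp (- t\<^sup>2 / (4 * b))) / c"
    and ***: "sqrt (2 * pi) = c * sqrt (pi / b)"
    using c by (simp_all add: field_simps)
  have "(LINT u|lborel. complex_of_real (exp (- b * u\<^sup>2)) * cis (t * u))
     = sqrt (2 * pi) * (LINT u|lborel. ?g (0 + c * u))"
    unfolding eq by (rule integral_mult_right_zero)
  also have "\<dots> = complex_of_real (sqrt (pi / b) * exp (- t\<^sup>2 / (4 * b)))"
    unfolding ** *** using c by simp
  finally show "(LINT u|lborel. complex_of_real (exp (- b * u\<^sup>2)) * cis (t * u))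
       = complex_of_real (sqrt (pi / b) * exp (- t\<^sup>2 / (4 * b)))" .
qed

lemma norm_sq_eq_sum_sq: "(norm (x :: real ^ 'd::finite))\<^sup>2 = (\<Sum>i\<in>UNIV. (x $ i)\<^sup>2)"
  by (simp add: norm_vec_def L2_set_def sum_nonneg)

lemma cis_sum: "finite A \<Longrightarrow> cis (\<Sum>i\<in>A. f i) = (\<Prod>i\<in>A. cis (f i))"
  by (induction A rule: finite_induct) (auto simp: cis_mult[symmetric])

lemma has_integral_gauss_cis_vec:
  fixes z :: "real ^ 'd::finite"
  assumes "b > 0"
  shows integrable_gauss_cis_vec: "integrable lborel (\<lambda>x::real^'d. complex_of_real (exp (- b * (norm x)\<^sup>2)) * cis (z \<bullet> x))"
    and integral_gauss_cis_vec: "(LINT x|lborel. complex_of_real (exp (- b * (norm (x::real^'d))\<^sup>2)) * cis (z \<bullet> x))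
       = complex_of_real ((pi / b) powr (real CARD('d) / 2) * exp (- (norm z)\<^sup>2 / (4 * b)))"
proof -
  let ?f = "\<lambda>i u. complex_of_real (exp (- b * u\<^sup>2)) * cis (z $ i * u)"
  have eq: "complex_of_real (exp (- b * (norm x)\<^sup>2)) * cis (z \<bullet> x) = (\<Prod>i\<in>UNIV. ?f i (x $ i))" for x
    by (simp add: norm_sq_eq_sum_sq inner_vec_def cis_sum prod.distrib sum_distrib_left exp_sum
       flip: sum_negf)
  show "integrable lborel (\<lambda>x::real^'d. complex_of_real (exp (- b * (norm x)\<^sup>2)) * cis (z \<bullet> x))"
    unfolding eq by (intro integrable_coordinate_product integrable_gauss_cis assms)
  have "(LINT x|lborel. complex_of_real (exp (- b * (norm (x::real^'d))\<^sup>2)) * cis (z \<bullet> x))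
     = (\<Prod>i\<in>UNIV. complex_of_real (sqrt (pi / b) * exp (- (z $ i)\<^sup>2 / (4 * b))))"
    unfolding eq by (subst integral_coordinate_product) 
      (rule integrable_gauss_cis[OF assms], simp only: integral_gauss_cis[OF assms])
  also have "\<dots> = complex_of_real (sqrt (pi / b) ^ CARD('d) * exp (- (norm z)\<^sup>2 / (4 * b)))"
    by (simp add: prod.distrib norm_sq_eq_sum_sq exp_sum sum_divide_distrib sum_negf[symmetric] del: sum_negf)
  also have "sqrt (pi / b) ^ CARD('d) = (pi / b) powr (real CARD('d) / 2)"
    using assms by (simp add: powr_half_sqrt[symmetric] powr_powr powr_realpow[symmetric])
  finally show "(LINT x|lborel. complex_of_real (exp (- b * (norm (x::real^'d))\<^sup>2)) * cis (z \<bullet> x))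
       = complex_of_real ((pi / b) powr (real CARD('d) / 2) * exp (- (norm z)\<^sup>2 / (4 * b)))" .
qed

lemma
  fixes z :: "real ^ 'd::finite"
  assumes "b > 0"
  shows integrable_gauss_vec: "integrable lborel (\<lambda>x::real^'d. exp (- b * (norm x)\<^sup>2))"
    and integral_gauss_vec: "(LINT x|lborel. exp (- b * (norm (x::real^'d))\<^sup>2)) = (pi / b) powr (real CARD('d) / 2)"
    and integral_gauss_cos_vec: "(LINT x|lborel. exp (- b * (norm (x::real^'d))\<^sup>2) * cos (z \<bullet> x))
       = (pi / b) powr (real CARD('d) / 2) * exp (- (norm z)\<^sup>2 / (4 * b))"
proof -
  have "integrable lborel (\<lambda>x::real^'d. Re (complex_of_real (exp (- b * (norm x)\<^sup>2)) * cis (0 \<bullet> x)))"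
    by (intro integrable_Re integrable_gauss_cis_vec assms)
  then show "integrable lborel (\<lambda>x::real^'d. exp (- b * (norm x)\<^sup>2))" by simp
  have *: "(LINT x|lborel. exp (- b * (norm (x::real^'d))\<^sup>2) * cos (z \<bullet> x))
       = (pi / b) powr (real CARD('d) / 2) * exp (- (norm z)\<^sup>2 / (4 * b))" for z
    using arg_cong[OF integral_gauss_cis_vec[OF assms, of z], of Re]
    by (subst (asm) integral_Re[symmetric, OF integrable_gauss_cis_vec[OF assms]]) simp
  show "(LINT x|lborel. exp (- b * (norm (x::real^'d))\<^sup>2) * cos (z \<bullet> x))
       = (pi / b) powr (real CARD('d) / 2) * exp (- (norm z)\<^sup>2 / (4 * b))" by (rule *)
  show "(LINT x|lborel. exp (- b * (norm (x::real^'d))\<^sup>2)) = (pi / b) powr (real CARD('d) / 2)" 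
    using *[of 0] by simp
qed

lemma (in pair_sigma_finite) integrable_mult_prod:
  fixes f :: "'a \<Rightarrow> real" and g :: "'b \<Rightarrow> real"
  assumes f: "integrable M1 f" and g: "integrable M2 g"
  shows "integrable (M1 \<Otimes>\<^sub>M M2) (\<lambda>(x, y). f x * g y)"
proof (rule Fubini_integrable)
  have [measurable]: "f \<in> borel_measurable M1" "g \<in> borel_measurable M2"
    using f g by auto
  show "(\<lambda>(x, y). f x * g y) \<in> borel_measurable (M1 \<Otimes>\<^sub>M M2)" by measurable
  show "integrable M1 (\<lambda>x. \<integral>y. norm (case (x, y) of (x, y) \<Rightarrow> f x * g y) \<partial>M2)"
    using f by (simp add: abs_mult)
  show "AE x in M1. integrable M2 (\<lambda>y. case (x, y) of (x, y) \<Rightarrow> f x * g y)"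
    using g by simp
qed

lemma
  fixes g :: "'a::euclidean_space \<Rightarrow> real"
  assumes "integrable lborel g"
  shows integrable_double: "integrable (lborel \<Otimes>\<^sub>M lborel) (\<lambda>z. g (fst z) * g (snd z))"
    and integral_square_eq_double:
      "(integral\<^sup>L lborel g)\<^sup>2 = (LINT z|(lborel \<Otimes>\<^sub>M lborel). g (fst z) * g (snd z))"
  using lborel_pair.integral_fst[OF lborel_pair.integrable_mult_prod[OF assms assms]]
    lborel_pair.integrable_mult_prod[OF assms assms]
  by (simp_all add: case_prod_unfold power2_eq_square)

text \<open>The inequality for nonnegative integrals carries over once the product is known to be integrable, which is
  \<open>2|fg| \<le> f\<^sup>2 + g\<^sup>2\<close>.\<close>

lemma Cauchy_Schwarz_integral:
  fixes f g :: "'a \<Rightarrow> real"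
  assumes [measurable]: "f \<in> borel_measurable M" "g \<in> borel_measurable M"
    and f: "integrable M (\<lambda>x. (f x)\<^sup>2)" and g: "integrable M (\<lambda>x. (g x)\<^sup>2)"
  shows "integrable M (\<lambda>x. f x * g x)"
    and "(LINT x|M. \<bar>f x * g x\<bar>)\<^sup>2 \<le> (LINT x|M. (f x)\<^sup>2) * (LINT x|M. (g x)\<^sup>2)"
proof -
  have "\<bar>f x * g x\<bar> \<le> \<bar>(f x)\<^sup>2 + (g x)\<^sup>2\<bar>" for x
  proof -
    have "2 * (\<bar>f x\<bar> * \<bar>g x\<bar>) \<le> \<bar>f x\<bar>\<^sup>2 + \<bar>g x\<bar>\<^sup>2"
      using sum_squares_bound[of "\<bar>f x\<bar>" "\<bar>g x\<bar>"] by simp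
    moreover have "0 \<le> \<bar>f x\<bar> * \<bar>g x\<bar>" by simp
    ultimately show ?thesis unfolding abs_mult power2_abs by linarith
  qed
  then show i: "integrable M (\<lambda>x. f x * g x)"
    by (intro Bochner_Integration.integrable_bound[OF Bochner_Integration.integrable_add[OF f g]]) auto
  have "ennreal ((LINT x|M. \<bar>f x * g x\<bar>)\<^sup>2) = (\<integral>\<^sup>+x. ennreal \<bar>f x\<bar> * ennreal \<bar>g x\<bar> \<partial>M)\<^sup>2"
    using integrable_abs[OF i] by (subst ennreal_power[symmetric], simp, subst nn_integral_eq_integral[symmetric])
       (auto simp: abs_mult ennreal_mult)
  also have "\<dots> \<le> (\<integral>\<^sup>+x. (ennreal \<bar>f x\<bar>)^2 \<partial>M) * (\<integral>\<^sup>+x. (ennreal \<bar>g x\<bar>)^2 \<partial>M)"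
    by (rule Cauchy_Schwarz_nn_integral) auto
  also have "\<dots> = ennreal ((LINT x|M. (f x)\<^sup>2) * (LINT x|M. (g x)\<^sup>2))"
    using f g by (simp add: ennreal_power nn_integral_eq_integral ennreal_mult)
  finally show "(LINT x|M. \<bar>f x * g x\<bar>)\<^sup>2 \<le> (LINT x|M. (f x)\<^sup>2) * (LINT x|M. (g x)\<^sup>2)"
    by simp
qed

section \<open>Gaussian smoothing and its energy\<close>

lemma gauss_kernel_measurable [measurable (raw)]:
  assumes "f \<in> borel_measurable M" "g \<in> borel_measurable M"
  shows "(\<lambda>x. gauss_kernel \<nu> (f x) (g x :: real ^ 'd::finite)) \<in> borel_measurable M"
  using assms unfolding gauss_kernel_def by measurable

lemma gauss_kernel_nonneg [simp]: "0 \<le> gauss_kernel \<nu> x y"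
  by (simp add: gauss_kernel_def)

lemma gauss_kernel_le_1: "0 < \<nu> \<Longrightarrow> gauss_kernel \<nu> x y \<le> 1"
  by (simp add: gauss_kernel_def)

lemma gauss_kernel_abs_le_1: "0 < \<nu> \<Longrightarrow> \<bar>gauss_kernel \<nu> x y\<bar> \<le> 1"
  by (simp add: gauss_kernel_le_1)

lemma gauss_kernel_sym: "gauss_kernel \<nu> x y = gauss_kernel \<nu> y x"
  by (simp add: gauss_kernel_def norm_minus_commute)

lemma has_integral_translate_lborel:
  fixes f :: "'a::euclidean_space \<Rightarrow> real"
  assumes [measurable]: "f \<in> borel_measurable borel"
  shows integrable_translate_lborel: "integrable lborel (\<lambda>x. f (c + x)) \<longleftrightarrow> integrable lborel f"
    and integral_translate_lborel: "(LINT x|lborel. f (c + x)) = (LINT x|lborel. f x)"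
proof -
  show "integrable lborel (\<lambda>x. f (c + x)) \<longleftrightarrow> integrable lborel f"
    by (subst (2) lborel_distr_plus[of c, symmetric], subst integrable_distr_eq) auto
  show "(LINT x|lborel. f (c + x)) = (LINT x|lborel. f x)"
    by (subst (2) lborel_distr_plus[of c, symmetric], subst integral_distr) auto
qed

lemma
  fixes x :: "real ^ 'd::finite"
  assumes "\<tau> > 0"
  shows integrable_gauss_kernel: "integrable lborel (\<lambda>y. gauss_kernel \<tau> x y)"
    and integral_gauss_kernel: "(LINT y|lborel. gauss_kernel \<tau> x y) = (pi / \<tau>) powr (real CARD('d) / 2)"
proof -
  have eq: "gauss_kernel \<tau> x y = exp (- \<tau> * (norm (- x + y))\<^sup>2)" for y
    by (simp add: gauss_kernel_def norm_minus_commute)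
  show "integrable lborel (\<lambda>y. gauss_kernel \<tau> x y)"
    unfolding eq by (subst integrable_translate_lborel) (auto intro!: integrable_gauss_vec[OF assms, simplified])
  show "(LINT y|lborel. gauss_kernel \<tau> x y) = (pi / \<tau>) powr (real CARD('d) / 2)"
    unfolding eq by (subst integral_translate_lborel[of "\<lambda>y. exp (- \<tau> * (norm y)\<^sup>2)"])
      (auto simp: integral_gauss_vec[OF assms, simplified])
qed

text \<open>Completing the square: \<open>|t - x|\<^sup>2 + |t - y|\<^sup>2\<close> splits into the distance of \<open>x\<close> and \<open>y\<close> and the distance of
  \<open>t\<close> from their midpoint. Integrated over \<open>t\<close>, this says that a Gaussian kernel is a multiple of the
  convolution of two narrower ones; it makes \<open>G\<^sub>\<tau>\<close> a multiple of the Gram kernel of the functions \<open>t \<mapsto> G\<^bsub>2\<tau>\<^esub>(t, x)\<close>.\<close>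

lemma gauss_kernel_mult:
  "gauss_kernel \<tau> t x * gauss_kernel \<tau> t y =
     gauss_kernel (\<tau> / 2) x y * gauss_kernel (2 * \<tau>) ((1 / 2) *\<^sub>R (x + y)) t"
proof -
  have "(norm (t - x))\<^sup>2 + (norm (t - y))\<^sup>2 =
      (norm (x - y))\<^sup>2 / 2 + 2 * (norm ((1 / 2) *\<^sub>R (x + y) - t))\<^sup>2"
    unfolding power2_norm_eq_inner by (simp add: inner_diff_left inner_diff_right inner_add_left
       inner_add_right inner_commute field_simps)
  then have "- \<tau> * (norm (t - x))\<^sup>2 + - \<tau> * (norm (t - y))\<^sup>2 =
     - (\<tau> / 2) * (norm (x - y))\<^sup>2 + - (2 * \<tau>) * (norm ((1 / 2) *\<^sub>R (x + y) - t))\<^sup>2"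
    by (simp add: algebra_simps flip: distrib_left)
  then show ?thesis unfolding gauss_kernel_def by (simp flip: exp_add)
qed

lemma
  fixes x y :: "real ^ 'd::finite"
  assumes "\<tau> > 0"
  shows integrable_gauss_kernel_mult: "integrable lborel (\<lambda>t. gauss_kernel \<tau> t x * gauss_kernel \<tau> t y)"
    and integral_gauss_kernel_mult: "(LINT t|lborel. gauss_kernel \<tau> t x * gauss_kernel \<tau> t y)
         = (pi / (2 * \<tau>)) powr (real CARD('d) / 2) * gauss_kernel (\<tau> / 2) x y"
  using assms by (simp_all add: gauss_kernel_mult integrable_gauss_kernel integral_gauss_kernel)

definition gauss_smooth :: "real \<Rightarrow> (real ^ 'd \<Rightarrow> real) \<Rightarrow> real ^ 'd \<Rightarrow> real" where
  "gauss_smooth \<tau> f x = (LINT y|lborel. gauss_kernel \<tau> x y * f y)"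

text \<open>For \<open>f = p - q\<close> this is the squared maximum mean discrepancy of the Gaussian kernel, the quantity that the test
  statistic estimates.\<close>

definition gauss_energy :: "real \<Rightarrow> (real ^ 'd \<Rightarrow> real) \<Rightarrow> real" where
  "gauss_energy \<tau> f = (LINT x|lborel. f x * gauss_smooth \<tau> f x)"

lemma integrable_bounded_mult:
  fixes f g :: "'a \<Rightarrow> real"
  assumes "integrable M f" "g \<in> borel_measurable M" "\<And>x. \<bar>g x\<bar> \<le> B"
  shows "integrable M (\<lambda>x. g x * f x)"
proof (rule Bochner_Integration.integrable_bound)
  show "integrable M (\<lambda>x. B * f x)" using assms by simp
  show "AE x in M. norm (g x * f x) \<le> norm (B * f x)"
    using assms(3) by (intro AE_I2) (auto simp: abs_mult intro!: mult_right_mono intro: order_trans[OF _ abs_ge_self])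
qed (use assms in auto)

lemma integrable_gauss_kernel_mult_fun:
  fixes f :: "real ^ 'd::finite \<Rightarrow> real"
  assumes "integrable lborel f" "\<tau> > 0"
  shows "integrable lborel (\<lambda>y. gauss_kernel \<tau> x y * f y)"
  by (rule integrable_bounded_mult[OF assms(1), where B=1]) (use assms gauss_kernel_abs_le_1 in auto)

lemma gauss_smooth_measurable [measurable]:
  fixes f :: "real ^ 'd::finite \<Rightarrow> real"
  assumes "f \<in> borel_measurable borel"
  shows "gauss_smooth \<tau> f \<in> borel_measurable borel"
  unfolding gauss_smooth_def using assms by measurable

lemma gauss_smooth_diff:
  fixes f g :: "real ^ 'd::finite \<Rightarrow> real"
  assumes "integrable lborel f" "integrable lborel g" "\<tau> > 0"
  shows "gauss_smooth \<tau> (\<lambda>x. f x - g x) x = gauss_smooth \<tau> f x - gauss_smooth \<tau> g x"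
  unfolding gauss_smooth_def right_diff_distrib
  by (intro Bochner_Integration.integral_diff integrable_gauss_kernel_mult_fun assms)

text \<open>The double integral over the product space is the form in which Fubini's theorem can exchange the integration
  with further variables.\<close>

lemma gauss_energy_double:
  fixes f :: "real ^ 'd::finite \<Rightarrow> real"
  assumes f: "integrable lborel f" and "\<tau> > 0"
  shows "integrable (lborel \<Otimes>\<^sub>M lborel) (\<lambda>(x, y). gauss_kernel \<tau> x y * (f x * f y))"
    and "gauss_energy \<tau> f = (LINT z|(lborel \<Otimes>\<^sub>M lborel). gauss_kernel \<tau> (fst z) (snd z) * (f (fst z) * f (snd z)))"
proof -
  have [measurable]: "f \<in> borel_measurable borel" using f by auto
  have "integrable (lborel \<Otimes>\<^sub>M lborel) (\<lambda>z. gauss_kernel \<tau> (fst z) (snd z) * (case z of (x, y) \<Rightarrow> f x * f y))"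
    by (rule integrable_bounded_mult[OF lborel_pair.integrable_mult_prod[OF f f], where B=1])
       (use gauss_kernel_abs_le_1[OF assms(2)] in auto)
  then show *: "integrable (lborel \<Otimes>\<^sub>M lborel) (\<lambda>(x, y). gauss_kernel \<tau> x y * (f x * f y))"
    by (simp add: case_prod_unfold)
  have "gauss_energy \<tau> f = (LINT x|lborel. LINT y|lborel. gauss_kernel \<tau> x y * (f x * f y))"
    unfolding gauss_energy_def gauss_smooth_def
    by (intro Bochner_Integration.integral_cong refl, subst integral_mult_right_zero[symmetric])
       (simp add: algebra_simps)
  also have "\<dots> = (LINT z|(lborel \<Otimes>\<^sub>M lborel). gauss_kernel \<tau> (fst z) (snd z) * (f (fst z) * f (snd z)))"
    using lborel_pair.integral_fst[OF *] by (simp add: case_prod_unfold)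
  finally show "gauss_energy \<tau> f = \<dots>" .
qed

section \<open>The energy on the Fourier side\<close>

lemma fourier_measurable [measurable]:
  fixes f :: "real ^ 'd::finite \<Rightarrow> real"
  assumes "f \<in> borel_measurable borel"
  shows "fourier f \<in> borel_measurable borel"
  unfolding fourier_def using assms by measurable

lemma integrable_fourier_integrand:
  fixes f :: "real ^ 'd::finite \<Rightarrow> real"
  assumes "integrable lborel f"
  shows "integrable lborel (\<lambda>x. complex_of_real (f x) * exp (- (\<i> * complex_of_real (x \<bullet> \<omega>))))"
proof (rule Bochner_Integration.integrable_bound[OF assms])
  have [measurable]: "f \<in> borel_measurable borel" using assms by auto
  show "(\<lambda>x. complex_of_real (f x) * exp (- (\<i> * complex_of_real (x \<bullet> \<omega>)))) \<in> borel_measurable lborel"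
    by measurable
  show "AE x in lborel. norm (complex_of_real (f x) * exp (- (\<i> * complex_of_real (x \<bullet> \<omega>)))) \<le> norm (f x)"
    by (simp add: norm_mult)
qed

lemma fourier_linear:
  fixes f g :: "real ^ 'd::finite \<Rightarrow> real"
  assumes "integrable lborel f" "integrable lborel g"
  shows "fourier (\<lambda>x. f x + c * g x) \<omega> = fourier f \<omega> + c * fourier g \<omega>"
proof -
  have "complex_of_real (f x + c * g x) * exp (- (\<i> * complex_of_real (x \<bullet> \<omega>))) =
    complex_of_real (f x) * exp (- (\<i> * complex_of_real (x \<bullet> \<omega>))) +
    c * (complex_of_real (g x) * exp (- (\<i> * complex_of_real (x \<bullet> \<omega>))))" for x
    by (simp add: algebra_simps)
  then show ?thesis
    unfolding fourier_def using assms
    by (simp add: integrable_fourier_integrand algebra_simps)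
qed

text \<open>The squared modulus is the product of the transform with its conjugate, hence a double integral in which the real
  part \<open>cos((x - y) \<bullet> \<omega>)\<close> of the phase survives because the weight \<open>f(x) f(y)\<close> is symmetric. Having it as a
  real integral lets all exchanges of integration below take place over the reals.\<close>

lemma cmod_fourier_sq:
  fixes f :: "real ^ 'd::finite \<Rightarrow> real"
  assumes f: "integrable lborel f"
  shows "(cmod (fourier f \<omega>))\<^sup>2 = (2 * pi) powr (- real CARD('d)) *
     (LINT z|(lborel \<Otimes>\<^sub>M lborel). cos ((fst z - snd z) \<bullet> \<omega>) * (f (fst z) * f (snd z)))"
proof -
  have [measurable]: "f \<in> borel_measurable borel" using f by auto
  let ?g = "\<lambda>x. complex_of_real (f x) * exp (- (\<i> * complex_of_real (x \<bullet> \<omega>)))"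
  define C where "C = (LINT x|lborel. f x * cos (x \<bullet> \<omega>))"
  define S where "S = (LINT x|lborel. f x * sin (x \<bullet> \<omega>))"
  note ig = integrable_fourier_integrand[OF f, of \<omega>]
  have Re: "Re (integral\<^sup>L lborel ?g) = C" 
    unfolding C_def integral_Re[OF ig, symmetric] by (simp add: Re_exp)
  have Im: "Im (integral\<^sup>L lborel ?g) = - S"
    unfolding S_def integral_Im[OF ig, symmetric] by (simp add: Im_exp)
  have ic: "integrable lborel (\<lambda>x. f x * cos (x \<bullet> \<omega>))"
    using integrable_bounded_mult[OF f, of "\<lambda>x. cos (x \<bullet> \<omega>)" 1] by (simp add: mult.commute)
  have isn: "integrable lborel (\<lambda>x. f x * sin (x \<bullet> \<omega>))"
    using integrable_bounded_mult[OF f, of "\<lambda>x. sin (x \<bullet> \<omega>)" 1] by (simp add: mult.commute)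
  have "(LINT z|(lborel \<Otimes>\<^sub>M lborel). cos ((fst z - snd z) \<bullet> \<omega>) * (f (fst z) * f (snd z)))
     = C\<^sup>2 + S\<^sup>2"
    unfolding C_def S_def integral_square_eq_double[OF ic] integral_square_eq_double[OF isn]
    by (subst Bochner_Integration.integral_add[symmetric, OF integrable_double[OF ic] integrable_double[OF isn]])
       (simp add: inner_diff_left cos_diff algebra_simps)
  moreover have "(cmod (fourier f \<omega>))\<^sup>2 = ((2 * pi) powr (- real CARD('d) / 2))\<^sup>2 * (C\<^sup>2 + S\<^sup>2)"
    unfolding fourier_def norm_mult power_mult_distrib using Re Im 
    by (simp add: cmod_power2)
  moreover have "((2 * pi) powr (- real CARD('d) / 2))\<^sup>2 = (2 * pi) powr (- real CARD('d))"
    by (simp add: powr_power)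
  ultimately show ?thesis by simp
qed

lemma fourier_bounded:
  fixes f :: "real ^ 'd::finite \<Rightarrow> real"
  shows "cmod (fourier f \<omega>) \<le> (2 * pi) powr (- real CARD('d) / 2) * (LINT x|lborel. \<bar>f x\<bar>)"
proof -
  have "cmod (LINT x|lborel. complex_of_real (f x) * exp (- (\<i> * complex_of_real (x \<bullet> \<omega>))))
    \<le> (LINT x|lborel. \<bar>f x\<bar>)"
    by (rule order_trans[OF integral_norm_bound]) (simp add: norm_mult)
  then show ?thesis unfolding fourier_def norm_mult by (simp add: mult_left_mono)
qed

text \<open>Inserting \<open>exp(-\<tau>|z|\<^sup>2) = (4\<pi>\<tau>)\<^bsup>-d/2\<^esup> \<integral> exp(-|\<omega>|\<^sup>2/4\<tau>) cos(z \<bullet> \<omega>) d\<omega>\<close> for the kernel and integrating over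
  the two space variables first leaves the squared modulus of the Fourier transform.\<close>

lemma gauss_energy_spectral:
  fixes f :: "real ^ 'd::finite \<Rightarrow> real"
  assumes f: "integrable lborel f" and \<tau>: "\<tau> > 0"
  shows "integrable lborel (\<lambda>\<omega>. exp (- (norm \<omega>)\<^sup>2 / (4 * \<tau>)) * (cmod (fourier f \<omega>))\<^sup>2)"
    and "gauss_energy \<tau> f = (pi / \<tau>) powr (real CARD('d) / 2) *
       (LINT \<omega>|lborel. exp (- (norm \<omega>)\<^sup>2 / (4 * \<tau>)) * (cmod (fourier f \<omega>))\<^sup>2)"
proof -
  have [measurable]: "f \<in> borel_measurable borel" using f by auto
  define W :: "real ^ 'd \<Rightarrow> real" where "W = (\<lambda>\<omega>. exp (- (1 / (4 * \<tau>)) * (norm \<omega>)\<^sup>2))"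
  have [measurable]: "W \<in> borel_measurable borel" unfolding W_def by measurable
  have W: "exp (- (norm \<omega>)\<^sup>2 / (4 * \<tau>)) = W \<omega>" for \<omega> by (simp add: W_def)
  have iW: "integrable lborel W" unfolding W_def using \<tau> by (intro integrable_gauss_vec) auto
  show "integrable lborel (\<lambda>\<omega>. exp (- (norm \<omega>)\<^sup>2 / (4 * \<tau>)) * (cmod (fourier f \<omega>))\<^sup>2)"
  proof -
    let ?B = "((2 * pi) powr (- real CARD('d) / 2) * (LINT x|lborel. \<bar>f x\<bar>))\<^sup>2"
    have "integrable lborel (\<lambda>\<omega>. (cmod (fourier f \<omega>))\<^sup>2 * W \<omega>)"
    proof (rule integrable_bounded_mult[OF iW])
      show "\<bar>(cmod (fourier f \<omega>))\<^sup>2\<bar> \<le> ?B" for \<omega>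
        using power_mono[OF fourier_bounded[of f \<omega>] norm_ge_zero, of 2] by simp
    qed measurable
    then show ?thesis unfolding W by (simp add: mult.commute)
  qed
  let ?H = "\<lambda>z::(real^'d)\<times>(real^'d). f (fst z) * f (snd z)"
  have iH: "integrable (lborel \<Otimes>\<^sub>M lborel) ?H"
    using lborel_pair.integrable_mult_prod[OF f f] by (simp add: case_prod_unfold)
  interpret P: pair_sigma_finite "lborel :: (real^'d) measure" "lborel \<Otimes>\<^sub>M lborel :: ((real^'d)\<times>(real^'d)) measure"
    unfolding lborel_prod ..
  let ?F = "\<lambda>\<omega> z. cos ((fst z - snd z) \<bullet> \<omega>) * (W \<omega> * ?H z)"
  have "integrable (lborel \<Otimes>\<^sub>M (lborel \<Otimes>\<^sub>M lborel)) (\<lambda>u. cos ((fst (snd u) - snd (snd u)) \<bullet> fst u) * 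
     (case u of (\<omega>, z) \<Rightarrow> W \<omega> * ?H z))"
    by (rule integrable_bounded_mult[OF P.integrable_mult_prod[OF iW iH], where B=1]) auto
  then have int: "integrable (lborel \<Otimes>\<^sub>M (lborel \<Otimes>\<^sub>M lborel)) (case_prod ?F)"
    by (simp add: case_prod_unfold)
  have "(LINT \<omega>|lborel. W \<omega> * (cmod (fourier f \<omega>))\<^sup>2) = 
      (2 * pi) powr (- real CARD('d)) * (LINT \<omega>|lborel. LINT z|(lborel \<Otimes>\<^sub>M lborel). ?F \<omega> z)"
    unfolding cmod_fourier_sq[OF f]
    by (subst integral_mult_right_zero[symmetric], intro Bochner_Integration.integral_cong refl,
        subst mult.left_commute, subst integral_mult_right_zero[symmetric]) (simp add: algebra_simps)
  also have "(LINT \<omega>|lborel. LINT z|(lborel \<Otimes>\<^sub>M lborel). ?F \<omega> z) = 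
       (LINT z|(lborel \<Otimes>\<^sub>M lborel). LINT \<omega>|lborel. ?F \<omega> z)"
    by (rule P.Fubini_integral[OF int, symmetric])
  also have "\<dots> = (LINT z|(lborel \<Otimes>\<^sub>M lborel). 
       (4 * pi * \<tau>) powr (real CARD('d) / 2) * (gauss_kernel \<tau> (fst z) (snd z) * ?H z))"
  proof (intro Bochner_Integration.integral_cong refl)
    fix z :: "(real^'d)\<times>(real^'d)"
    have "(LINT \<omega>|lborel. ?F \<omega> z) = (LINT \<omega>|lborel. W \<omega> * cos ((fst z - snd z) \<bullet> \<omega>)) * ?H z"
      by (subst integral_mult_left_zero[symmetric]) (simp add: algebra_simps)
    also have "(LINT \<omega>|lborel. W \<omega> * cos ((fst z - snd z) \<bullet> \<omega>)) = 
      (4 * pi * \<tau>) powr (real CARD('d) / 2) * gauss_kernel \<tau> (fst z) (snd z)"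
      unfolding W_def using \<tau> by (subst integral_gauss_cos_vec) (auto simp: gauss_kernel_def algebra_simps)
    finally show "(LINT \<omega>|lborel. ?F \<omega> z) = 
       (4 * pi * \<tau>) powr (real CARD('d) / 2) * (gauss_kernel \<tau> (fst z) (snd z) * ?H z)" by simp
  qed
  also have "\<dots> = (4 * pi * \<tau>) powr (real CARD('d) / 2) * gauss_energy \<tau> f"
    unfolding gauss_energy_double(2)[OF f \<tau>] by simp
  finally have eq: "(LINT \<omega>|lborel. W \<omega> * (cmod (fourier f \<omega>))\<^sup>2) = (2 * pi) powr (- real CARD('d)) *
     ((4 * pi * \<tau>) powr (real CARD('d) / 2) * gauss_energy \<tau> f)" .
  (* the normalisations cancel: (pi/tau) (4 pi tau) = (2 pi)^2 *)
  have "(pi / \<tau>) powr (real CARD('d) / 2) * ((2 * pi) powr (- real CARD('d)) * (4 * pi * \<tau>) powr (real CARD('d) / 2))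
    = ((pi / \<tau>) * (4 * pi * \<tau>)) powr (real CARD('d) / 2) * (2 * pi) powr (- real CARD('d))"
    using \<tau> by (subst powr_mult) auto
  also have "(pi / \<tau>) * (4 * pi * \<tau>) = (2 * pi) powr 2" using \<tau> by (simp add: power2_eq_square)
  also have "((2 * pi) powr 2) powr (real CARD('d) / 2) * (2 * pi) powr (- real CARD('d)) = 1"
    unfolding powr_powr powr_add[symmetric] by simp
  finally show "gauss_energy \<tau> f = (pi / \<tau>) powr (real CARD('d) / 2) *
       (LINT \<omega>|lborel. exp (- (norm \<omega>)\<^sup>2 / (4 * \<tau>)) * (cmod (fourier f \<omega>))\<^sup>2)"
    unfolding W eq by (simp add: mult.assoc[symmetric])
qed

text \<open>Smoothing twice with the kernel of parameter \<open>\<tau>\<close> is, up to a factor, smoothing once with parameter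
  \<open>\<tau>/2\<close>.\<close>

lemma
  fixes f :: "real ^ 'd::finite \<Rightarrow> real"
  assumes f: "integrable lborel f" and \<tau>: "\<tau> > 0"
  shows integrable_gauss_smooth_sq: "integrable lborel (\<lambda>t. (gauss_smooth \<tau> f t)\<^sup>2)"
    and integral_gauss_smooth_sq: "(LINT t|lborel. (gauss_smooth \<tau> f t)\<^sup>2) = 
      (pi / (2 * \<tau>)) powr (real CARD('d) / 2) * gauss_energy (\<tau> / 2) f"
proof -
  have [measurable]: "f \<in> borel_measurable borel" using f by auto
  let ?H = "\<lambda>z::(real^'d)\<times>(real^'d). f (fst z) * f (snd z)"
  let ?c = "(pi / (2 * \<tau>)) powr (real CARD('d) / 2)"
  interpret P: pair_sigma_finite "lborel \<Otimes>\<^sub>M lborel :: ((real^'d)\<times>(real^'d)) measure" "lborel :: (real^'d) measure"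
    unfolding lborel_prod ..
  let ?F = "\<lambda>z t. ?H z * (gauss_kernel \<tau> t (fst z) * gauss_kernel \<tau> t (snd z))"
  have iE: "integrable (lborel \<Otimes>\<^sub>M lborel) (\<lambda>z. gauss_kernel (\<tau> / 2) (fst z) (snd z) * ?H z)"
    using gauss_energy_double(1)[OF f, of "\<tau> / 2"] \<tau> by (simp add: case_prod_unfold)
  have int: "integrable ((lborel \<Otimes>\<^sub>M lborel) \<Otimes>\<^sub>M lborel) (case_prod ?F)"
  proof (rule P.Fubini_integrable)
    have "(\<integral>t. norm (?F z t) \<partial>lborel) = ?c * \<bar>gauss_kernel (\<tau> / 2) (fst z) (snd z) * ?H z\<bar>" for z
      using integral_gauss_kernel_mult[OF \<tau>, of "fst z" "snd z"] by (simp add: abs_mult)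
    then show "integrable (lborel \<Otimes>\<^sub>M lborel) (\<lambda>z. \<integral>t. norm (case (z, t) of (z, t) \<Rightarrow> ?F z t) \<partial>lborel)"
      using integrable_mult_right[OF integrable_abs[OF iE], of ?c] by simp
    show "AE z in lborel \<Otimes>\<^sub>M lborel. integrable lborel (\<lambda>t. case (z, t) of (z, t) \<Rightarrow> ?F z t)"
      unfolding prod.case by (intro AE_I2 integrable_mult_right integrable_gauss_kernel_mult \<tau>)
  qed simp
  have sq: "(gauss_smooth \<tau> f t)\<^sup>2 = (LINT z|(lborel \<Otimes>\<^sub>M lborel). ?F z t)" for t
    unfolding gauss_smooth_def integral_square_eq_double[OF integrable_gauss_kernel_mult_fun[OF f \<tau>]]
    by (simp add: algebra_simps)
  show "integrable lborel (\<lambda>t. (gauss_smooth \<tau> f t)\<^sup>2)"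
    unfolding sq by (rule P.integrable_snd[OF int])
  have "(LINT t|lborel. (gauss_smooth \<tau> f t)\<^sup>2) = (LINT z|(lborel \<Otimes>\<^sub>M lborel). LINT t|lborel. ?F z t)"
    unfolding sq by (rule P.Fubini_integral[OF int])
  also have "\<dots> = (LINT z|(lborel \<Otimes>\<^sub>M lborel). ?c * (gauss_kernel (\<tau> / 2) (fst z) (snd z) * ?H z))"
    using \<tau> by (simp add: integral_gauss_kernel_mult algebra_simps)
  also have "\<dots> = ?c * gauss_energy (\<tau> / 2) f"
    using \<tau> by (simp add: gauss_energy_double(2)[OF f])
  finally show "(LINT t|lborel. (gauss_smooth \<tau> f t)\<^sup>2) = ?c * gauss_energy (\<tau> / 2) f" .
qed

lemma gauss_energy_nonneg:
  fixes f :: "real ^ 'd::finite \<Rightarrow> real"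
  assumes f: "integrable lborel f" and \<tau>: "\<tau> > 0"
  shows "0 \<le> gauss_energy \<tau> f"
  unfolding gauss_energy_spectral[OF assms] by simp

text \<open>This is the reproducing property of the Gaussian kernel: \<open>gauss_smooth \<tau> f\<close> lies in its Hilbert space
  with squared norm \<open>gauss_energy \<tau> f\<close>, and evaluation at \<open>x\<close> has norm \<open>G\<^sub>\<tau>(x, x) = 1\<close>. Concretely,
  \<open>gauss_smooth \<tau> f x\<close> is, up to normalisation, the inner product of \<open>G\<^bsub>2\<tau>\<^esub>(x, \<cdot>)\<close> with
  \<open>gauss_smooth (2\<tau>) f\<close>, and the Cauchy-Schwarz inequality applies.\<close>

lemma gauss_smooth_sq_le_energy:
  fixes f :: "real ^ 'd::finite \<Rightarrow> real"
  assumes f: "integrable lborel f" and \<tau>: "\<tau> > 0"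
  shows "(gauss_smooth \<tau> f x)\<^sup>2 \<le> gauss_energy \<tau> f"
proof -
  have [measurable]: "f \<in> borel_measurable borel" using f by auto
  define c where "c = (pi / (4 * \<tau>)) powr (real CARD('d) / 2)"
  have c: "c > 0" using \<tau> by (simp add: c_def)
  have \<tau>2: "2 * \<tau> > 0" using \<tau> by simp
  let ?F = "\<lambda>y t. gauss_kernel (2 * \<tau>) t x * gauss_kernel (2 * \<tau>) t y * f y"
  have "integrable (lborel \<Otimes>\<^sub>M lborel) (\<lambda>u. gauss_kernel (2 * \<tau>) (snd u) (fst u) *
          (case u of (y, t) \<Rightarrow> f y * gauss_kernel (2 * \<tau>) x t))"
    by (rule integrable_bounded_mult[OF lborel_pair.integrable_mult_prod[OF f integrable_gauss_kernel[OF \<tau>2]], where B=1])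
       (use gauss_kernel_abs_le_1[OF \<tau>2] in auto)
  then have int: "integrable (lborel \<Otimes>\<^sub>M lborel) (case_prod ?F)"
    by (simp add: case_prod_unfold gauss_kernel_sym[of _ x] algebra_simps)
  have "c * gauss_smooth \<tau> f x = (LINT y|lborel. LINT t|lborel. ?F y t)"
  proof -
    have "c * (gauss_kernel \<tau> x y * f y) = (LINT t|lborel. ?F y t)" for y
      using integral_gauss_kernel_mult[OF \<tau>2, of x y] by (simp add: c_def)
    then show ?thesis unfolding gauss_smooth_def integral_mult_right_zero[symmetric]
      by (intro Bochner_Integration.integral_cong refl)
  qed
  also have "\<dots> = (LINT t|lborel. LINT y|lborel. ?F y t)"
    by (rule lborel_pair.Fubini_integral[OF int, symmetric])
  also have "\<dots> = (LINT t|lborel. gauss_kernel (2 * \<tau>) t x * gauss_smooth (2 * \<tau>) f t)"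
    unfolding gauss_smooth_def by (simp add: mult.assoc)
  finally have eq: "c * gauss_smooth \<tau> f x = (LINT t|lborel. gauss_kernel (2 * \<tau>) t x * gauss_smooth (2 * \<tau>) f t)" .
  have sq: "(gauss_kernel (2 * \<tau>) t x)\<^sup>2 = gauss_kernel (2 * \<tau>) t x * gauss_kernel (2 * \<tau>) t x" for t
    by (simp add: power2_eq_square)
  have "(c * gauss_smooth \<tau> f x)\<^sup>2 \<le> (LINT t|lborel. \<bar>gauss_kernel (2 * \<tau>) t x * gauss_smooth (2 * \<tau>) f t\<bar>)\<^sup>2"
    unfolding eq by (rule power2_le_iff_abs_le[THEN iffD2]) (auto intro: integral_abs_bound)
  also have "\<dots> \<le> (LINT t|lborel. (gauss_kernel (2 * \<tau>) t x)\<^sup>2) * (LINT t|lborel. (gauss_smooth (2 * \<tau>) f t)\<^sup>2)"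
    by (intro Cauchy_Schwarz_integral(2) integrable_gauss_smooth_sq[OF f \<tau>2])
       (auto simp: sq integrable_gauss_kernel_mult[OF \<tau>2])
  also have "\<dots> = c * (c * gauss_energy \<tau> f)"
    unfolding sq integral_gauss_kernel_mult[OF \<tau>2] integral_gauss_smooth_sq[OF f \<tau>2]
    by (simp add: c_def gauss_kernel_def)
  finally show ?thesis using c by (simp add: power2_eq_square)
qed

text \<open>The normalised Gaussians are an approximate identity. Within distance \<open>\<delta>\<close> of \<open>x\<close> the function is close to
  \<open>f x\<close>; outside, the kernel is at most \<open>exp(-n \<delta>\<^sup>2)\<close>, which is integrated against \<open>|f|\<close>, while against the
  constant \<open>f x\<close> only half of the exponent is given away, so that the other half is still integrable.\<close>

lemma gauss_smooth_tendsto: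
  fixes f :: "real ^ 'd::finite \<Rightarrow> real"
  assumes f: "integrable lborel f" and cont: "isCont f x"
  shows "(\<lambda>n. (real n / pi) powr (real CARD('d) / 2) * gauss_smooth (real n) f x) \<longlonglongrightarrow> f x"
proof (rule LIMSEQ_I)
  fix r :: real assume r: "0 < r"
  define a where "a = real CARD('d) / 2"
  define A where "A = (LINT y|lborel. \<bar>f y\<bar>)"
  have a: "a > 0" by (simp add: a_def)
  have "eventually (\<lambda>y. dist (f y) (f x) < r / 2) (nhds x)"
    using cont r unfolding isCont_def tendsto_iff eventually_at_filter
    by (auto elim!: allE[of _ "r / 2"] eventually_mono)
  then obtain \<delta> where \<delta>: "\<delta> > 0" "\<And>y. norm (y - x) < \<delta> \<Longrightarrow> \<bar>f y - f x\<bar> < r / 2"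
    unfolding eventually_nhds_metric by (auto simp: dist_norm)
  define g where "g = (\<lambda>n::nat. (real n / pi) powr a * exp (- (real n * \<delta>\<^sup>2)) * A + exp (- (real n / 2 * \<delta>\<^sup>2)) * \<bar>f x\<bar> * 2 powr a)"
  (* g bounds the contribution of the points at distance at least delta from x *)
  have "g \<longlonglongrightarrow> 0"
    unfolding g_def using \<delta> a by real_asymp
  then have "eventually (\<lambda>n. g n < r / 2) sequentially"
    using r by (intro order_tendstoD) auto
  then obtain N where N: "\<And>n. n \<ge> N \<Longrightarrow> g n < r / 2" by (auto simp: eventually_sequentially)
  show "\<exists>no. \<forall>n\<ge>no. norm ((real n / pi) powr (real CARD('d) / 2) * gauss_smooth (real n) f x - f x) < r"
  proof (intro exI allI impI)
    fix n assume n: "max N 1 \<le> n"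
    define \<tau> where "\<tau> = real n"
    have \<tau>: "\<tau> > 0" and \<tau>': "\<tau> / 2 > 0" using n by (auto simp: \<tau>_def)
    define c where "c = (\<tau> / pi) powr a"
    have c: "c > 0" using \<tau> by (simp add: c_def)
    have inv: "c * (pi / \<tau>) powr a = 1" using \<tau> by (simp add: c_def flip: powr_mult)
    have inv2: "c * (pi / (\<tau> / 2)) powr a = 2 powr a" using \<tau> by (simp add: c_def flip: powr_mult)
    have "gauss_smooth \<tau> f x - f x * (LINT y|lborel. gauss_kernel \<tau> x y) = (LINT y|lborel. gauss_kernel \<tau> x y * (f y - f x))"
      unfolding gauss_smooth_def right_diff_distrib
      by (subst Bochner_Integration.integral_diff) 
         (auto simp: integrable_gauss_kernel[OF \<tau>] integrable_gauss_kernel_mult_fun[OF f \<tau>])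
    also have "f x * (LINT y|lborel. gauss_kernel \<tau> x y) = f x * (pi / \<tau>) powr a"
      by (simp add: integral_gauss_kernel[OF \<tau>] a_def)
    finally have "c * gauss_smooth \<tau> f x - f x * (c * (pi / \<tau>) powr a) = c * (LINT y|lborel. gauss_kernel \<tau> x y * (f y - f x))"
      by (simp add: algebra_simps)
    then have "\<bar>c * gauss_smooth \<tau> f x - f x\<bar> = c * \<bar>LINT y|lborel. gauss_kernel \<tau> x y * (f y - f x)\<bar>"
      unfolding inv using c by (simp add: abs_mult)
    also have "\<dots> \<le> c * (LINT y|lborel. \<bar>gauss_kernel \<tau> x y * (f y - f x)\<bar>)"
      using c by (intro mult_left_mono integral_abs_bound) auto
    also have "\<dots> \<le> c * (LINT y|lborel. r / 2 * gauss_kernel \<tau> x y + exp (- (\<tau> * \<delta>\<^sup>2)) * \<bar>f y\<bar> +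
         exp (- (\<tau> / 2 * \<delta>\<^sup>2)) * \<bar>f x\<bar> * gauss_kernel (\<tau> / 2) x y)"
    proof (intro mult_left_mono integral_mono)
      show "integrable lborel (\<lambda>y. \<bar>gauss_kernel \<tau> x y * (f y - f x)\<bar>)"
        unfolding right_diff_distrib
        by (intro integrable_abs Bochner_Integration.integrable_diff integrable_mult_left integrable_gauss_kernel
             integrable_gauss_kernel_mult_fun f \<tau>)
      show "integrable lborel (\<lambda>y. r / 2 * gauss_kernel \<tau> x y + exp (- (\<tau> * \<delta>\<^sup>2)) * \<bar>f y\<bar> +
         exp (- (\<tau> / 2 * \<delta>\<^sup>2)) * \<bar>f x\<bar> * gauss_kernel (\<tau> / 2) x y)"
        by (intro Bochner_Integration.integrable_add integrable_mult_right integrable_abs integrable_gauss_kernel f \<tau> \<tau>')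
      fix y :: "real ^ 'd"
      show "\<bar>gauss_kernel \<tau> x y * (f y - f x)\<bar> \<le> r / 2 * gauss_kernel \<tau> x y + exp (- (\<tau> * \<delta>\<^sup>2)) * \<bar>f y\<bar> +
         exp (- (\<tau> / 2 * \<delta>\<^sup>2)) * \<bar>f x\<bar> * gauss_kernel (\<tau> / 2) x y"
      proof (cases "norm (y - x) < \<delta>")
        case True
        then have "gauss_kernel \<tau> x y * \<bar>f y - f x\<bar> \<le> r / 2 * gauss_kernel \<tau> x y"
          using \<delta>(2)[of y] by (subst mult.commute, intro mult_right_mono) auto
        moreover have "0 \<le> exp (- (\<tau> * \<delta>\<^sup>2)) * \<bar>f y\<bar>" "0 \<le> exp (- (\<tau> / 2 * \<delta>\<^sup>2)) * \<bar>f x\<bar> * gauss_kernel (\<tau> / 2) x y"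
          by auto
        ultimately show ?thesis unfolding abs_mult abs_of_nonneg[OF gauss_kernel_nonneg] by linarith
      next
        case False
        then have d: "\<delta>\<^sup>2 \<le> (norm (x - y))\<^sup>2" using \<delta> by (intro power_mono) (auto simp: norm_minus_commute)
        have k1: "gauss_kernel \<tau> x y \<le> exp (- (\<tau> * \<delta>\<^sup>2))"
          using d \<tau> by (simp add: gauss_kernel_def)
        have "gauss_kernel \<tau> x y = gauss_kernel (\<tau> / 2) x y * gauss_kernel (\<tau> / 2) x y"
          by (simp add: gauss_kernel_def flip: exp_add)
        also have "\<dots> \<le> exp (- (\<tau> / 2 * \<delta>\<^sup>2)) * gauss_kernel (\<tau> / 2) x y"
          using d \<tau> by (intro mult_right_mono) (auto simp: gauss_kernel_def)
        finally have k2: "gauss_kernel \<tau> x y \<le> exp (- (\<tau> / 2 * \<delta>\<^sup>2)) * gauss_kernel (\<tau> / 2) x y" .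
        have "\<bar>gauss_kernel \<tau> x y * (f y - f x)\<bar> \<le> gauss_kernel \<tau> x y * \<bar>f y\<bar> + gauss_kernel \<tau> x y * \<bar>f x\<bar>"
          by (simp add: abs_mult mult_left_mono abs_triangle_ineq4 flip: distrib_left)
        also have "\<dots> \<le> exp (- (\<tau> * \<delta>\<^sup>2)) * \<bar>f y\<bar> + exp (- (\<tau> / 2 * \<delta>\<^sup>2)) * gauss_kernel (\<tau> / 2) x y * \<bar>f x\<bar>"
          using k1 k2 by (intro add_mono mult_right_mono) auto
        moreover have "0 \<le> r / 2 * gauss_kernel \<tau> x y" using r by simp
        ultimately show ?thesis by (simp add: algebra_simps)
      qed
    qed (use c in auto)
    also have "\<dots> = c * (r / 2 * (pi / \<tau>) powr a + exp (- (\<tau> * \<delta>\<^sup>2)) * A + exp (- (\<tau> / 2 * \<delta>\<^sup>2)) * \<bar>f x\<bar> * (pi / (\<tau> / 2)) powr a)"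
      using integrable_gauss_kernel[OF \<tau>, of x] integrable_gauss_kernel[OF \<tau>', of x] f
        integral_gauss_kernel[OF \<tau>, of x] integral_gauss_kernel[OF \<tau>', of x]
      by (simp add: A_def a_def)
    also have "\<dots> = r / 2 * (c * (pi / \<tau>) powr a) + c * exp (- (\<tau> * \<delta>\<^sup>2)) * A + exp (- (\<tau> / 2 * \<delta>\<^sup>2)) * \<bar>f x\<bar> * (c * (pi / (\<tau> / 2)) powr a)"
      by (simp only: algebra_simps)
    also have "\<dots> = r / 2 + g n"
      unfolding inv inv2 by (simp add: g_def c_def \<tau>_def)
    also have "\<dots> < r" using N[of n] n by simp
    finally show "norm ((real n / pi) powr (real CARD('d) / 2) * gauss_smooth (real n) f x - f x) < r"
      by (simp add: c_def a_def \<tau>_def)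
  qed
qed

text \<open>On the Fourier side both quantities are Gaussian averages of \<open>|F f|\<^sup>2\<close>. The left one has the smaller width, so it is
  dominated by the right one; the factors \<open>(\<pi>/2\<tau>)(2\<pi>/\<tau>) = (\<pi>/\<tau>)\<^sup>2\<close> match exactly.\<close>

lemma gauss_smooth_sq_integral_le:
  fixes f :: "real ^ 'd::finite \<Rightarrow> real"
  assumes f: "integrable lborel f" and \<tau>: "\<tau> > 0"
  shows "(LINT t|lborel. (gauss_smooth \<tau> f t)\<^sup>2) \<le> (pi / \<tau>) powr (real CARD('d) / 2) * gauss_energy \<tau> f"
proof -
  have \<tau>2: "\<tau> / 2 > 0" using \<tau> by simp
  define a where "a = real CARD('d) / 2"
  have "(LINT t|lborel. (gauss_smooth \<tau> f t)\<^sup>2) = (pi / (2 * \<tau>)) powr a * ((pi / (\<tau> / 2)) powr a *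
     (LINT \<omega>|lborel. exp (- (norm \<omega>)\<^sup>2 / (4 * (\<tau> / 2))) * (cmod (fourier f \<omega>))\<^sup>2))"
    unfolding integral_gauss_smooth_sq[OF f \<tau>] gauss_energy_spectral(2)[OF f \<tau>2] a_def ..
  also have "\<dots> \<le> (pi / (2 * \<tau>)) powr a * ((pi / (\<tau> / 2)) powr a * 
     (LINT \<omega>|lborel. exp (- (norm \<omega>)\<^sup>2 / (4 * \<tau>)) * (cmod (fourier f \<omega>))\<^sup>2))"
    using gauss_energy_spectral(1)[OF f \<tau>] gauss_energy_spectral(1)[OF f \<tau>2] \<tau>
    by (intro mult_left_mono integral_mono mult_right_mono) (auto simp: field_simps)
  also have "\<dots> = (pi / (2 * \<tau>) * (pi / (\<tau> / 2))) powr a * 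
     (LINT \<omega>|lborel. exp (- (norm \<omega>)\<^sup>2 / (4 * \<tau>)) * (cmod (fourier f \<omega>))\<^sup>2)"
    using \<tau> by (subst powr_mult) auto
  also have "pi / (2 * \<tau>) * (pi / (\<tau> / 2)) = pi / \<tau> * (pi / \<tau>)" using \<tau> by simp
  also have "\<dots> powr a * (LINT \<omega>|lborel. exp (- (norm \<omega>)\<^sup>2 / (4 * \<tau>)) * (cmod (fourier f \<omega>))\<^sup>2)
     = (pi / \<tau>) powr a * gauss_energy \<tau> f"
    unfolding gauss_energy_spectral(2)[OF f \<tau>] a_def using \<tau> by (subst powr_mult) auto
  finally show ?thesis unfolding a_def .
qed

text \<open>One half of Plancherel's theorem for almost everywhere continuous functions: the smoothed functions have squared norm at most
  \<open>\<integral> |F f|\<^sup>2\<close> and converge to \<open>f\<close> almost everywhere, so Fatou's lemma transfers the bound to \<open>f\<close>.\<close>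

lemma
  fixes f :: "real ^ 'd::finite \<Rightarrow> real"
  assumes f: "integrable lborel f" and cont: "AE x in lborel. isCont f x"
    and F: "integrable lborel (\<lambda>\<omega>. (cmod (fourier f \<omega>))\<^sup>2)"
  shows fourier_L2_imp_integrable_sq: "integrable lborel (\<lambda>x. (f x)\<^sup>2)"
    and integral_sq_le_fourier: "(LINT x|lborel. (f x)\<^sup>2) \<le> (LINT \<omega>|lborel. (cmod (fourier f \<omega>))\<^sup>2)"
proof -
  have [measurable]: "f \<in> borel_measurable borel" using f by auto
  define a where "a = real CARD('d) / 2"
  define u where "u = (\<lambda>n x. (real n / pi) powr a * gauss_smooth (real n) f x)"
  define B where "B = (LINT \<omega>|lborel. (cmod (fourier f \<omega>))\<^sup>2)"
  have B0: "0 \<le> B" by (simp add: B_def)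
  have bnd: "(\<integral>\<^sup>+ x. ennreal ((u n x)\<^sup>2) \<partial>lborel) \<le> ennreal B" if n: "n > 0" for n
  proof -
    have \<tau>: "real n > 0" using n by simp
    have "(\<integral>\<^sup>+ x. ennreal ((u n x)\<^sup>2) \<partial>lborel) = ennreal (LINT x|lborel. (u n x)\<^sup>2)"
      unfolding u_def power_mult_distrib
      by (intro nn_integral_eq_integral integrable_mult_right integrable_gauss_smooth_sq f \<tau>) auto
    also have "(LINT x|lborel. (u n x)\<^sup>2) = ((real n / pi) powr a)\<^sup>2 * (LINT t|lborel. (gauss_smooth (real n) f t)\<^sup>2)"
      unfolding u_def power_mult_distrib by simp
    also have "\<dots> \<le> ((real n / pi) powr a)\<^sup>2 * ((pi / real n) powr a * gauss_energy (real n) f)"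
      unfolding a_def by (intro mult_left_mono gauss_smooth_sq_integral_le f \<tau>) auto
    also have "\<dots> = ((real n / pi) powr a * (pi / real n) powr a)\<^sup>2 * 
        (LINT \<omega>|lborel. exp (- (norm \<omega>)\<^sup>2 / (4 * real n)) * (cmod (fourier f \<omega>))\<^sup>2)"
      unfolding gauss_energy_spectral(2)[OF f \<tau>] a_def by (simp add: power2_eq_square)
    also have "(real n / pi) powr a * (pi / real n) powr a = 1"
      using n by (simp flip: powr_mult)
    also have "1\<^sup>2 * (LINT \<omega>|lborel. exp (- (norm \<omega>)\<^sup>2 / (4 * real n)) * (cmod (fourier f \<omega>))\<^sup>2) \<le> B"
      unfolding B_def using gauss_energy_spectral(1)[OF f \<tau>] F
      by (auto intro!: integral_mono mult_left_le_one_le)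
    finally show ?thesis by (simp add: ennreal_leI)
  qed
  have "(\<integral>\<^sup>+ x. ennreal ((f x)\<^sup>2) \<partial>lborel) = (\<integral>\<^sup>+ x. liminf (\<lambda>n. ennreal ((u n x)\<^sup>2)) \<partial>lborel)"
  proof (rule nn_integral_cong_AE)
    show "AE x in lborel. ennreal ((f x)\<^sup>2) = liminf (\<lambda>n. ennreal ((u n x)\<^sup>2))"
      using cont
    proof eventually_elim
      case (elim x)
      have "(\<lambda>n. ennreal ((u n x)\<^sup>2)) \<longlonglongrightarrow> ennreal ((f x)\<^sup>2)"
        unfolding u_def a_def by (intro tendsto_ennrealI tendsto_power gauss_smooth_tendsto f elim)
      then show ?case by (rule lim_imp_Liminf[OF trivial_limit_sequentially, symmetric])
    qed
  qed
  also have "\<dots> \<le> liminf (\<lambda>n. \<integral>\<^sup>+ x. ennreal ((u n x)\<^sup>2) \<partial>lborel)"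
    by (rule nn_integral_liminf) (auto simp: u_def)
  also have "\<dots> \<le> liminf (\<lambda>n::nat. ennreal B)"
    by (intro Liminf_mono eventually_sequentiallyI[of 1] bnd) simp
  also have "\<dots> = ennreal B" by (simp add: Liminf_const)
  finally have le: "(\<integral>\<^sup>+ x. ennreal ((f x)\<^sup>2) \<partial>lborel) \<le> ennreal B" .
  show int: "integrable lborel (\<lambda>x. (f x)\<^sup>2)"
    by (rule integrableI_bounded) (auto intro: le_less_trans[OF le])
  show "(LINT x|lborel. (f x)\<^sup>2) \<le> (LINT \<omega>|lborel. (cmod (fourier f \<omega>))\<^sup>2)"
    using le B0 unfolding B_def[symmetric] by (subst (asm) nn_integral_eq_integral[OF int]) auto
qed

text \<open>The other half. For the Gaussian average \<open>A\<close> of \<open>|F g|\<^sup>2\<close>, the Cauchy-Schwarz inequality between \<open>g\<close> and its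
  smoothing gives \<open>A\<^sup>2 \<le> A \<integral> g\<^sup>2\<close>, and \<open>A\<close> tends to \<open>\<integral> |F g|\<^sup>2\<close> as the Gaussian weight on the Fourier side
  widens.\<close>

lemma
  fixes g :: "real ^ 'd::finite \<Rightarrow> real"
  assumes g: "integrable lborel g" and g2: "integrable lborel (\<lambda>x. (g x)\<^sup>2)"
  shows integrable_fourier_sq: "integrable lborel (\<lambda>\<omega>. (cmod (fourier g \<omega>))\<^sup>2)"
    and integral_fourier_sq_le: "(LINT \<omega>|lborel. (cmod (fourier g \<omega>))\<^sup>2) \<le> (LINT x|lborel. (g x)\<^sup>2)"
proof -
  have [measurable]: "g \<in> borel_measurable borel" using g by auto
  define B where "B = (LINT x|lborel. (g x)\<^sup>2)"
  have B0: "0 \<le> B" by (simp add: B_def)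
  define a where "a = real CARD('d) / 2"
  let ?v = "\<lambda>n::nat. \<lambda>\<omega>. exp (- (norm \<omega>)\<^sup>2 / (4 * real n)) * (cmod (fourier g \<omega>))\<^sup>2"
  have bnd: "(\<integral>\<^sup>+ \<omega>. ennreal (?v n \<omega>) \<partial>lborel) \<le> ennreal B" if n: "n > 0" for n
  proof -
    have \<tau>: "real n > 0" using n by simp
    define A where "A = (LINT \<omega>|lborel. ?v n \<omega>)"
    define q where "q = (pi / real n) powr a"
    have q: "q > 0" using n by (simp add: q_def)
    have E: "gauss_energy (real n) g = q * A"
      unfolding A_def q_def a_def by (rule gauss_energy_spectral(2)[OF g \<tau>])
    have A0: "0 \<le> A" by (simp add: A_def)
    have "(q * A)\<^sup>2 \<le> (LINT x|lborel. \<bar>g x * gauss_smooth (real n) g x\<bar>)\<^sup>2"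
      unfolding E[symmetric] gauss_energy_def
      by (rule power2_le_iff_abs_le[THEN iffD2]) (auto intro: integral_abs_bound)
    also have "\<dots> \<le> B * (LINT t|lborel. (gauss_smooth (real n) g t)\<^sup>2)"
      unfolding B_def by (intro Cauchy_Schwarz_integral g2 integrable_gauss_smooth_sq g \<tau>) auto
    also have "\<dots> \<le> B * (q * (q * A))"
      using gauss_smooth_sq_integral_le[OF g \<tau>] unfolding E by (intro mult_left_mono B0) (simp add: q_def a_def)
    finally have "q\<^sup>2 * A\<^sup>2 \<le> q\<^sup>2 * (B * A)" by (simp add: power2_eq_square algebra_simps)
    then have "A\<^sup>2 \<le> B * A" using q by (subst (asm) mult_le_cancel_left_pos) auto
    then have "A \<le> B" using A0 B0 by (cases "A = 0") (auto simp: power2_eq_square)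
    then show ?thesis using gauss_energy_spectral(1)[OF g \<tau>]
      by (subst nn_integral_eq_integral) (auto simp: A_def ennreal_leI)
  qed
  have "(\<integral>\<^sup>+ \<omega>. ennreal ((cmod (fourier g \<omega>))\<^sup>2) \<partial>lborel) = (\<integral>\<^sup>+ \<omega>. liminf (\<lambda>n. ennreal (?v n \<omega>)) \<partial>lborel)"
  proof (rule nn_integral_cong)
    fix \<omega> :: "real ^ 'd"
    have *: "(\<lambda>n. ennreal (?v n \<omega>)) \<longlonglongrightarrow> ennreal (1 * (cmod (fourier g \<omega>))\<^sup>2)"
    proof (intro tendsto_ennrealI tendsto_mult tendsto_const)
      show "(\<lambda>n. exp (- (norm \<omega>)\<^sup>2 / (4 * real n))) \<longlonglongrightarrow> 1" by real_asymp
    qed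
    show "ennreal ((cmod (fourier g \<omega>))\<^sup>2) = liminf (\<lambda>n. ennreal (?v n \<omega>))"
      using lim_imp_Liminf[OF trivial_limit_sequentially *] by (simp only: mult_1)
  qed
  also have "\<dots> \<le> liminf (\<lambda>n. \<integral>\<^sup>+ \<omega>. ennreal (?v n \<omega>) \<partial>lborel)"
    by (rule nn_integral_liminf) auto
  also have "\<dots> \<le> liminf (\<lambda>n::nat. ennreal B)"
    by (intro Liminf_mono eventually_sequentiallyI[of 1] bnd) simp
  also have "\<dots> = ennreal B" by (simp add: Liminf_const)
  finally have le: "(\<integral>\<^sup>+ \<omega>. ennreal ((cmod (fourier g \<omega>))\<^sup>2) \<partial>lborel) \<le> ennreal B" .
  show int: "integrable lborel (\<lambda>\<omega>. (cmod (fourier g \<omega>))\<^sup>2)"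
    by (rule integrableI_bounded) (auto intro: le_less_trans[OF le])
  show "(LINT \<omega>|lborel. (cmod (fourier g \<omega>))\<^sup>2) \<le> (LINT x|lborel. (g x)\<^sup>2)"
    using le B0 unfolding B_def[symmetric] by (subst (asm) nn_integral_eq_integral[OF int]) auto
qed

text \<open>The frequency axis is cut at \<open>|\<omega>|\<^sup>2 = \<nu>\<close>. Below the cut the Gaussian weight is at least \<open>exp(-1/4)\<close>; above it
  \<open>1 \<le> \<nu>\<^bsup>-s\<^esup> (1 + |\<omega>|\<^sup>2)\<^sup>s\<close>, so that the Sobolev norm takes over.\<close>

lemma gauss_energy_lower_bound:
  fixes f :: "real ^ 'd::finite \<Rightarrow> real"
  assumes f: "integrable lborel f" and cont: "AE x in lborel. isCont f x"
    and S: "integrable lborel (sobolev_integrand s f)" and s: "s > 0" and \<nu>: "\<nu> > 0"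
  shows "gauss_energy \<nu> f \<ge> (pi / \<nu>) powr (real CARD('d) / 2) * exp (- 1 / 4) * 
     ((LINT x|lborel. (f x)\<^sup>2) - \<nu> powr (- s) * (LINT \<omega>|lborel. sobolev_integrand s f \<omega>))"
proof -
  have [measurable]: "f \<in> borel_measurable borel" using f by auto
  let ?F = "\<lambda>\<omega>. (cmod (fourier f \<omega>))\<^sup>2"
  let ?g = "\<lambda>\<omega>. exp (- (norm \<omega>)\<^sup>2 / (4 * \<nu>)) * ?F \<omega>"
  note ig = gauss_energy_spectral[OF f \<nu>]
  have F: "integrable lborel ?F"
  proof (rule Bochner_Integration.integrable_bound[OF S])
    show "AE \<omega> in lborel. norm (?F \<omega>) \<le> norm (sobolev_integrand s f \<omega>)"
      using s by (auto simp: sobolev_integrand_def mult_le_cancel_right1 ge_one_powr_ge_zero)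
  qed measurable
  have "(LINT x|lborel. (f x)\<^sup>2) \<le> (LINT \<omega>|lborel. ?F \<omega>)"
    by (rule integral_sq_le_fourier[OF f cont F])
  also have "\<dots> \<le> (LINT \<omega>|lborel. exp (1 / 4) * ?g \<omega> + \<nu> powr (- s) * sobolev_integrand s f \<omega>)"
  proof (rule integral_mono[OF F])
    show "integrable lborel (\<lambda>\<omega>. exp (1 / 4) * ?g \<omega> + \<nu> powr (- s) * sobolev_integrand s f \<omega>)"
      by (intro Bochner_Integration.integrable_add integrable_mult_right ig S)
    fix \<omega> :: "real ^ 'd"
    show "?F \<omega> \<le> exp (1 / 4) * ?g \<omega> + \<nu> powr (- s) * sobolev_integrand s f \<omega>"
    proof (cases "(norm \<omega>)\<^sup>2 \<le> \<nu>")
      case True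
      then have "(norm \<omega>)\<^sup>2 / (4 * \<nu>) \<le> 1 / 4" using \<nu> by (simp add: field_simps)
      then have "1 \<le> exp (1 / 4) * exp (- (norm \<omega>)\<^sup>2 / (4 * \<nu>))" by (simp flip: exp_add)
      then have "1 * ?F \<omega> \<le> exp (1 / 4) * exp (- (norm \<omega>)\<^sup>2 / (4 * \<nu>)) * ?F \<omega>"
        by (intro mult_right_mono) auto
      moreover have "0 \<le> \<nu> powr (- s) * sobolev_integrand s f \<omega>" by (simp add: sobolev_integrand_def)
      ultimately show ?thesis by simp
    next
      case False
      then have "\<nu> powr s \<le> (1 + (norm \<omega>)\<^sup>2) powr s" using \<nu> s by (intro powr_mono2) auto
      then have "\<nu> powr (- s) * \<nu> powr s \<le> \<nu> powr (- s) * (1 + (norm \<omega>)\<^sup>2) powr s"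
        by (intro mult_left_mono) auto
      then have "1 \<le> \<nu> powr (- s) * (1 + (norm \<omega>)\<^sup>2) powr s" using \<nu> by (simp flip: powr_add)
      then have "1 * ?F \<omega> \<le> \<nu> powr (- s) * (1 + (norm \<omega>)\<^sup>2) powr s * ?F \<omega>"
        by (intro mult_right_mono) auto
      moreover have "0 \<le> exp (1 / 4) * ?g \<omega>" by simp
      ultimately show ?thesis unfolding sobolev_integrand_def mult.assoc by linarith
    qed
  qed
  also have "\<dots> = exp (1 / 4) * (LINT \<omega>|lborel. ?g \<omega>) + \<nu> powr (- s) * (LINT \<omega>|lborel. sobolev_integrand s f \<omega>)"
    by (subst Bochner_Integration.integral_add) (use ig S in auto)
  finally have "exp (- 1 / 4) * ((LINT x|lborel. (f x)\<^sup>2) - \<nu> powr (- s) * (LINT \<omega>|lborel. sobolev_integrand s f \<omega>))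
     \<le> exp (- 1 / 4) * (exp (1 / 4) * (LINT \<omega>|lborel. ?g \<omega>))"
    by (intro mult_left_mono) auto
  also have "\<dots> = (LINT \<omega>|lborel. ?g \<omega>)" by (simp add: mult.assoc[symmetric] flip: exp_add)
  finally show ?thesis unfolding ig(2) mult.assoc by (intro mult_left_mono) auto
qed

section \<open>Variance of a weighted U-statistic\<close>

text \<open>A function of independent coordinates belongs to the component \<open>A\<close> of the Hoeffding decomposition if it depends
  only on the coordinates in \<open>A\<close> and averages to zero over each of them. Boundedness is part of the predicate because
  it makes every product that occurs integrable.\<close>

definition centered_on :: "'i set \<Rightarrow> ('i \<Rightarrow> 'a measure) \<Rightarrow> 'i set \<Rightarrow> (('i \<Rightarrow> 'a) \<Rightarrow> real) \<Rightarrow> bool" where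
  "centered_on I M A u \<longleftrightarrow> A \<subseteq> I \<and> u \<in> borel_measurable (Pi\<^sub>M I M) \<and>
     (\<exists>B. \<forall>z\<in>space (Pi\<^sub>M I M). \<bar>u z\<bar> \<le> B) \<and>
     (\<forall>z\<in>space (Pi\<^sub>M I M). \<forall>i\<in>I - A. \<forall>y\<in>space (M i). u (z(i := y)) = u z) \<and>
     (\<forall>z\<in>space (Pi\<^sub>M I M). \<forall>i\<in>A. (\<integral>y. u (z(i := y)) \<partial>M i) = 0)"

lemma (in prob_space) integrable_bounded_on:
  fixes u :: "'a \<Rightarrow> real"
  assumes "u \<in> borel_measurable M" "\<And>z. z \<in> space M \<Longrightarrow> \<bar>u z\<bar> \<le> B"
  shows "integrable M u"
  using assms by (intro integrable_const_bound[of _ B]) auto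

lemma centered_on_integrable_mult:
  assumes P: "prob_space (Pi\<^sub>M I M)"
    and u: "centered_on I M A u" and v: "centered_on I M B v"
  shows "integrable (Pi\<^sub>M I M) (\<lambda>z. u z * v z)"
proof -
  interpret prob_space "Pi\<^sub>M I M" by fact
  obtain b c where "\<forall>z\<in>space (Pi\<^sub>M I M). \<bar>u z\<bar> \<le> b" "\<forall>z\<in>space (Pi\<^sub>M I M). \<bar>v z\<bar> \<le> c"
    using u v by (auto simp: centered_on_def)
  then have "\<bar>u z * v z\<bar> \<le> b * c" if "z \<in> space (Pi\<^sub>M I M)" for z
    unfolding abs_mult using that by (intro mult_mono) (auto intro: order_trans[OF abs_ge_zero])
  then show ?thesis using u v
    by (intro integrable_bounded_on[of _ "b * c"]) (auto simp: centered_on_def)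
qed

text \<open>Some coordinate lies in exactly one of the two sets. Integrating over it first annihilates the function whose set contains
  it, while the other function is constant.\<close>

lemma (in product_prob_space) centered_on_orthogonal:
  assumes I: "finite I" and u: "centered_on I M A u" and v: "centered_on I M B v" and ne: "A \<noteq> B"
  shows "(\<integral>z. u z * v z \<partial>Pi\<^sub>M I M) = 0"
proof -
  have *: "(\<integral>z. u z * v z \<partial>Pi\<^sub>M I M) = 0"
    if u: "centered_on I M A u" and v: "centered_on I M B v" and i: "i \<in> A - B" for A B u v i
  proof -
    have iI: "i \<in> I" using u i by (auto simp: centered_on_def)
    have I_eq: "insert i (I - {i}) = I" using iI by auto
    have P: "prob_space (Pi\<^sub>M I M)" by (rule prob_space_PiM) (rule prob_space)
    note int = centered_on_integrable_mult[OF P u v]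
    obtain y0 where y0: "y0 \<in> space (M i)" using M.not_empty by blast
    have "(\<integral>z. u z * v z \<partial>Pi\<^sub>M I M) =
       (\<integral>x. (\<integral>y. u (x(i:=y)) * v (x(i:=y)) \<partial>M i) \<partial>Pi\<^sub>M (I - {i}) M)"
      using product_integral_insert[of "I - {i}" i "\<lambda>z. u z * v z"] int I unfolding I_eq by simp
    also have "\<dots> = (\<integral>x. 0 \<partial>Pi\<^sub>M (I - {i}) M)"
    proof (rule Bochner_Integration.integral_cong[OF refl])
      fix x assume x: "x \<in> space (Pi\<^sub>M (I - {i}) M)"
      define z where "z = x(i := y0)"
      have z: "z \<in> space (Pi\<^sub>M I M)"
        using x y0 iI by (auto simp: z_def space_PiM PiE_iff extensional_def)
      have "(\<integral>y. u (x(i:=y)) * v (x(i:=y)) \<partial>M i) = (\<integral>y. u (z(i:=y)) * v z \<partial>M i)"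
      proof (rule Bochner_Integration.integral_cong[OF refl])
        fix y assume y: "y \<in> space (M i)"
        have "v (z(i := y)) = v z" using v z i iI y by (auto simp: centered_on_def)
        then show "u (x(i:=y)) * v (x(i:=y)) = u (z(i:=y)) * v z" by (simp add: z_def)
      qed
      also have "\<dots> = 0" using u z i by (auto simp: centered_on_def)
      finally show "(\<integral>y. u (x(i:=y)) * v (x(i:=y)) \<partial>M i) = 0" .
    qed
    finally show ?thesis by simp
  qed
  from ne consider i where "i \<in> A - B" | i where "i \<in> B - A" by auto
  then show ?thesis
  proof cases
    case 1 then show ?thesis using *[OF u v] by auto
  next
    case 2 then show ?thesis using *[OF v u] by (auto simp: mult.commute)
  qed
qed

lemma (in product_prob_space) second_moment_sum_centered:
  assumes I: "finite I" and J: "finite J"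
    and u: "\<And>j. j \<in> J \<Longrightarrow> centered_on I M (A j) (u j)" and inj: "inj_on A J"
  shows "(\<integral>z. (\<Sum>j\<in>J. u j z)\<^sup>2 \<partial>Pi\<^sub>M I M) = (\<Sum>j\<in>J. \<integral>z. (u j z)\<^sup>2 \<partial>Pi\<^sub>M I M)"
proof -
  have P: "prob_space (Pi\<^sub>M I M)" by (rule prob_space_PiM) (rule prob_space)
  have int: "integrable (Pi\<^sub>M I M) (\<lambda>z. u j z * u k z)" if "j \<in> J" "k \<in> J" for j k
    using centered_on_integrable_mult[OF P u u] that by auto
  have "(\<integral>z. (\<Sum>j\<in>J. u j z)\<^sup>2 \<partial>Pi\<^sub>M I M) = (\<Sum>j\<in>J. \<Sum>k\<in>J. \<integral>z. u j z * u k z \<partial>Pi\<^sub>M I M)"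
    unfolding power2_eq_square sum_product
    by (subst Bochner_Integration.integral_sum, intro Bochner_Integration.integrable_sum int, assumption+,
        intro sum.cong refl Bochner_Integration.integral_sum int)
  also have "\<dots> = (\<Sum>j\<in>J. \<Sum>k\<in>J. if k = j then \<integral>z. (u j z)\<^sup>2 \<partial>Pi\<^sub>M I M else 0)"
  proof (intro sum.cong refl)
    fix j k assume "j \<in> J" "k \<in> J"
    then show "(\<integral>z. u j z * u k z \<partial>Pi\<^sub>M I M) = (if k = j then \<integral>z. (u j z)\<^sup>2 \<partial>Pi\<^sub>M I M else 0)"
      using centered_on_orthogonal[OF I u u, of j k] inj
      by (auto simp: power2_eq_square inj_on_def)
  qed
  also have "\<dots> = (\<Sum>j\<in>J. \<integral>z. (u j z)\<^sup>2 \<partial>Pi\<^sub>M I M)"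
    using J by (intro sum.cong refl) simp
  finally show ?thesis .
qed

lemma sum_off_diagonal_symmetric:
  fixes f :: "'i::linorder \<Rightarrow> 'i \<Rightarrow> real"
  assumes I: "finite I" and sym: "\<And>i j. f i j = f j i"
  shows "(\<Sum>(i, j)\<in>{(i, j). i \<in> I \<and> j \<in> I \<and> i \<noteq> j}. f i j) =
     2 * (\<Sum>(i, j)\<in>{(i, j). i \<in> I \<and> j \<in> I \<and> i < j}. f i j)"
proof -
  have fin: "finite {(i, j). i \<in> I \<and> j \<in> I \<and> i < j}" "finite {(i, j). i \<in> I \<and> j \<in> I \<and> j < i}"
    by (rule finite_subset[of _ "I \<times> I"]; use I in auto)+
  have eq: "{(i, j). i \<in> I \<and> j \<in> I \<and> i \<noteq> j} =
      {(i, j). i \<in> I \<and> j \<in> I \<and> i < j} \<union> {(i, j). i \<in> I \<and> j \<in> I \<and> j < i}" by auto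
  have "(\<Sum>(i, j)\<in>{(i, j). i \<in> I \<and> j \<in> I \<and> j < i}. f i j) =
      (\<Sum>(i, j)\<in>{(i, j). i \<in> I \<and> j \<in> I \<and> i < j}. f i j)"
    by (rule sum.reindex_bij_witness[of _ prod.swap prod.swap]) (auto simp: sym)
  then show ?thesis unfolding eq using fin by (subst sum.union_disjoint) auto
qed

section \<open>Hoeffding decomposition of a kernel\<close>

text \<open>Independent observations with possibly different laws \<open>M i\<close> on a common measurable space, and a symmetric kernel with
  values in the unit interval. The upper bound 1 gives \<open>k\<^sup>2 \<le> k\<close>, so that second moments of the kernel are
  controlled by its first moments.\<close>

locale bounded_kernel_sample = product_prob_space M I
  for M :: "'i::linorder \<Rightarrow> 'a measure" and I :: "'i set" +
  fixes N :: "'a measure" and k :: "'a \<Rightarrow> 'a \<Rightarrow> real"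
  assumes fin_I: "finite I" and sets_M: "\<And>i. sets (M i) = sets N"
    and k_meas: "case_prod k \<in> borel_measurable (N \<Otimes>\<^sub>M N)"
    and k_sym: "\<And>x y. k x y = k y x" and k_nonneg: "\<And>x y. 0 \<le> k x y" and k_le1: "\<And>x y. k x y \<le> 1"
begin

text \<open>The pieces of the decomposition \<open>k x y = mean + (proj j x - mean) + (proj i y - mean) + degen x y\<close> for a pair of
  observations \<open>i, j\<close>.\<close>

definition "proj j x = (\<integral>y. k x y \<partial>M j)"
definition "mean i j = (\<integral>x. proj j x \<partial>M i)"
definition "degen i j x y = k x y - proj j x - proj i y + mean i j"

lemma k_abs: "\<bar>k x y\<bar> \<le> 1" using k_nonneg[of x y] k_le1[of x y] by simp

lemma measurable_M_N [simp]: "measurable (M i) L = measurable N L"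
  by (rule measurable_cong_sets) (auto simp: sets_M)

lemma measurable_M_N' [simp]: "measurable L (M i) = measurable L N"
  by (rule measurable_cong_sets) (auto simp: sets_M)

lemma k_measurable [measurable (raw)]:
  assumes "f \<in> measurable L N" "g \<in> measurable L N"
  shows "(\<lambda>x. k (f x) (g x)) \<in> borel_measurable L"
  using measurable_compose[OF measurable_Pair[OF assms] k_meas] by simp

lemma proj_measurable [measurable]: "proj j \<in> borel_measurable N"
proof -
  have "case_prod k \<in> borel_measurable (N \<Otimes>\<^sub>M M j)"
    using k_meas by (subst measurable_cong_sets[OF sets_pair_measure_cong[OF refl sets_M] refl])
  then show ?thesis unfolding proj_def by (rule M.borel_measurable_lebesgue_integral)
qed

lemma space_M: "space (M i) = space N"
  using sets_M[of i] by (rule sets_eq_imp_space_eq)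

lemma k_integrable: "x \<in> space N \<Longrightarrow> integrable (M j) (k x)"
proof -
  assume x: "x \<in> space N"
  have "k x \<in> borel_measurable (M j)" using k_measurable[OF measurable_const[OF x] measurable_ident] by simp
  then show ?thesis using k_abs by (intro M.integrable_bounded_on) auto
qed

lemma proj_nonneg: "0 \<le> proj j x" unfolding proj_def using k_nonneg by simp

lemma proj_le1: "proj j x \<le> 1"
proof -
  show ?thesis unfolding proj_def using k_le1 k_nonneg
    by (cases "integrable (M j) (k x)") (auto intro!: M.integral_le_const simp: not_integrable_integral_eq)
qed

lemma proj_abs: "\<bar>proj j x\<bar> \<le> 1" using proj_nonneg[of j x] proj_le1[of j x] by simp

lemma proj_integrable: "integrable (M i) (proj j)"
proof -
  show ?thesis using proj_abs by (intro M.integrable_bounded_on) auto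
qed

lemma mean_sym: "mean i j = mean j i"
proof -
  interpret p: pair_prob_space "M i" "M j" ..
  have "case_prod k \<in> borel_measurable (M i \<Otimes>\<^sub>M M j)"
    using k_meas by (subst measurable_cong_sets[OF sets_pair_measure_cong[OF sets_M sets_M] refl])
  then have "integrable (M i \<Otimes>\<^sub>M M j) (case_prod k)"
    using k_abs by (intro p.P.integrable_bounded_on) auto
  from p.Fubini_integral[OF this] show ?thesis
    unfolding mean_def proj_def by (simp add: k_sym)
qed

lemma mean_abs: "\<bar>mean i j\<bar> \<le> 1"
proof -
  show ?thesis unfolding mean_def using proj_abs proj_integrable
    by (intro order_trans[OF integral_abs_bound] M.integral_le_const) auto
qed

lemma degen_sym: "degen i j x y = degen j i y x"
  by (simp add: degen_def mean_sym[of i j] k_sym)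

lemma degen_abs: "\<bar>degen i j x y\<bar> \<le> 4"
  using k_abs[of x y] proj_abs[of j x] proj_abs[of i y] mean_abs[of i j] unfolding degen_def by linarith

lemma integral_degen: "x \<in> space N \<Longrightarrow> (\<integral>y. degen i j x y \<partial>M j) = 0"
proof -
  assume x: "x \<in> space N"
  have "(\<integral>y. degen i j x y \<partial>M j) = (\<integral>y. k x y \<partial>M j) - proj j x - (\<integral>y. proj i y \<partial>M j) + mean i j"
    unfolding degen_def using k_integrable[OF x] proj_integrable by (simp add: M.prob_space)
  then show ?thesis using mean_sym[of i j] by (simp add: proj_def[symmetric] mean_def)
qed

lemma component_measurable [measurable]: "i \<in> I \<Longrightarrow> (\<lambda>z. z i) \<in> measurable (Pi\<^sub>M I M) N"
  using measurable_component_singleton[of i I M] by simp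

lemma space_component: "z \<in> space (Pi\<^sub>M I M) \<Longrightarrow> i \<in> I \<Longrightarrow> z i \<in> space N"
  by (auto simp: space_PiM space_M)

lemma centered_on_proj:
  assumes "i \<in> I" and g: "g \<in> borel_measurable N" and B: "\<And>x. \<bar>g x\<bar> \<le> B"
  shows "centered_on I M {i} (\<lambda>z. g (z i) - (\<integral>x. g x \<partial>M i))"
proof -
  have int: "integrable (M i) g" using g B by (intro M.integrable_bounded_on) auto
  show ?thesis unfolding centered_on_def
  proof (intro conjI ballI exI)
    show "\<bar>g (z i) - (\<integral>x. g x \<partial>M i)\<bar> \<le> B + \<bar>\<integral>x. g x \<partial>M i\<bar>" for z
      using B[of "z i"] by linarith
  next
    note [measurable] = g assms(1)
    show "(\<lambda>z. g (z i) - (\<integral>x. g x \<partial>M i)) \<in> borel_measurable (Pi\<^sub>M I M)" by measurable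
  next
    fix z i' assume "i' \<in> {i}"
    then show "(\<integral>y. g ((z(i' := y)) i) - (\<integral>x. g x \<partial>M i) \<partial>M i') = 0"
      using int by (simp add: M.prob_space)
  qed (use assms(1) in auto)
qed

lemma centered_on_const: "centered_on I M {} (\<lambda>_. c)"
  by (auto simp: centered_on_def)

lemma centered_on_degen:
  assumes "i \<in> I" "j \<in> I" "i \<noteq> j"
  shows "centered_on I M {i, j} (\<lambda>z. c * degen i j (z i) (z j))"
  unfolding centered_on_def
proof (intro conjI ballI exI)
  show "\<bar>c * degen i j (z i) (z j)\<bar> \<le> \<bar>c\<bar> * 4" for z
    unfolding abs_mult using degen_abs by (intro mult_left_mono) auto
next
  note [measurable] = assms(1,2)
  show "(\<lambda>z. c * degen i j (z i) (z j)) \<in> borel_measurable (Pi\<^sub>M I M)" 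
    unfolding degen_def by measurable
next
  fix z i' assume z: "z \<in> space (Pi\<^sub>M I M)" and "i' \<in> {i, j}"
  then consider "i' = i" | "i' = j" by auto
  then show "(\<integral>y. c * degen i j ((z(i' := y)) i) ((z(i' := y)) j) \<partial>M i') = 0"
  proof cases
    case 1
    then show ?thesis using assms integral_degen[OF space_component[OF z assms(2)], where i=j and j=i]
      by (simp add: degen_sym[of j i])
  next
    case 2
    then show ?thesis using assms integral_degen[OF space_component[OF z assms(1)], where i=i and j=j] by simp
  qed
qed (use assms in auto)

lemma P_prob_space: "prob_space (Pi\<^sub>M I M)"
  by (rule prob_space_PiM) (rule prob_space)

lemma k_pair_integrable: "i \<in> I \<Longrightarrow> j \<in> I \<Longrightarrow> integrable (Pi\<^sub>M I M) (\<lambda>z. k (z i) (z j))"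
proof -
  assume ij [measurable]: "i \<in> I" "j \<in> I"
  show ?thesis using k_abs by (intro P.integrable_bounded_on) auto
qed

lemma integral_centered_eq_0: 
  assumes "centered_on I M A u" "A \<noteq> {}"
  shows "integrable (Pi\<^sub>M I M) u" "(\<integral>z. u z \<partial>Pi\<^sub>M I M) = 0"
  using centered_on_orthogonal[OF fin_I assms(1) centered_on_const[of 1] assms(2)]
    centered_on_integrable_mult[OF P_prob_space assms(1) centered_on_const[of 1]] by auto

text \<open>The fully degenerate part is the orthogonal projection of the kernel onto its component, hence not larger than the kernel in
  mean square; and \<open>k\<^sup>2 \<le> k\<close>.\<close>

lemma
  assumes ij: "i \<in> I" "j \<in> I" "i \<noteq> j"
  shows integral_k_pair: "(\<integral>z. k (z i) (z j) \<partial>Pi\<^sub>M I M) = mean i j"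
    and integral_degen_sq_le: "(\<integral>z. (degen i j (z i) (z j))\<^sup>2 \<partial>Pi\<^sub>M I M) \<le> mean i j"
proof -
  note [measurable] = ij(1,2)
  define r where "r = (\<lambda>z. degen i j (z i) (z j))"
  define a where "a = (\<lambda>z. proj j (z i) - mean i j)"
  define b where "b = (\<lambda>z. proj i (z j) - mean j i)"
  have r: "centered_on I M {i, j} r"
    using centered_on_degen[OF ij, of 1] by (simp add: r_def)
  have a: "centered_on I M {i} a"
    unfolding a_def mean_def using proj_abs by (intro centered_on_proj ij) auto
  have b: "centered_on I M {j} b"
    unfolding b_def mean_def using proj_abs by (intro centered_on_proj ij) auto
  have k: "k (z i) (z j) = r z + a z + b z + mean i j" for z
    by (simp add: r_def a_def b_def degen_def mean_sym[of j i])
  show *: "(\<integral>z. k (z i) (z j) \<partial>Pi\<^sub>M I M) = mean i j"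
    unfolding k using integral_centered_eq_0[OF r] integral_centered_eq_0[OF a] integral_centered_eq_0[OF b]
    by (simp add: P.prob_space)
  note int = centered_on_integrable_mult[OF P_prob_space r]
  have orth: "(\<integral>z. r z * a z \<partial>Pi\<^sub>M I M) = 0" "(\<integral>z. r z * b z \<partial>Pi\<^sub>M I M) = 0"
     "(\<integral>z. r z * mean i j \<partial>Pi\<^sub>M I M) = 0"
    using ij integral_centered_eq_0(2)[OF r] by (auto intro!: centered_on_orthogonal[OF fin_I r] a b)
  have irk: "integrable (Pi\<^sub>M I M) (\<lambda>z. r z * k (z i) (z j))"
    unfolding k distrib_left by (intro Bochner_Integration.integrable_add int[OF r] int[OF a] int[OF b] int[OF centered_on_const])
  have rk: "(\<integral>z. r z * k (z i) (z j) \<partial>Pi\<^sub>M I M) = (\<integral>z. r z * r z \<partial>Pi\<^sub>M I M)"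
    unfolding k distrib_left
    using int[OF r] int[OF a] int[OF b] int[OF centered_on_const[of "mean i j"]] orth
    by simp
  have ik2: "integrable (Pi\<^sub>M I M) (\<lambda>z. k (z i) (z j) * k (z i) (z j))"
    using k_nonneg k_le1 by (intro P.integrable_bounded_on[of _ 1]) (auto simp: abs_mult mult_le_one)
  have "0 \<le> (\<integral>z. (r z - k (z i) (z j))\<^sup>2 \<partial>Pi\<^sub>M I M)" by simp
  also have "\<dots> = (\<integral>z. r z * r z - 2 * (r z * k (z i) (z j)) + k (z i) (z j) * k (z i) (z j) \<partial>Pi\<^sub>M I M)"
    by (simp add: power2_eq_square algebra_simps)
  also have "\<dots> = (\<integral>z. k (z i) (z j) * k (z i) (z j) \<partial>Pi\<^sub>M I M) - (\<integral>z. r z * r z \<partial>Pi\<^sub>M I M)"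
    using int[OF r] irk ik2 rk by simp
  finally have "(\<integral>z. r z * r z \<partial>Pi\<^sub>M I M) \<le> (\<integral>z. k (z i) (z j) * k (z i) (z j) \<partial>Pi\<^sub>M I M)" by simp
  also have "\<dots> \<le> (\<integral>z. k (z i) (z j) \<partial>Pi\<^sub>M I M)"
    using k_nonneg k_le1 by (intro integral_mono ik2 k_pair_integrable ij) (simp add: mult_left_le)
  finally show "(\<integral>z. (degen i j (z i) (z j))\<^sup>2 \<partial>Pi\<^sub>M I M) \<le> mean i j"
    unfolding * by (simp add: r_def power2_eq_square)
qed

lemma integral_component:
  fixes g :: "'a \<Rightarrow> real"
  assumes "i \<in> I" "g \<in> borel_measurable N"
  shows "(\<integral>z. g (z i) \<partial>Pi\<^sub>M I M) = (\<integral>x. g x \<partial>M i)"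
proof -
  have "(\<integral>x. g x \<partial>distr (Pi\<^sub>M I M) (M i) (\<lambda>z. z i)) = (\<integral>z. g (z i) \<partial>Pi\<^sub>M I M)"
    by (rule integral_distr) (use assms in auto)
  then show ?thesis using PiM_component[OF assms(1)] by simp
qed

text \<open>Half of the coefficient of observation \<open>i\<close> in the linear part of the weighted sum; by symmetry of the weights
  each observation occurs in both positions of a pair.\<close>

definition "lin_part w i x = (\<Sum>j\<in>I - {i}. w i j * proj j x)"

lemma lin_part_measurable [measurable]: "lin_part w i \<in> borel_measurable N"
  unfolding lin_part_def by measurable

lemma lin_part_abs: "\<bar>lin_part w i x\<bar> \<le> (\<Sum>j\<in>I - {i}. \<bar>w i j\<bar>)"
  unfolding lin_part_def using proj_abs
  by (intro order_trans[OF sum_abs] sum_mono) (simp add: abs_mult mult_left_le)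

text \<open>The centred sum is regrouped into components indexed by the sets \<open>{i}\<close> (linear parts) and \<open>{i, j}\<close> (degenerate
  parts). These sets are distinct, so the components are orthogonal and their second moments add up.\<close>

lemma variance_off_diagonal_sum:
  fixes w :: "'i \<Rightarrow> 'i \<Rightarrow> real"
  assumes w: "\<And>i j. w i j = w j i"
  defines "D \<equiv> {(i, j). i \<in> I \<and> j \<in> I \<and> i \<noteq> j}"
  shows "(\<integral>z. ((\<Sum>(i, j)\<in>D. w i j * k (z i) (z j)) - (\<Sum>(i, j)\<in>D. w i j * mean i j))\<^sup>2 \<partial>Pi\<^sub>M I M)
     \<le> 4 * (\<Sum>i\<in>I. \<integral>x. (lin_part w i x)\<^sup>2 \<partial>M i) + 2 * (\<Sum>(i, j)\<in>D. (w i j)\<^sup>2 * mean i j)"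
proof -
  (* one index per component: (i, i) stands for the set {i}, and (i, j) with i < j for {i, j} *)
  define L where "L = {(i, j). i \<in> I \<and> j \<in> I \<and> i < j}"
  define J where "J = (\<lambda>i. (i, i)) ` I \<union> L"
  define m where "m = (\<lambda>i. \<integral>x. lin_part w i x \<partial>M i)"
  define u where "u = (\<lambda>(i, j). \<lambda>z. if i = j then 2 * (lin_part w i (z i) - m i)
      else 2 * w i j * degen i j (z i) (z j))"
  have fin: "finite D" "finite L" "finite J"
    by (rule finite_subset[of _ "I \<times> I"]; use fin_I in \<open>auto simp: J_def D_def L_def\<close>)+
  have D_Sigma: "D = (SIGMA i:I. I - {i})" by (auto simp: D_def)
  have m: "m i = (\<Sum>j\<in>I - {i}. w i j * mean i j)" for i
    unfolding m_def lin_part_def mean_def using proj_integrable by (subst Bochner_Integration.integral_sum) auto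
  have off: "(\<Sum>(i, j)\<in>D. f i j) = 2 * (\<Sum>(i, j)\<in>L. f i j)" if "\<And>i j. f i j = f j i" for f :: "'i \<Rightarrow> 'i \<Rightarrow> real"
    unfolding D_def L_def by (rule sum_off_diagonal_symmetric[OF fin_I that])
  have sumJ: "(\<Sum>p\<in>J. f p) = (\<Sum>i\<in>I. f (i, i)) + (\<Sum>p\<in>L. f p)" for f :: "'i \<times> 'i \<Rightarrow> real"
    unfolding J_def using fin fin_I
    by (subst sum.union_disjoint) (auto simp: L_def sum.reindex inj_on_def)
  have decomp: "(\<Sum>(i, j)\<in>D. w i j * k (z i) (z j)) - (\<Sum>(i, j)\<in>D. w i j * mean i j) = (\<Sum>p\<in>J. u p z)" for z
  proof -
    have lin: "(\<Sum>(i, j)\<in>D. w i j * (proj j (z i) - mean i j)) = (\<Sum>i\<in>I. lin_part w i (z i) - m i)"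
      unfolding D_Sigma using fin_I
      by (subst sum.Sigma[symmetric]) (auto simp: lin_part_def m right_diff_distrib sum_subtractf)
    have lin': "(\<Sum>(i, j)\<in>D. w i j * (proj i (z j) - mean i j)) = (\<Sum>(i, j)\<in>D. w i j * (proj j (z i) - mean i j))"
      by (rule sum.reindex_bij_witness[of _ prod.swap prod.swap])
         (use mean_sym w in \<open>auto simp: D_def\<close>)
    have "(\<Sum>(i, j)\<in>D. w i j * k (z i) (z j)) - (\<Sum>(i, j)\<in>D. w i j * mean i j) =
      (\<Sum>(i, j)\<in>D. w i j * degen i j (z i) (z j)) + (\<Sum>(i, j)\<in>D. w i j * (proj j (z i) - mean i j))
      + (\<Sum>(i, j)\<in>D. w i j * (proj i (z j) - mean i j))"
      unfolding sum_subtractf[symmetric] sum.distrib[symmetric]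
      by (intro sum.cong refl) (auto simp: degen_def algebra_simps)
    also have "\<dots> = 2 * (\<Sum>(i, j)\<in>L. w i j * degen i j (z i) (z j)) + 2 * (\<Sum>i\<in>I. lin_part w i (z i) - m i)"
      unfolding lin' lin by (subst off) (use w degen_sym in \<open>auto simp: algebra_simps\<close>)
    also have "\<dots> = (\<Sum>p\<in>J. u p z)"
      unfolding sumJ by (auto simp: u_def sum_distrib_left L_def intro!: sum.cong)
    finally show ?thesis .
  qed
  have cent: "centered_on I M {fst p, snd p} (u p)" if pJ: "p \<in> J" for p
  proof (cases "fst p = snd p")
    case True
    then obtain i where p: "p = (i, i)" "i \<in> I" using pJ by (auto simp: J_def L_def)
    have "centered_on I M {i} (\<lambda>z. 2 * lin_part w i (z i) - (\<integral>x. 2 * lin_part w i x \<partial>M i))"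
      by (rule centered_on_proj[OF p(2), where B="2 * (\<Sum>j\<in>I - {i}. \<bar>w i j\<bar>)"])
         (use lin_part_abs in \<open>auto simp: abs_mult\<close>)
    then show ?thesis using p by (simp add: u_def m_def right_diff_distrib)
  next
    case False
    then show ?thesis using pJ centered_on_degen[of "fst p" "snd p" "2 * w (fst p) (snd p)"]
      by (auto simp: J_def L_def u_def split: prod.splits)
  qed
  have inj: "inj_on (\<lambda>p. {fst p, snd p}) J"
    by (auto simp: inj_on_def J_def L_def doubleton_eq_iff)
  have "(\<integral>z. ((\<Sum>(i, j)\<in>D. w i j * k (z i) (z j)) - (\<Sum>(i, j)\<in>D. w i j * mean i j))\<^sup>2 \<partial>Pi\<^sub>M I M)
     = (\<Sum>p\<in>J. \<integral>z. (u p z)\<^sup>2 \<partial>Pi\<^sub>M I M)"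
    unfolding decomp by (rule second_moment_sum_centered[OF fin_I fin(3) cent inj])
  also have "\<dots> = (\<Sum>i\<in>I. \<integral>z. (2 * (lin_part w i (z i) - m i))\<^sup>2 \<partial>Pi\<^sub>M I M) +
     (\<Sum>(i, j)\<in>L. \<integral>z. (2 * w i j * degen i j (z i) (z j))\<^sup>2 \<partial>Pi\<^sub>M I M)"
    unfolding sumJ
    by (intro arg_cong2[where f="(+)"] sum.cong refl) (auto simp: u_def L_def intro!: Bochner_Integration.integral_cong)
  also have "\<dots> \<le> (\<Sum>i\<in>I. 4 * (\<integral>x. (lin_part w i x)\<^sup>2 \<partial>M i)) + (\<Sum>(i, j)\<in>L. 4 * ((w i j)\<^sup>2 * mean i j))"
  proof (intro add_mono sum_mono)
    fix i assume i: "i \<in> I"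
    let ?B = "\<Sum>j\<in>I - {i}. \<bar>w i j\<bar>"
    have i1: "integrable (M i) (lin_part w i)"
      using lin_part_abs by (intro M.integrable_bounded_on) auto
    have i2: "integrable (M i) (\<lambda>x. (lin_part w i x)\<^sup>2)"
    proof (rule M.integrable_bounded_on)
      show "\<bar>(lin_part w i x)\<^sup>2\<bar> \<le> ?B\<^sup>2" for x
        using power_mono[OF lin_part_abs[of w i x], of 2] by simp
    qed simp
    have "(\<integral>z. (2 * (lin_part w i (z i) - m i))\<^sup>2 \<partial>Pi\<^sub>M I M) = (\<integral>x. (2 * (lin_part w i x - m i))\<^sup>2 \<partial>M i)"
      by (rule integral_component[OF i]) measurable
    also have "\<dots> = 4 * M.variance i (lin_part w i)"
      unfolding power_mult_distrib m_def by simp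
    also have "\<dots> \<le> 4 * (\<integral>x. (lin_part w i x)\<^sup>2 \<partial>M i)"
      using M.variance_eq[OF i1 i2] by simp
    finally show "(\<integral>z. (2 * (lin_part w i (z i) - m i))\<^sup>2 \<partial>Pi\<^sub>M I M) \<le> 4 * (\<integral>x. (lin_part w i x)\<^sup>2 \<partial>M i)" .
  next
    fix p assume p: "p \<in> L"
    then show "(case p of (i, j) \<Rightarrow> \<integral>z. (2 * w i j * degen i j (z i) (z j))\<^sup>2 \<partial>Pi\<^sub>M I M)
       \<le> (case p of (i, j) \<Rightarrow> 4 * ((w i j)\<^sup>2 * mean i j))"
      using integral_degen_sq_le
      by (auto simp: L_def power_mult_distrib intro!: mult_left_mono)
  qed
  also have "\<dots> = 4 * (\<Sum>i\<in>I. \<integral>x. (lin_part w i x)\<^sup>2 \<partial>M i) + 2 * (\<Sum>(i, j)\<in>D. (w i j)\<^sup>2 * mean i j)"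
    using w mean_sym by (subst off) (auto simp: sum_distrib_left case_prod_unfold)
  finally show ?thesis .
qed

end

section \<open>Energies of densities in a Sobolev ball\<close>

lemma fourier_sq_le_sobolev_integrand:
  assumes "s > 0"
  shows "(cmod (fourier f \<omega>))\<^sup>2 \<le> sobolev_integrand s f \<omega>"
  using assms mult_right_mono[OF ge_one_powr_ge_zero[of "1 + (norm \<omega>)\<^sup>2" s], of "(cmod (fourier f \<omega>))\<^sup>2"]
  by (simp add: sobolev_integrand_def)

text \<open>Membership in the ball controls the mean square of the function itself, through the inequality between
  \<open>\<integral> f\<^sup>2\<close> and \<open>\<integral> |F f|\<^sup>2\<close>.\<close>

lemma sobolev_ballD:
  fixes f :: "real ^ 'd::finite \<Rightarrow> real"
  assumes f: "f \<in> sobolev_ball s M" and s: "s > 0"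
  shows "integrable lborel f" "AE x in lborel. isCont f x" "integrable lborel (sobolev_integrand s f)"
    "(LINT \<omega>|lborel. sobolev_integrand s f \<omega>) \<le> M\<^sup>2" "0 \<le> M"
    "integrable lborel (\<lambda>\<omega>. (cmod (fourier f \<omega>))\<^sup>2)" "(LINT \<omega>|lborel. (cmod (fourier f \<omega>))\<^sup>2) \<le> M\<^sup>2"
    "integrable lborel (\<lambda>x. (f x)\<^sup>2)" "(LINT x|lborel. (f x)\<^sup>2) \<le> M\<^sup>2"
proof -
  show 1: "integrable lborel f" and 2: "AE x in lborel. isCont f x" 
    and 3: "integrable lborel (sobolev_integrand s f)"
    using f by (auto simp: sobolev_ball_def sobolev_def)
  have le: "sqrt (LINT \<omega>|lborel. sobolev_integrand s f \<omega>) \<le> M"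
    using f by (auto simp: sobolev_ball_def sobolev_norm_def)
  have "0 \<le> (LINT \<omega>|lborel. sobolev_integrand s f \<omega>)"
    by (simp add: sobolev_integrand_def)
  then show "0 \<le> M" using le real_sqrt_ge_zero order_trans by blast
  show 4: "(LINT \<omega>|lborel. sobolev_integrand s f \<omega>) \<le> M\<^sup>2" using le by (rule sqrt_le_D)
  have [measurable]: "f \<in> borel_measurable borel" using 1 by auto
  show 5: "integrable lborel (\<lambda>\<omega>. (cmod (fourier f \<omega>))\<^sup>2)"
  proof (rule Bochner_Integration.integrable_bound[OF 3])
    show "AE \<omega> in lborel. norm ((cmod (fourier f \<omega>))\<^sup>2) \<le> norm (sobolev_integrand s f \<omega>)"
      using order_trans[OF fourier_sq_le_sobolev_integrand[OF s, of f] abs_ge_self] by auto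
  qed measurable
  show 6: "(LINT \<omega>|lborel. (cmod (fourier f \<omega>))\<^sup>2) \<le> M\<^sup>2"
    by (rule order_trans[OF integral_mono[OF 5 3 fourier_sq_le_sobolev_integrand[OF s]] 4])
  show "integrable lborel (\<lambda>x. (f x)\<^sup>2)" "(LINT x|lborel. (f x)\<^sup>2) \<le> M\<^sup>2"
    using fourier_L2_imp_integrable_sq[OF 1 2 5] integral_sq_le_fourier[OF 1 2 5] 6 by auto
qed

lemma gauss_energy_le:
  fixes f :: "real ^ 'd::finite \<Rightarrow> real"
  assumes f: "integrable lborel f" and \<nu>: "\<nu> > 0" 
    and F: "integrable lborel (\<lambda>\<omega>. (cmod (fourier f \<omega>))\<^sup>2)"
  shows "gauss_energy \<nu> f \<le> (pi / \<nu>) powr (real CARD('d) / 2) * (LINT \<omega>|lborel. (cmod (fourier f \<omega>))\<^sup>2)"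
  unfolding gauss_energy_spectral(2)[OF f \<nu>] using gauss_energy_spectral(1)[OF f \<nu>] F \<nu>
  by (intro mult_left_mono integral_mono) (auto intro!: mult_left_le_one_le)

lemma integral_mult_smooth_le:
  fixes p f :: "real ^ 'd::finite \<Rightarrow> real"
  assumes p: "p \<in> sobolev_ball s M" and s: "s > 0" and f: "integrable lborel f" and \<nu>: "\<nu> > 0"
  shows "integrable lborel (\<lambda>x. p x * gauss_smooth \<nu> f x)"
    and "(LINT x|lborel. \<bar>p x * gauss_smooth \<nu> f x\<bar>) \<le> M * sqrt ((pi / \<nu>) powr (real CARD('d) / 2) * gauss_energy \<nu> f)"
proof -
  note P = sobolev_ballD[OF p s]
  have [measurable]: "f \<in> borel_measurable borel" "p \<in> borel_measurable borel" using f P by auto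
  note CS = Cauchy_Schwarz_integral[of p lborel "gauss_smooth \<nu> f", OF _ _ P(8) integrable_gauss_smooth_sq[OF f \<nu>]]
  show "integrable lborel (\<lambda>x. p x * gauss_smooth \<nu> f x)" using CS(1) by simp
  have "(LINT x|lborel. \<bar>p x * gauss_smooth \<nu> f x\<bar>)\<^sup>2 \<le> (LINT x|lborel. (p x)\<^sup>2) * (LINT x|lborel. (gauss_smooth \<nu> f x)\<^sup>2)"
    using CS(2) by simp
  also have "\<dots> \<le> M\<^sup>2 * ((pi / \<nu>) powr (real CARD('d) / 2) * gauss_energy \<nu> f)"
    by (intro mult_mono P gauss_smooth_sq_integral_le f \<nu>) auto
  finally have "(LINT x|lborel. \<bar>p x * gauss_smooth \<nu> f x\<bar>) \<le> sqrt (M\<^sup>2 * ((pi / \<nu>) powr (real CARD('d) / 2) * gauss_energy \<nu> f))"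
    by (rule real_le_rsqrt)
  then show "(LINT x|lborel. \<bar>p x * gauss_smooth \<nu> f x\<bar>) \<le> M * sqrt ((pi / \<nu>) powr (real CARD('d) / 2) * gauss_energy \<nu> f)"
    using P(5) by (simp add: real_sqrt_mult)
qed

text \<open>Bounds the mean of the kernel between two observations. Smoothing has operator norm \<open>(\<pi>/\<nu>)\<^bsup>d/2\<^esup>\<close> on square
  integrable functions, and both densities have norm at most \<open>M\<close>.\<close>

lemma integral_density_smooth_le:
  fixes p q :: "real ^ 'd::finite \<Rightarrow> real"
  assumes p: "p \<in> sobolev_ball s M" and q: "q \<in> sobolev_ball s M" and s: "s > 0" and \<nu>: "\<nu> > 0"
  shows "(LINT x|lborel. p x * gauss_smooth \<nu> q x) \<le> (pi / \<nu>) powr (real CARD('d) / 2) * M\<^sup>2"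
proof -
  note Q = sobolev_ballD[OF q s]
  define K where "K = (pi / \<nu>) powr (real CARD('d) / 2)"
  have K: "0 \<le> K" by (simp add: K_def)
  have "gauss_energy \<nu> q \<le> K * M\<^sup>2"
    using gauss_energy_le[OF Q(1) \<nu> Q(6)] mult_left_mono[OF Q(7) K] unfolding K_def by linarith
  then have "K * gauss_energy \<nu> q \<le> K * (K * M\<^sup>2)" using K by (intro mult_left_mono) auto
  then have "sqrt (K * gauss_energy \<nu> q) \<le> sqrt ((K * M)\<^sup>2)"
    by (intro real_sqrt_le_mono) (simp add: power2_eq_square algebra_simps)
  then have "sqrt (K * gauss_energy \<nu> q) \<le> K * M" using K Q(5) by simp
  then have "M * sqrt (K * gauss_energy \<nu> q) \<le> M * (K * M)" using Q(5) by (intro mult_left_mono)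
  moreover have "(LINT x|lborel. p x * gauss_smooth \<nu> q x) \<le> (LINT x|lborel. \<bar>p x * gauss_smooth \<nu> q x\<bar>)"
    using integral_abs_bound[of lborel "\<lambda>x. p x * gauss_smooth \<nu> q x"] by linarith
  ultimately show ?thesis
    using integral_mult_smooth_le(2)[OF p s Q(1) \<nu>] unfolding K_def
    by (simp add: power2_eq_square algebra_simps)
qed

text \<open>Bounds the variance of the linear part of the statistic. One factor \<open>gauss_smooth \<nu> f\<close> is bounded uniformly by
  the root of the energy, the other one is paired with \<open>p\<close> by the Cauchy-Schwarz inequality; each contributes a
  root of the energy, and smoothing contributes \<open>(\<pi>/\<nu>)\<^bsup>d/4\<^esup>\<close>.\<close>

lemma integral_density_smooth_sq_le:
  fixes p f :: "real ^ 'd::finite \<Rightarrow> real"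
  assumes p: "p \<in> sobolev_ball s M" and p0: "\<And>x. 0 \<le> p x" and s: "s > 0" and f: "integrable lborel f" and \<nu>: "\<nu> > 0"
  shows "(LINT x|lborel. p x * (gauss_smooth \<nu> f x)\<^sup>2) \<le>
     M * sqrt ((pi / \<nu>) powr (real CARD('d) / 2)) * gauss_energy \<nu> f"
proof -
  note P = sobolev_ballD[OF p s]
  define E where "E = gauss_energy \<nu> f"
  have E0: "0 \<le> E" unfolding E_def by (rule gauss_energy_nonneg[OF f \<nu>])
  have [measurable]: "f \<in> borel_measurable borel" "p \<in> borel_measurable borel" using f P by auto
  have T: "\<bar>gauss_smooth \<nu> f x\<bar> \<le> sqrt E" for x
    using gauss_smooth_sq_le_energy[OF f \<nu>, of x] by (simp add: E_def real_le_rsqrt)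
  have "(LINT x|lborel. p x * (gauss_smooth \<nu> f x)\<^sup>2) \<le> (LINT x|lborel. sqrt E * \<bar>p x * gauss_smooth \<nu> f x\<bar>)"
  proof (rule integral_mono)
    show "integrable lborel (\<lambda>x. sqrt E * \<bar>p x * gauss_smooth \<nu> f x\<bar>)"
      by (intro integrable_mult_right integrable_abs integral_mult_smooth_le(1)[OF p s f \<nu>])
    show *: "p x * (gauss_smooth \<nu> f x)\<^sup>2 \<le> sqrt E * \<bar>p x * gauss_smooth \<nu> f x\<bar>" for x
    proof -
      have "p x * (gauss_smooth \<nu> f x)\<^sup>2 = \<bar>gauss_smooth \<nu> f x\<bar> * \<bar>p x * gauss_smooth \<nu> f x\<bar>"
        using p0[of x] by (simp add: abs_mult power2_eq_square)
      also have "\<dots> \<le> sqrt E * \<bar>p x * gauss_smooth \<nu> f x\<bar>" using T by (intro mult_right_mono) auto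
      finally show ?thesis .
    qed
    then show "integrable lborel (\<lambda>x. p x * (gauss_smooth \<nu> f x)\<^sup>2)"
      using p0 E0
      by (intro Bochner_Integration.integrable_bound[OF integrable_mult_right[OF integrable_abs[OF integral_mult_smooth_le(1)[OF p s f \<nu>]], of "sqrt E"]])
         (auto simp: abs_mult)
  qed
  also have "\<dots> \<le> sqrt E * (M * sqrt ((pi / \<nu>) powr (real CARD('d) / 2) * E))"
    using integral_mult_smooth_le(2)[OF p s f \<nu>] E0 unfolding E_def by (simp add: mult_left_mono)
  also have "\<dots> = M * sqrt ((pi / \<nu>) powr (real CARD('d) / 2)) * (sqrt E * sqrt E)"
    by (simp add: real_sqrt_mult)
  finally show ?thesis using E0 by (simp add: E_def)
qed

section \<open>The pooled sample\<close>

definition pooled_density :: "(real ^ 'd \<Rightarrow> real) \<Rightarrow> (real ^ 'd \<Rightarrow> real) \<Rightarrow> nat \<Rightarrow> nat \<Rightarrow> real ^ 'd \<Rightarrow> real" where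
  "pooled_density p q n i = (if i \<le> n then p else q)"

definition pooled_marginal :: "(real ^ 'd \<Rightarrow> real) \<Rightarrow> (real ^ 'd \<Rightarrow> real) \<Rightarrow> nat \<Rightarrow> nat \<Rightarrow> (real ^ 'd) measure" where
  "pooled_marginal p q n i = density lborel (\<lambda>x. ennreal (pooled_density p q n i x))"

text \<open>Both samples in one extensional family, so that the law of the pair of samples becomes a product measure
  over a single index set, to which the Hoeffding decomposition applies. The values agree with
  \<open>pooled_sample\<close> on the indices that the statistics use.\<close>

definition pool :: "nat \<Rightarrow> nat \<Rightarrow> (nat \<Rightarrow> 'a) \<times> (nat \<Rightarrow> 'a) \<Rightarrow> nat \<Rightarrow> 'a" where
  "pool n m = (\<lambda>(x, y). \<lambda>i\<in>{1..n + m}. if i \<le> n then x i else y (i - n))"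

lemma
  fixes p q :: "real ^ 'd::finite \<Rightarrow> real"
  assumes p: "prob_density p" and q: "prob_density q"
  shows measurable_pool: "pool n m \<in> sample_law p q n m \<rightarrow>\<^sub>M (\<Pi>\<^sub>M i\<in>{1..n + m}. pooled_marginal p q n i)"
    and distr_pool: "distr (sample_law p q n m) (\<Pi>\<^sub>M i\<in>{1..n + m}. pooled_marginal p q n i) (pool n m)
      = (\<Pi>\<^sub>M i\<in>{1..n + m}. pooled_marginal p q n i)"
proof -
  let ?X = "density lborel (\<lambda>x. ennreal (p x))" and ?Y = "density lborel (\<lambda>x. ennreal (q x))"
  let ?M = "pooled_marginal p q n"
  interpret X: prob_space ?X using p by (simp add: prob_density_def)
  interpret Y: prob_space ?Y using q by (simp add: prob_density_def)
  interpret PX: product_prob_space "\<lambda>_. ?X" "{1..n}" ..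
  interpret PY: product_prob_space "\<lambda>_. ?Y" "{1..m}" ..
  have M: "?M i = (if i \<le> n then ?X else ?Y)" for i
    by (simp add: pooled_marginal_def pooled_density_def)
  interpret PM: product_prob_space ?M "{1..n+m}"
    by (rule product_prob_spaceI) (simp add: M X.prob_space_axioms Y.prob_space_axioms)
  have [measurable_cong]: "sets (?M i) = sets borel" for i by (simp add: M)
  show meas: "pool n m \<in> sample_law p q n m \<rightarrow>\<^sub>M (\<Pi>\<^sub>M i\<in>{1..n + m}. ?M i)"
    unfolding sample_law_def pool_def split_beta'
  proof (rule measurable_restrict)
    fix i assume i: "i \<in> {1..n+m}"
    show "(\<lambda>w. if i \<le> n then fst w i else snd w (i - n)) \<in> (\<Pi>\<^sub>M i\<in>{1..n}. ?X) \<Otimes>\<^sub>M (\<Pi>\<^sub>M j\<in>{1..m}. ?Y) \<rightarrow>\<^sub>M ?M i"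
    proof (cases "i \<le> n")
      case True
      then have "i \<in> {1..n}" using i by simp
      then have "(\<lambda>w. fst w i) \<in> (\<Pi>\<^sub>M i\<in>{1..n}. ?X) \<Otimes>\<^sub>M (\<Pi>\<^sub>M j\<in>{1..m}. ?Y) \<rightarrow>\<^sub>M ?X"
        by (rule measurable_compose[OF measurable_fst measurable_component_singleton])
      then show ?thesis using True by (simp add: M)
    next
      case False
      then have "i - n \<in> {1..m}" using i by auto
      then have "(\<lambda>w. snd w (i - n)) \<in> (\<Pi>\<^sub>M i\<in>{1..n}. ?X) \<Otimes>\<^sub>M (\<Pi>\<^sub>M j\<in>{1..m}. ?Y) \<rightarrow>\<^sub>M ?Y"
        by (rule measurable_compose[OF measurable_snd measurable_component_singleton])
      then show ?thesis using False by (simp add: M)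
    qed
  qed
  show "distr (sample_law p q n m) (\<Pi>\<^sub>M i\<in>{1..n + m}. ?M i) (pool n m) = (\<Pi>\<^sub>M i\<in>{1..n + m}. ?M i)"
  proof (rule PM.PiM_eqI)
    fix A assume A: "\<And>i. i \<in> {1..n+m} \<Longrightarrow> A i \<in> sets (?M i)"
    let ?AX = "\<Pi>\<^sub>E i\<in>{1..n}. A i" and ?AY = "\<Pi>\<^sub>E j\<in>{1..m}. A (j + n)"
    have A': "A i \<in> sets borel" if "1 \<le> i" "i \<le> n + m" for i using A[of i] that by (simp add: M split: if_splits)
    have pre: "pool n m -` Pi\<^sub>E {1..n+m} A \<inter> space (sample_law p q n m) = ?AX \<times> ?AY"
    proof (intro set_eqI iffI)
      fix w assume w: "w \<in> pool n m -` Pi\<^sub>E {1..n+m} A \<inter> space (sample_law p q n m)"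
      obtain x y where xy: "w = (x, y)" by (cases w)
      have sp: "x \<in> extensional {1..n}" "y \<in> extensional {1..m}" 
        using w by (auto simp: xy sample_law_def space_pair_measure space_PiM PiE_def)
      have in_A: "pool n m w i \<in> A i" if "i \<in> {1..n+m}" for i using w that by (auto simp: PiE_def)
      have "x i \<in> A i" if "i \<in> {1..n}" for i using in_A[of i] that by (simp add: pool_def xy)
      moreover have "y j \<in> A (j + n)" if "j \<in> {1..m}" for j using in_A[of "j + n"] that by (simp add: pool_def xy)
      ultimately show "w \<in> ?AX \<times> ?AY" using sp by (auto simp: xy PiE_def)
    next
      fix w assume w: "w \<in> ?AX \<times> ?AY"
      then obtain x y where xy: "w = (x, y)" "x \<in> ?AX" "y \<in> ?AY" by auto
      have "pool n m w i \<in> A i" if i: "i \<in> {1..n+m}" for i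
      proof (cases "i \<le> n")
        case True then show ?thesis using xy i by (auto simp: pool_def)
      next
        case False
        then have "i - n \<in> {1..m}" using i by auto
        with False i xy(3) have "y (i - n) \<in> A (i - n + n)" by (auto simp: PiE_def Pi_def)
        then show ?thesis using False i by (simp add: pool_def xy)
      qed
      moreover have "w \<in> space (sample_law p q n m)"
        using xy by (auto simp: sample_law_def space_pair_measure space_PiM PiE_def)
      ultimately show "w \<in> pool n m -` Pi\<^sub>E {1..n+m} A \<inter> space (sample_law p q n m)"
        by (auto simp: PiE_def pool_def split: prod.splits)
    qed
    have "emeasure (distr (sample_law p q n m) (Pi\<^sub>M {1..n+m} ?M) (pool n m)) (Pi\<^sub>E {1..n+m} A) = 
        emeasure (sample_law p q n m) (?AX \<times> ?AY)"
      by (subst emeasure_distr[OF meas]) (use A pre in \<open>auto intro!: sets_PiM_I_finite\<close>)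
    also have "\<dots> = emeasure (PiM {1..n} (\<lambda>_. ?X)) ?AX * emeasure (PiM {1..m} (\<lambda>_. ?Y)) ?AY"
      unfolding sample_law_def
      by (rule PY.P.emeasure_pair_measure_Times) (auto intro!: sets_PiM_I_finite A')
    also have "\<dots> = (\<Prod>i\<in>{1..n}. emeasure ?X (A i)) * (\<Prod>j\<in>{1..m}. emeasure ?Y (A (j + n)))"
    proof (intro arg_cong2[where f="(*)"])
      show "emeasure (PiM {1..n} (\<lambda>_. ?X)) ?AX = (\<Prod>i\<in>{1..n}. emeasure ?X (A i))"
        by (rule PX.emeasure_PiM) (use A' in auto)
      show "emeasure (PiM {1..m} (\<lambda>_. ?Y)) ?AY = (\<Prod>j\<in>{1..m}. emeasure ?Y (A (j + n)))"
        by (rule PY.emeasure_PiM) (use A' in auto)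
    qed
    also have "(\<Prod>i\<in>{1..n}. emeasure ?X (A i)) = (\<Prod>i\<in>{1..n}. emeasure (?M i) (A i))"
      by (intro prod.cong) (auto simp: M)
    also have "(\<Prod>j\<in>{1..m}. emeasure ?Y (A (j + n))) = (\<Prod>i\<in>{n+1..n+m}. emeasure (?M i) (A i))"
      by (rule prod.reindex_bij_witness[of _ "\<lambda>i. i - n" "\<lambda>j. j + n"]) (auto simp: M)
    also have "(\<Prod>i\<in>{1..n}. emeasure (?M i) (A i)) * (\<Prod>i\<in>{n+1..n+m}. emeasure (?M i) (A i))
       = (\<Prod>i\<in>{1..n+m}. emeasure (?M i) (A i))"
      by (rule prod.ub_add_nat[symmetric]) simp
    finally show "emeasure (distr (sample_law p q n m) (Pi\<^sub>M {1..n+m} ?M) (pool n m)) (Pi\<^sub>E {1..n+m} A)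
       = (\<Prod>i\<in>{1..n+m}. emeasure (?M i) (A i))" .
  qed auto
qed

lemma sum_off_diagonal_union:
  fixes f :: "'i \<Rightarrow> 'i \<Rightarrow> real"
  assumes A: "finite A" and B: "finite B" and AB: "A \<inter> B = {}"
  defines "D \<equiv> \<lambda>A. {(i, j). i \<in> A \<and> j \<in> A \<and> i \<noteq> j}"
  shows "(\<Sum>(i, j)\<in>D (A \<union> B). f i j) = (\<Sum>(i, j)\<in>D A. f i j) + (\<Sum>(i, j)\<in>D B. f i j)
    + (\<Sum>i\<in>A. \<Sum>j\<in>B. f i j + f j i)"
proof -
  have fin: "finite (D A)" if "finite A" for A unfolding D_def by (rule finite_subset[of _ "A \<times> A"]) (use that in auto)
  have eq: "D (A \<union> B) = (D A \<union> D B) \<union> (A \<times> B \<union> B \<times> A)"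
    using AB unfolding D_def by blast
  have "(\<Sum>(i, j)\<in>D (A \<union> B). f i j) = (\<Sum>(i, j)\<in>D A \<union> D B. f i j) + (\<Sum>(i, j)\<in>A \<times> B \<union> B \<times> A. f i j)"
    unfolding eq by (rule sum.union_disjoint) (use A B fin AB in \<open>auto simp: D_def\<close>)
  also have "(\<Sum>(i, j)\<in>D A \<union> D B. f i j) = (\<Sum>(i, j)\<in>D A. f i j) + (\<Sum>(i, j)\<in>D B. f i j)"
    by (rule sum.union_disjoint) (use A B fin AB in \<open>auto simp: D_def\<close>)
  also have "(\<Sum>(i, j)\<in>A \<times> B \<union> B \<times> A. f i j) = (\<Sum>(i, j)\<in>A \<times> B. f i j) + (\<Sum>(i, j)\<in>B \<times> A. f i j)"
    by (rule sum.union_disjoint) (use A B AB in auto)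
  also have "(\<Sum>(i, j)\<in>B \<times> A. f i j) = (\<Sum>i\<in>A. \<Sum>j\<in>B. f j i)"
    unfolding sum.cartesian_product[symmetric] by (rule sum.swap)
  also have "(\<Sum>(i, j)\<in>A \<times> B. f i j) = (\<Sum>i\<in>A. \<Sum>j\<in>B. f i j)"
    unfolding sum.cartesian_product[symmetric] ..
  finally show ?thesis by (simp add: sum.distrib)
qed

text \<open>Separates a sum over pairs of pooled observations into the two samples and the pairs between them.\<close>

lemma sum_off_diagonal_pooled:
  fixes f :: "nat \<Rightarrow> nat \<Rightarrow> real"
  shows "(\<Sum>(i, j)\<in>{(i, j). i \<in> {1..n+m} \<and> j \<in> {1..n+m} \<and> i \<noteq> j}. f i j) =
     (\<Sum>(i, j)\<in>{(i, j). i \<in> {1..n} \<and> j \<in> {1..n} \<and> i \<noteq> j}. f i j)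
   + (\<Sum>(i, j)\<in>{(i, j). i \<in> {1..m} \<and> j \<in> {1..m} \<and> i \<noteq> j}. f (n + i) (n + j))
   + (\<Sum>i = 1..n. \<Sum>j = 1..m. f i (n + j) + f (n + j) i)"
proof -
  define B where "B = (\<lambda>j. n + j) ` {1..m}"
  have U: "{1..n+m} = {1..n} \<union> B"
    unfolding B_def by (simp add: image_add_atLeastAtMost ivl_disj_un_two_touch) (auto simp: le_Suc_eq)
  have inj: "inj_on (\<lambda>j. n + j) {1..m}" by simp
  have "{1..n} \<inter> B = {}" by (auto simp: B_def)
  from sum_off_diagonal_union[OF _ _ this, of f]
  have "(\<Sum>(i, j)\<in>{(i, j). i \<in> {1..n+m} \<and> j \<in> {1..n+m} \<and> i \<noteq> j}. f i j) =
     (\<Sum>(i, j)\<in>{(i, j). i \<in> {1..n} \<and> j \<in> {1..n} \<and> i \<noteq> j}. f i j)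
   + (\<Sum>(i, j)\<in>{(i, j). i \<in> B \<and> j \<in> B \<and> i \<noteq> j}. f i j)
   + (\<Sum>i = 1..n. \<Sum>j\<in>B. f i j + f j i)"
    unfolding U by (simp add: B_def)
  also have "(\<Sum>(i, j)\<in>{(i, j). i \<in> B \<and> j \<in> B \<and> i \<noteq> j}. f i j) =
      (\<Sum>(i, j)\<in>{(i, j). i \<in> {1..m} \<and> j \<in> {1..m} \<and> i \<noteq> j}. f (n + i) (n + j))"
  proof (rule sum.reindex_cong[of "\<lambda>(i, j). (n + i, n + j)"])
    show "inj_on (\<lambda>(i, j). (n + i, n + j)) {(i, j). i \<in> {1..m} \<and> j \<in> {1..m} \<and> i \<noteq> j}"
      by (auto simp: inj_on_def)
    show "{(i, j). i \<in> B \<and> j \<in> B \<and> i \<noteq> j} =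
       (\<lambda>(i, j). (n + i, n + j)) ` {(i, j). i \<in> {1..m} \<and> j \<in> {1..m} \<and> i \<noteq> j}"
      unfolding B_def image_iff set_eq_iff by (auto simp del: atLeastAtMost_iff image_add_atLeastAtMost)
  qed (simp add: case_prod_unfold)
  also have "(\<Sum>i = 1..n. \<Sum>j\<in>B. f i j + f j i) = (\<Sum>i = 1..n. \<Sum>j = 1..m. f i (n + j) + f (n + j) i)"
    unfolding B_def sum.reindex[OF inj] by simp
  finally show ?thesis .
qed

lemma card_off_diagonal:
  assumes "finite A"
  shows "card {(i, j). i \<in> A \<and> j \<in> A \<and> i \<noteq> j} = card A * (card A - 1)"
proof -
  have "{(i, j). i \<in> A \<and> j \<in> A \<and> i \<noteq> j} = (SIGMA i:A. A - {i})" by auto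
  then show ?thesis using assms by (simp add: card_SigmaI)
qed

lemma sum_off_diagonal_blocks:
  fixes f :: "nat \<Rightarrow> nat \<Rightarrow> real"
  assumes "n \<ge> 1" "m \<ge> 1"
    and XX: "\<And>i j. i \<le> n \<Longrightarrow> j \<le> n \<Longrightarrow> f i j = A" and YY: "\<And>i j. n < i \<Longrightarrow> n < j \<Longrightarrow> f i j = B"
    and XY: "\<And>i j. i \<le> n \<Longrightarrow> n < j \<Longrightarrow> f i j = C" and YX: "\<And>i j. i \<le> n \<Longrightarrow> n < j \<Longrightarrow> f j i = C'"
  shows "(\<Sum>(i, j)\<in>{(i, j). i \<in> {1..n+m} \<and> j \<in> {1..n+m} \<and> i \<noteq> j}. f i j) =
     real n * (real n - 1) * A + real m * (real m - 1) * B + real n * real m * (C + C')"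
proof -
  let ?D = "\<lambda>k::nat. {(i, j). i \<in> {1..k} \<and> j \<in> {1..k} \<and> i \<noteq> j}"
  have card: "real (card (?D k)) = real k * (real k - 1)" if "k \<ge> 1" for k
    using that by (subst card_off_diagonal) (auto simp: of_nat_diff)
  have "(\<Sum>(i, j)\<in>?D n. f i j) = (\<Sum>_\<in>?D n. A)"
    by (intro sum.cong refl) (auto intro: XX)
  then have 1: "(\<Sum>(i, j)\<in>?D n. f i j) = real n * (real n - 1) * A"
    by (simp only: sum_constant card[OF assms(1)])
  have "(\<Sum>(i, j)\<in>?D m. f (n + i) (n + j)) = (\<Sum>_\<in>?D m. B)"
    by (intro sum.cong refl) (auto intro: YY)
  then have 2: "(\<Sum>(i, j)\<in>?D m. f (n + i) (n + j)) = real m * (real m - 1) * B"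
    by (simp only: sum_constant card[OF assms(2)])
  have "(\<Sum>i = 1..n. \<Sum>j = 1..m. f i (n + j) + f (n + j) i) = (\<Sum>i = 1..n. \<Sum>j = 1..m. C + C')"
    by (intro sum.cong refl arg_cong2[where f="(+)"]) (auto intro: XY YX)
  then have 3: "(\<Sum>i = 1..n. \<Sum>j = 1..m. f i (n + j) + f (n + j) i) = real n * real m * (C + C')"
    by simp
  show ?thesis unfolding sum_off_diagonal_pooled 1 2 3 ..
qed

text \<open>With these weights the statistic is a single sum over all pairs of distinct pooled observations.\<close>

definition mmd_weight :: "nat \<Rightarrow> nat \<Rightarrow> nat \<Rightarrow> nat \<Rightarrow> real" where
  "mmd_weight n m i j = (if i \<le> n \<and> j \<le> n then 1 / (real n * (real n - 1))
     else if n < i \<and> n < j then 1 / (real m * (real m - 1)) else - 1 / (real m * real n))"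

lemma mmd_weight_sym: "mmd_weight n m i j = mmd_weight n m j i"
  by (auto simp: mmd_weight_def)

lemma mmd_estimate_pool:
  "mmd_estimate \<nu> n m x y = (\<Sum>(i, j)\<in>{(i, j). i \<in> {1..n+m} \<and> j \<in> {1..n+m} \<and> i \<noteq> j}.
      mmd_weight n m i j * gauss_kernel \<nu> (pool n m (x, y) i) (pool n m (x, y) j))"
proof -
  have 1: "(\<Sum>(i, j)\<in>{(i, j). i \<in> {1..n} \<and> j \<in> {1..n} \<and> i \<noteq> j}. 
       mmd_weight n m i j * gauss_kernel \<nu> (pool n m (x, y) i) (pool n m (x, y) j)) =
     1 / (real n * (real n - 1)) * (\<Sum>(i, j)\<in>{(i, j). i \<in> {1..n} \<and> j \<in> {1..n} \<and> i \<noteq> j}. gauss_kernel \<nu> (x i) (x j))"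
    unfolding sum_distrib_left by (intro sum.cong refl) (auto simp: mmd_weight_def pool_def)
  have 2: "(\<Sum>(i, j)\<in>{(i, j). i \<in> {1..m} \<and> j \<in> {1..m} \<and> i \<noteq> j}. 
       mmd_weight n m (n + i) (n + j) * gauss_kernel \<nu> (pool n m (x, y) (n + i)) (pool n m (x, y) (n + j))) =
     1 / (real m * (real m - 1)) * (\<Sum>(i, j)\<in>{(i, j). i \<in> {1..m} \<and> j \<in> {1..m} \<and> i \<noteq> j}. gauss_kernel \<nu> (y i) (y j))"
    unfolding sum_distrib_left by (intro sum.cong refl) (auto simp: mmd_weight_def pool_def)
  have 3: "(\<Sum>i = 1..n. \<Sum>j = 1..m. mmd_weight n m i (n + j) * gauss_kernel \<nu> (pool n m (x, y) i) (pool n m (x, y) (n + j)) +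
       mmd_weight n m (n + j) i * gauss_kernel \<nu> (pool n m (x, y) (n + j)) (pool n m (x, y) i)) =
     - (2 / (real m * real n) * (\<Sum>i = 1..n. \<Sum>j = 1..m. gauss_kernel \<nu> (x i) (y j)))"
    unfolding sum_distrib_left sum_negf[symmetric]
    by (intro sum.cong refl) (auto simp: mmd_weight_def pool_def gauss_kernel_sym)
  show ?thesis
    unfolding sum_off_diagonal_pooled 1 2 3 mmd_estimate_def by simp
qed

section \<open>Finite-sample power of the Gaussian test\<close>

lemma card_distinct_quadruples:
  assumes "N \<ge> 4"
  shows "real (card {(i1, i2, j1, j2). {i1, i2, j1, j2} \<subseteq> {1..N} \<and> card {i1, i2, j1, j2} = 4}) * fact (N - 4) = fact N"
    (is "real (card ?Q) * _ = _")
proof -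
  let ?L = "{xs. length xs = 4 \<and> distinct xs \<and> set xs \<subseteq> {1..N}}"
  have "bij_betw (\<lambda>(i1, i2, j1, j2). [i1, i2, j1, j2]) ?Q ?L"
  proof (rule bij_betwI')
    fix u v assume "u \<in> ?Q" "v \<in> ?Q"
    show "((\<lambda>(i1, i2, j1, j2). [i1, i2, j1, j2]) u = (\<lambda>(i1, i2, j1, j2). [i1, i2, j1, j2]) v) = (u = v)"
      by (auto split: prod.splits)
  next
    fix u assume "u \<in> ?Q"
    then obtain a b c d where u: "u = (a, b, c, d)" "{a, b, c, d} \<subseteq> {1..N}" "card {a, b, c, d} = 4" by auto
    then have "distinct [a, b, c, d]" by (intro card_distinct) simp
    then show "(\<lambda>(i1, i2, j1, j2). [i1, i2, j1, j2]) u \<in> ?L" using u by simp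
  next
    fix xs assume xs: "xs \<in> ?L"
    then obtain a b c d where abcd: "xs = [a, b, c, d]"
      by (auto simp: numeral_eq_Suc length_Suc_conv)
    have "card (set xs) = 4" using xs distinct_card[of xs] by simp
    then have "(a, b, c, d) \<in> ?Q" using xs abcd by auto
    then show "\<exists>u\<in>?Q. xs = (\<lambda>(i1, i2, j1, j2). [i1, i2, j1, j2]) u"
      by (intro bexI[of _ "(a, b, c, d)"]) (auto simp: abcd)
  qed
  then have "card ?Q = card ?L" by (rule bij_betw_same_card)
  also have "\<dots> = \<Prod>{N - 4 + 1..N}" using assms by (subst card_lists_distinct_length_eq) auto
  finally have c: "card ?Q = \<Prod>{N - 4 + 1..N}" .
  have "{1..N} = {1..N - 4} \<union> {N - 4 + 1..N}" by auto
  then have "fact N = (fact (N - 4) :: nat) * \<Prod>{N - 4 + 1..N}"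
    unfolding fact_prod of_nat_id by (simp add: prod.union_disjoint)
  then have "fact N = fact (N - 4) * card ?Q" by (simp only: c)
  then have "real (fact N) = real (fact (N - 4) * card ?Q)" by (rule arg_cong)
  then show ?thesis by (simp add: mult.commute)
qed

lemma mult_inverse_le: "(x::real) \<le> c * y \<Longrightarrow> 0 < c \<Longrightarrow> 1 / c * x \<le> y"
  by (simp add: field_simps)

locale two_sample =
  fixes p q :: "real ^ 'd::finite \<Rightarrow> real" and s M \<nu> :: real and n m :: nat
  assumes s: "s > 0" and \<nu>: "\<nu> > 0" and n2: "n \<ge> 2" and m2: "m \<ge> 2"
    and p_ball: "p \<in> sobolev_ball s M" and q_ball: "q \<in> sobolev_ball s M"
    and p_dens: "prob_density p" and q_dens: "prob_density q"
begin

abbreviation "marg \<equiv> pooled_marginal p q n"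
abbreviation "dens \<equiv> pooled_density p q n"
abbreviation "D \<equiv> {(i, j). i \<in> {1..n+m} \<and> j \<in> {1..n+m} \<and> i \<noteq> j}"
abbreviation "PP \<equiv> Pi\<^sub>M {1..n+m} marg"
text \<open>The integral of the kernel in one of its arguments. Its square root, multiplied by the rate and the Sobolev radius, is the noise
  level of the statistic.\<close>

definition "kap = (pi / \<nu>) powr (real CARD('d) / 2)"
definition "energy = gauss_energy \<nu> (\<lambda>x. p x - q x)"
definition "rate = 1 / real n + 1 / real m"

lemma prob_space_marg: "prob_space (marg i)"
  using p_dens q_dens by (auto simp: pooled_marginal_def pooled_density_def prob_density_def)

lemma dens_ball: "dens i \<in> sobolev_ball s M" and dens_prob: "prob_density (dens i)"
  using p_ball q_ball p_dens q_dens by (auto simp: pooled_density_def)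

lemma dens_measurable [measurable]: "dens i \<in> borel_measurable borel" and dens_nonneg: "0 \<le> dens i x"
  using dens_prob by (auto simp: prob_density_def)

lemma bounded_kernel_sample_gauss: "\<nu>' > 0 \<Longrightarrow> bounded_kernel_sample marg {1..n+m} borel (gauss_kernel \<nu>')"
proof -
  assume \<nu>': "\<nu>' > 0"
  interpret product_prob_space marg "{1..n+m}"
    by (rule product_prob_spaceI) (rule prob_space_marg)
  show ?thesis
    by unfold_locales (auto simp: pooled_marginal_def gauss_kernel_sym[of \<nu>'] gauss_kernel_le_1[OF \<nu>'] case_prod_unfold)
qed

sublocale K: bounded_kernel_sample marg "{1..n+m}" borel "gauss_kernel \<nu>"
  by (rule bounded_kernel_sample_gauss[OF \<nu>])

lemma integral_marg:
  fixes g :: "real ^ 'd \<Rightarrow> real"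
  assumes [measurable]: "g \<in> borel_measurable borel"
  shows "(\<integral>x. g x \<partial>marg i) = (LINT x|lborel. dens i x * g x)"
  unfolding pooled_marginal_def by (subst integral_density) (auto simp: dens_nonneg)

lemma proj_marg: "(\<integral>y. gauss_kernel \<nu>' x y \<partial>marg j) = gauss_smooth \<nu>' (dens j) x"
  unfolding gauss_smooth_def by (subst integral_marg) (auto simp: mult.commute)

lemma mean_marg: "(\<integral>x. (\<integral>y. gauss_kernel \<nu>' x y \<partial>marg j) \<partial>marg i) = (LINT x|lborel. dens i x * gauss_smooth \<nu>' (dens j) x)"
  unfolding proj_marg by (subst integral_marg) auto

lemma K_proj: "K.proj j = gauss_smooth \<nu> (dens j)"
  unfolding K.proj_def proj_marg ..

lemma K_mean: "K.mean i j = (LINT x|lborel. dens i x * gauss_smooth \<nu> (dens j) x)"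
  unfolding K.mean_def K.proj_def by (rule mean_marg)

lemma K_mean_le: "K.mean i j \<le> kap * M\<^sup>2"
  unfolding K_mean kap_def by (rule integral_density_smooth_le[OF dens_ball dens_ball s \<nu>])

lemma p_int: "integrable lborel p" "integrable lborel q"
  using sobolev_ballD(1)[OF p_ball s] sobolev_ballD(1)[OF q_ball s] by auto

lemma diff_int: "integrable lborel (\<lambda>x. p x - q x)" using p_int by simp

lemma sum_weight_mean: "(\<Sum>(i, j)\<in>D. mmd_weight n m i j * K.mean i j) = energy"
proof -
  define mu :: "(real ^ 'd \<Rightarrow> real) \<Rightarrow> (real ^ 'd \<Rightarrow> real) \<Rightarrow> real" where
    "mu = (\<lambda>f g. LINT x|lborel. f x * gauss_smooth \<nu> g x)"
  have int: "integrable lborel (\<lambda>x. f x * gauss_smooth \<nu> g x)" if "f \<in> {p, q}" "g \<in> {p, q}" for f g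
    using integral_mult_smooth_le(1)[of f s M g \<nu>] that p_ball q_ball s \<nu> p_int by auto
  have e: "energy = mu p p - mu p q - mu q p + mu q q"
  proof -
    have "(p x - q x) * gauss_smooth \<nu> (\<lambda>x. p x - q x) x = p x * gauss_smooth \<nu> p x - p x * gauss_smooth \<nu> q x
       - q x * gauss_smooth \<nu> p x + q x * gauss_smooth \<nu> q x" for x
      unfolding gauss_smooth_diff[OF p_int \<nu>] by (simp add: algebra_simps)
    then show ?thesis unfolding energy_def gauss_energy_def mu_def using int by simp
  qed
  have m: "K.mean i j = mu (dens i) (dens j)" for i j by (simp add: K_mean mu_def)
  have "(\<Sum>(i, j)\<in>D. mmd_weight n m i j * K.mean i j) =
     real n * (real n - 1) * (1 / (real n * (real n - 1)) * mu p p)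
   + real m * (real m - 1) * (1 / (real m * (real m - 1)) * mu q q)
   + real n * real m * (- 1 / (real m * real n) * mu p q + - 1 / (real m * real n) * mu q p)"
    by (rule sum_off_diagonal_blocks) (use n2 m2 in \<open>auto simp: mmd_weight_def m pooled_density_def\<close>)
  also have "\<dots> = mu p p + mu q q - (mu p q + mu q p)"
  proof -
    have cancel: "u * (1 / u * x) = x" if "u \<noteq> 0" for u x :: real using that by simp
    have nz: "real n * (real n - 1) \<noteq> 0" "real m * (real m - 1) \<noteq> 0" using n2 m2 by auto
    have "real n * real m * (- 1 / (real m * real n) * x + - 1 / (real m * real n) * y) = - (x + y)" for x y :: real
      using n2 m2 by (simp add: field_simps)
    then show ?thesis unfolding cancel[OF nz(1)] cancel[OF nz(2)] by simp
  qed
  finally show ?thesis unfolding e by simp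
qed

lemma sum_weight_sq: "(\<Sum>(i, j)\<in>D. (mmd_weight n m i j)\<^sup>2) \<le> 2 * rate\<^sup>2"
proof -
  (* k - 1 is at least k / 2 *)
  have half: "1 / (real k * (real k - 1)) \<le> 2 / (real k)\<^sup>2" if "k \<ge> 2" for k :: nat
    using that by (simp add: field_simps power2_eq_square)
  have "(\<Sum>(i, j)\<in>D. (mmd_weight n m i j)\<^sup>2) =
     real n * (real n - 1) * (1 / (real n * (real n - 1)))\<^sup>2
   + real m * (real m - 1) * (1 / (real m * (real m - 1)))\<^sup>2
   + real n * real m * ((1 / (real m * real n))\<^sup>2 + (1 / (real m * real n))\<^sup>2)"
    by (rule sum_off_diagonal_blocks) (use n2 m2 in \<open>auto simp: mmd_weight_def\<close>)
  also have "\<dots> = 1 / (real n * (real n - 1)) + 1 / (real m * (real m - 1)) + 2 / (real m * real n)"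
    using n2 m2 by (simp add: power2_eq_square)
  also have "\<dots> \<le> 2 / (real n)\<^sup>2 + 2 / (real m)\<^sup>2 + 2 / (real m * real n)"
    by (intro add_mono half n2 m2 order_refl)
  also have "\<dots> \<le> 2 * rate\<^sup>2"
    using n2 m2 unfolding rate_def power2_sum by (simp add: power_divide mult.commute divide_right_mono)
  finally show ?thesis .
qed

text \<open>Within its own sample an observation is compared with all the others of the same sample, outside with all of the other one. The
  weights sum to \<open>1/n\<close> and \<open>-1/n\<close> for the first sample, and to \<open>1/m\<close> and \<open>-1/m\<close> for the second, so the linear part is proportional to the smoothed difference of
  the densities and vanishes under the null hypothesis.\<close>

lemma lin_part_mmd:
  assumes "i \<in> {1..n+m}"
  shows "(K.lin_part (mmd_weight n m) i x)\<^sup>2 = (gauss_smooth \<nu> (\<lambda>x. p x - q x) x)\<^sup>2 / (real (if i \<le> n then n else m))\<^sup>2"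
proof -
  let ?w = "mmd_weight n m"
  have U: "{1..n+m} - {i} = ({1..n} - {i}) \<union> ({n+1..n+m} - {i})" by auto
  have split: "K.lin_part ?w i x = (\<Sum>j\<in>{1..n} - {i}. ?w i j * K.proj j x) + (\<Sum>j\<in>{n+1..n+m} - {i}. ?w i j * K.proj j x)"
    unfolding K.lin_part_def U by (rule sum.union_disjoint) auto
  let ?a = "gauss_smooth \<nu> p x" and ?b = "gauss_smooth \<nu> q x"
  have d: "gauss_smooth \<nu> (\<lambda>x. p x - q x) x = ?a - ?b" by (rule gauss_smooth_diff[OF p_int \<nu>])
  show ?thesis
  proof (cases "i \<le> n")
    case True
    have "(\<Sum>j\<in>{1..n} - {i}. ?w i j * K.proj j x) = (\<Sum>j\<in>{1..n} - {i}. 1 / (real n * (real n - 1)) * ?a)"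
      using True by (intro sum.cong refl) (auto simp: mmd_weight_def K_proj pooled_density_def)
    also have "\<dots> = ?a / real n" using True assms n2 by (simp add: of_nat_diff)
    finally have 1: "(\<Sum>j\<in>{1..n} - {i}. ?w i j * K.proj j x) = ?a / real n" .
    have "(\<Sum>j\<in>{n+1..n+m} - {i}. ?w i j * K.proj j x) = (\<Sum>j\<in>{n+1..n+m}. - 1 / (real m * real n) * ?b)"
      using True by (intro sum.cong) (auto simp: mmd_weight_def K_proj pooled_density_def)
    also have "\<dots> = - ?b / real n" using m2 by simp
    finally have "K.lin_part ?w i x = (?a - ?b) / real n" unfolding split 1 by (simp add: diff_divide_distrib)
    then show ?thesis unfolding d using True by (simp add: power_divide)
  next
    case False
    have "(\<Sum>j\<in>{n+1..n+m} - {i}. ?w i j * K.proj j x) = (\<Sum>j\<in>{n+1..n+m} - {i}. 1 / (real m * (real m - 1)) * ?b)"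
      using False by (intro sum.cong refl) (auto simp: mmd_weight_def K_proj pooled_density_def)
    also have "\<dots> = ?b / real m" using False assms m2 by (simp add: of_nat_diff)
    finally have 1: "(\<Sum>j\<in>{n+1..n+m} - {i}. ?w i j * K.proj j x) = ?b / real m" .
    have "(\<Sum>j\<in>{1..n} - {i}. ?w i j * K.proj j x) = (\<Sum>j\<in>{1..n}. - 1 / (real m * real n) * ?a)"
      using False by (intro sum.cong) (auto simp: mmd_weight_def K_proj pooled_density_def)
    also have "\<dots> = - ?a / real m" using n2 by simp
    finally have "K.lin_part ?w i x = (?b - ?a) / real m" unfolding split 1 by (simp add: diff_divide_distrib)
    then show ?thesis unfolding d using False by (simp add: power_divide power2_commute)
  qed
qed

definition "mmd z = (\<Sum>(i, j)\<in>D. mmd_weight n m i j * gauss_kernel \<nu> (z i) (z j))"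

definition "noise = rate * M * sqrt kap"

lemma M_nonneg: "0 \<le> M" using sobolev_ballD(5)[OF p_ball s] .

lemma variance_mmd: "(\<integral>z. (mmd z - energy)\<^sup>2 \<partial>PP) \<le> 4 * (noise * energy) + 4 * noise\<^sup>2"
proof -
  let ?c = "M * sqrt kap * energy"
  have "(\<integral>z. (mmd z - energy)\<^sup>2 \<partial>PP) \<le> 4 * (\<Sum>i\<in>{1..n+m}. \<integral>x. (K.lin_part (mmd_weight n m) i x)\<^sup>2 \<partial>marg i)
     + 2 * (\<Sum>(i, j)\<in>D. (mmd_weight n m i j)\<^sup>2 * K.mean i j)"
    unfolding mmd_def sum_weight_mean[symmetric] by (rule K.variance_off_diagonal_sum[OF mmd_weight_sym])
  also have "(\<Sum>i\<in>{1..n+m}. \<integral>x. (K.lin_part (mmd_weight n m) i x)\<^sup>2 \<partial>marg i)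
      \<le> (\<Sum>i\<in>{1..n+m}. ?c / (real (if i \<le> n then n else m))\<^sup>2)"
  proof (rule sum_mono)
    fix i assume i: "i \<in> {1..n+m}"
    have "(\<integral>x. (K.lin_part (mmd_weight n m) i x)\<^sup>2 \<partial>marg i) = 
      (LINT x|lborel. dens i x * (gauss_smooth \<nu> (\<lambda>x. p x - q x) x)\<^sup>2) / (real (if i \<le> n then n else m))\<^sup>2"
      unfolding lin_part_mmd[OF i] using p_int by (subst integral_marg) auto
    also have "\<dots> \<le> ?c / (real (if i \<le> n then n else m))\<^sup>2"
      unfolding energy_def kap_def
      by (intro divide_right_mono integral_density_smooth_sq_le[OF dens_ball dens_nonneg s diff_int \<nu>]) auto
    finally show "(\<integral>x. (K.lin_part (mmd_weight n m) i x)\<^sup>2 \<partial>marg i) \<le> ?c / (real (if i \<le> n then n else m))\<^sup>2" .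
  qed
  also have "(\<Sum>i\<in>{1..n+m}. ?c / (real (if i \<le> n then n else m))\<^sup>2) = 
      (\<Sum>i\<in>{1..n}. ?c / (real n)\<^sup>2) + (\<Sum>i\<in>{n+1..n+m}. ?c / (real m)\<^sup>2)"
    by (subst sum.ub_add_nat) (auto intro!: sum.cong arg_cong2[where f="(+)"])
  also have "\<dots> = rate * ?c"
    using n2 m2 by (simp add: rate_def power2_eq_square field_simps)
  also have "(\<Sum>(i, j)\<in>D. (mmd_weight n m i j)\<^sup>2 * K.mean i j) \<le> (\<Sum>(i, j)\<in>D. (mmd_weight n m i j)\<^sup>2) * (kap * M\<^sup>2)"
    unfolding sum_distrib_right case_prod_unfold by (intro sum_mono mult_left_mono K_mean_le) auto
  also have "\<dots> \<le> 2 * rate\<^sup>2 * (kap * M\<^sup>2)"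
    by (intro mult_right_mono sum_weight_sq) (auto simp: kap_def)
  finally show ?thesis by (simp add: noise_def power_mult_distrib algebra_simps kap_def)
qed

text \<open>An upper bound for the studentisation \<open>s_hat\<close> whose expectation is easy: the middle term of
  \<open>s_tilde_sq\<close> enters with a negative sign and is dropped, and the truncation at \<open>1/n\<^sup>2\<close> is added.\<close>

definition "s_bound z = 1 / (real (n+m) * (real (n+m) - 1)) * (\<Sum>(i, j)\<in>D. gauss_kernel (2 * \<nu>) (z i) (z j))
   + fact (n+m - 4) / fact (n+m) *
       (\<Sum>(i1, i2, j1, j2) \<in> {(i1, i2, j1, j2). {i1, i2, j1, j2} \<subseteq> {1..n+m} \<and> card {i1, i2, j1, j2} = 4}.
          gauss_kernel \<nu> (z i1) (z j1) * gauss_kernel \<nu> (z i2) (z j2)) + 1 / (real n)\<^sup>2"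

lemma s_tilde_sq_le: "max (s_tilde_sq \<nu> (n+m) z) (1 / (real n)\<^sup>2) \<le> s_bound z"
proof -
  define A where "A = 1 / (real (n+m) * (real (n+m) - 1)) * (\<Sum>(i, j)\<in>D. gauss_kernel (2 * \<nu>) (z i) (z j))"
  define B where "B = 2 * fact (n+m - 3) / fact (n+m) *
       (\<Sum>(i, j1, j2) \<in> {(i, j1, j2). {i, j1, j2} \<subseteq> {1..n+m} \<and> card {i, j1, j2} = 3}.
          gauss_kernel \<nu> (z i) (z j1) * gauss_kernel \<nu> (z i) (z j2))"
  define C where "C = fact (n+m - 4) / fact (n+m) *
       (\<Sum>(i1, i2, j1, j2) \<in> {(i1, i2, j1, j2). {i1, i2, j1, j2} \<subseteq> {1..n+m} \<and> card {i1, i2, j1, j2} = 4}.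
          gauss_kernel \<nu> (z i1) (z j1) * gauss_kernel \<nu> (z i2) (z j2))"
  have A: "0 \<le> A" unfolding A_def using n2 by (intro mult_nonneg_nonneg sum_nonneg) auto
  have B: "0 \<le> B" unfolding B_def by (intro mult_nonneg_nonneg sum_nonneg) auto
  have C: "0 \<le> C" unfolding C_def by (intro mult_nonneg_nonneg sum_nonneg) auto
  have st: "s_tilde_sq \<nu> (n+m) z = A - B + C"
    unfolding s_tilde_sq_def A_def B_def C_def ..
  have sb: "s_bound z = A + C + 1 / (real n)\<^sup>2"
    unfolding s_bound_def A_def C_def ..
  have "0 \<le> 1 / (real n)\<^sup>2" by simp
  then show ?thesis unfolding st sb using A B C by linarith
qed

lemma kap_nonneg: "0 \<le> kap" by (simp add: kap_def)

text \<open>A larger parameter gives a smaller kernel, so one bound serves the kernel \<open>G\<^sub>\<nu>\<close> and the kernel \<open>G\<^bsub>2\<nu>\<^esub>\<close> of the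
  studentisation.\<close>

lemma gauss_pair_integral:
  assumes "i \<in> {1..n+m}" "j \<in> {1..n+m}" "i \<noteq> j" "\<nu>' \<ge> \<nu>"
  shows "integrable PP (\<lambda>z. gauss_kernel \<nu>' (z i) (z j))" "(\<integral>z. gauss_kernel \<nu>' (z i) (z j) \<partial>PP) \<le> kap * M\<^sup>2"
proof -
  have \<nu>': "\<nu>' > 0" using \<nu> assms by simp
  interpret L: bounded_kernel_sample marg "{1..n+m}" borel "gauss_kernel \<nu>'"
    by (rule bounded_kernel_sample_gauss[OF \<nu>'])
  show 1: "integrable PP (\<lambda>z. gauss_kernel \<nu>' (z i) (z j))" by (rule L.k_pair_integrable[OF assms(1,2)])
  have "(\<integral>z. gauss_kernel \<nu>' (z i) (z j) \<partial>PP) \<le> (\<integral>z. gauss_kernel \<nu> (z i) (z j) \<partial>PP)"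
    using assms(4) by (intro integral_mono 1 K.k_pair_integrable[OF assms(1,2)]) (auto simp: gauss_kernel_def mult_right_mono)
  also have "\<dots> \<le> kap * M\<^sup>2" unfolding K.integral_k_pair[OF assms(1-3)] by (rule K_mean_le)
  finally show "(\<integral>z. gauss_kernel \<nu>' (z i) (z j) \<partial>PP) \<le> kap * M\<^sup>2" .
qed

text \<open>Each normalised sum is an average of terms with expectation at most \<open>kap M\<^sup>2\<close>; for products of two kernels the
  second kernel is bounded by 1.\<close>

lemma s_bound_integral:
  shows s_bound_integrable: "integrable PP s_bound" 
    and "(\<integral>z. s_bound z \<partial>PP) \<le> 2 * (kap * M\<^sup>2) + 1 / (real n)\<^sup>2"
proof -
  let ?Q = "{(i1, i2, j1, j2). {i1, i2, j1, j2} \<subseteq> {1..n+m} \<and> card {i1, i2, j1, j2} = 4}"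
  let ?g = "\<lambda>z (i1, i2, j1, j2). gauss_kernel \<nu> (z i1) (z j1) * gauss_kernel \<nu> (z i2) (z j2)"
  (* four different indices: the two kernels are evaluated at pairs of distinct observations *)
  have Q: "?Q = {(i1, i2, j1, j2). distinct [i1, i2, j1, j2] \<and> {i1, i2, j1, j2} \<subseteq> {1..n+m}}"
  proof -
    have *: "card (set xs) = 4 \<longleftrightarrow> distinct xs" if "length xs = 4" for xs :: "nat list"
      using that card_distinct[of xs] distinct_card[of xs] by metis
    have "card {a, b, c, d} = 4 \<longleftrightarrow> distinct [a, b, c, d]" for a b c d :: nat
      using *[of "[a, b, c, d]"] by (simp only: list.set list.size)
    then show ?thesis by (simp only: conj_commute)
  qed
  have q1: "integrable PP (\<lambda>z. ?g z u)" and q2: "(\<integral>z. ?g z u \<partial>PP) \<le> kap * M\<^sup>2" if "u \<in> ?Q" for u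
  proof -
    obtain a b c d where u: "u = (a, b, c, d)" by (cases u) auto
    have abcd: "a \<in> {1..n+m}" "b \<in> {1..n+m}" "c \<in> {1..n+m}" "d \<in> {1..n+m}" "a \<noteq> c" "b \<noteq> d"
      using that unfolding Q u by auto
    note [measurable] = K.component_measurable[OF abcd(1)] K.component_measurable[OF abcd(2)]
      K.component_measurable[OF abcd(3)] K.component_measurable[OF abcd(4)]
    have le: "gauss_kernel \<nu> (z a) (z c) * gauss_kernel \<nu> (z b) (z d) \<le> gauss_kernel \<nu> (z a) (z c)" for z
      by (rule mult_left_le) (auto intro: gauss_kernel_le_1[OF \<nu>])
    show *: "integrable PP (\<lambda>z. ?g z u)" unfolding u prod.case
      by (rule Bochner_Integration.integrable_bound[OF gauss_pair_integral(1)[OF abcd(1,3,5) order_refl]])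
         (measurable, use le in \<open>auto intro!: AE_I2\<close>)
    have "(\<integral>z. ?g z u \<partial>PP) \<le> (\<integral>z. gauss_kernel \<nu> (z a) (z c) \<partial>PP)"
      using le by (intro integral_mono * gauss_pair_integral(1)[OF abcd(1,3,5) order_refl]) (auto simp: u)
    also have "\<dots> \<le> kap * M\<^sup>2" by (rule gauss_pair_integral(2)[OF abcd(1,3,5) order_refl])
    finally show "(\<integral>z. ?g z u \<partial>PP) \<le> kap * M\<^sup>2" .
  qed
  let ?h = "\<lambda>z (i, j). gauss_kernel (2 * \<nu>) (z i) (z j)"
  have d1: "integrable PP (\<lambda>z. ?h z u)" and d2: "(\<integral>z. ?h z u \<partial>PP) \<le> kap * M\<^sup>2" if "u \<in> D" for u
    using that gauss_pair_integral[of "fst u" "snd u" "2 * \<nu>"] \<nu> by (auto simp: case_prod_unfold)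
  have i1: "integrable PP (\<lambda>z. \<Sum>u\<in>D. ?h z u)" and i2: "integrable PP (\<lambda>z. \<Sum>u\<in>?Q. ?g z u)"
    by (rule Bochner_Integration.integrable_sum, erule d1, rule Bochner_Integration.integrable_sum, erule q1)
  have sb: "s_bound = (\<lambda>z. 1 / (real (n+m) * (real (n+m) - 1)) * (\<Sum>u\<in>D. ?h z u) + fact (n+m - 4) / fact (n+m) * (\<Sum>u\<in>?Q. ?g z u) + 1 / (real n)\<^sup>2)"
    by (simp add: s_bound_def fun_eq_iff)
  have c: "integrable PP (\<lambda>z. 1 / (real n)\<^sup>2)" by (rule K.P.integrable_const)
  show "integrable PP s_bound" unfolding sb 
    by (intro Bochner_Integration.integrable_add integrable_mult_right i1 i2 c)
  have "(\<integral>z. s_bound z \<partial>PP) = 1 / (real (n+m) * (real (n+m) - 1)) * (\<integral>z. (\<Sum>u\<in>D. ?h z u) \<partial>PP) + 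
      fact (n+m - 4) / fact (n+m) * (\<integral>z. (\<Sum>u\<in>?Q. ?g z u) \<partial>PP) + 1 / (real n)\<^sup>2"
    unfolding sb
    by (subst Bochner_Integration.integral_add[OF Bochner_Integration.integrable_add[OF integrable_mult_right[OF i1] integrable_mult_right[OF i2]] c],
        subst Bochner_Integration.integral_add[OF integrable_mult_right[OF i1] integrable_mult_right[OF i2]])
       (simp add: K.P.prob_space del: One_nat_def)
  also have "(\<integral>z. (\<Sum>u\<in>D. ?h z u) \<partial>PP) = (\<Sum>u\<in>D. \<integral>z. ?h z u \<partial>PP)"
    by (rule Bochner_Integration.integral_sum) (rule d1)
  also have "(\<integral>z. (\<Sum>u\<in>?Q. ?g z u) \<partial>PP) = (\<Sum>u\<in>?Q. \<integral>z. ?g z u \<partial>PP)"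
    by (rule Bochner_Integration.integral_sum) (rule q1)
  finally have eq: "(\<integral>z. s_bound z \<partial>PP) = 1 / (real (n+m) * (real (n+m) - 1)) * (\<Sum>u\<in>D. \<integral>z. ?h z u \<partial>PP) +
      fact (n+m - 4) / fact (n+m) * (\<Sum>u\<in>?Q. \<integral>z. ?g z u \<partial>PP) + 1 / (real n)\<^sup>2" .
  have "(\<Sum>u\<in>D. \<integral>z. ?h z u \<partial>PP) \<le> real (card D) * (kap * M\<^sup>2)"
    by (rule sum_bounded_above) (rule d2)
  moreover have "real (card D) = real (n+m) * (real (n+m) - 1)"
    using n2 by (subst card_off_diagonal[OF finite_atLeastAtMost]) (simp only: card_atLeastAtMost, simp add: of_nat_diff)
  ultimately have "(\<Sum>u\<in>D. \<integral>z. ?h z u \<partial>PP) \<le> (real (n+m) * (real (n+m) - 1)) * (kap * M\<^sup>2)"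
    by (simp only:)
  moreover have "0 < real (n+m) * (real (n+m) - 1)" using n2 by (intro mult_pos_pos) auto
  ultimately have 1: "1 / (real (n+m) * (real (n+m) - 1)) * (\<Sum>u\<in>D. \<integral>z. ?h z u \<partial>PP) \<le> kap * M\<^sup>2"
    by (rule mult_inverse_le)
  have "(\<Sum>u\<in>?Q. \<integral>z. ?g z u \<partial>PP) \<le> real (card ?Q) * (kap * M\<^sup>2)"
    by (rule sum_bounded_above) (rule q2)
  then have "fact (n+m - 4) / fact (n+m) * (\<Sum>u\<in>?Q. \<integral>z. ?g z u \<partial>PP) \<le> fact (n+m - 4) / fact (n+m) * (real (card ?Q) * (kap * M\<^sup>2))"
    by (rule mult_left_mono) simp
  also have "\<dots> = (real (card ?Q) * fact (n+m - 4)) / fact (n+m) * (kap * M\<^sup>2)" by (simp only: divide_inverse mult.assoc mult.left_commute)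
  also have "real (card ?Q) * fact (n+m - 4) = fact (n+m)"
    using n2 m2 by (intro card_distinct_quadruples) simp
  finally have 2: "fact (n+m - 4) / fact (n+m) * (\<Sum>u\<in>?Q. \<integral>z. ?g z u \<partial>PP) \<le> kap * M\<^sup>2" by (simp only: divide_self_if fact_nonzero if_False mult_1)
  show "(\<integral>z. s_bound z \<partial>PP) \<le> 2 * (kap * M\<^sup>2) + 1 / (real n)\<^sup>2" unfolding eq using 1 2 by linarith
qed


definition "s_pooled z = sqrt (max (s_tilde_sq \<nu> (n+m) z) (1 / (real n)\<^sup>2))"

definition "rejects \<alpha> z \<longleftrightarrow>
  1 / (sqrt 2 * rate) * inverse (s_pooled z) * mmd z > normal_upper_quantile \<alpha>"

lemma hom_test_pool: "hom_test \<nu> \<alpha> n m x y \<longleftrightarrow> rejects \<alpha> (pool n m (x, y))"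
proof -
  have "s_tilde_sq \<nu> (n+m) (pooled_sample n x y) = s_tilde_sq \<nu> (n+m) (pool n m (x, y))"
    unfolding s_tilde_sq_def
    by (intro arg_cong2[where f="(+)"] arg_cong2[where f="(-)"] arg_cong2[where f="(*)"] refl sum.cong)
       (auto simp: pooled_sample_def pool_def)
  moreover have "real n * real m / (sqrt 2 * (real n + real m)) = 1 / (sqrt 2 * rate)"
    using n2 m2 by (simp add: rate_def field_simps)
  ultimately show ?thesis
    unfolding hom_test_def hom_statistic_def s_hat_def rejects_def s_pooled_def mmd_estimate_pool mmd_def by simp
qed

lemma mmd_measurable [measurable]: "mmd \<in> borel_measurable PP"
  unfolding mmd_def case_prod_unfold
proof (rule borel_measurable_sum, goal_cases)
  case (1 u)
  then have [measurable]: "fst u \<in> {1..n+m}" "snd u \<in> {1..n+m}" by auto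
  show ?case
    by measurable
qed

lemma s_tilde_measurable [measurable]: "s_tilde_sq \<nu> (n+m) \<in> borel_measurable PP"
proof -
  let ?Q = "{(i1, i2, j1, j2). {i1, i2, j1, j2} \<subseteq> {1..n+m} \<and> card {i1, i2, j1, j2} = 4}"
  let ?R = "{(i, j1, j2). {i, j1, j2} \<subseteq> {1..n+m} \<and> card {i, j1, j2} = 3}"
  have 1: "(\<lambda>z. \<Sum>(i, j)\<in>D. gauss_kernel (2 * \<nu>) (z i) (z j)) \<in> borel_measurable PP"
    unfolding case_prod_unfold
  proof (rule borel_measurable_sum, goal_cases)
    case (1 u)
    then have [measurable]: "fst u \<in> {1..n+m}" "snd u \<in> {1..n+m}" by auto
    show ?case
      by measurable
  qed
  have 2: "(\<lambda>z. \<Sum>(i, j1, j2)\<in>?R. gauss_kernel \<nu> (z i) (z j1) * gauss_kernel \<nu> (z i) (z j2)) \<in> borel_measurable PP"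
    unfolding case_prod_unfold
  proof (rule borel_measurable_sum, goal_cases)
    case (1 u)
    then have [measurable]: "fst u \<in> {1..n+m}" "fst (snd u) \<in> {1..n+m}" "snd (snd u) \<in> {1..n+m}" by auto
    show ?case
      by measurable
  qed
  have 3: "(\<lambda>z. \<Sum>(i1, i2, j1, j2)\<in>?Q. gauss_kernel \<nu> (z i1) (z j1) * gauss_kernel \<nu> (z i2) (z j2)) \<in> borel_measurable PP"
    unfolding case_prod_unfold
  proof (rule borel_measurable_sum, goal_cases)
    case (1 u)
    then have [measurable]: "fst u \<in> {1..n+m}" "fst (snd u) \<in> {1..n+m}" "fst (snd (snd u)) \<in> {1..n+m}" "snd (snd (snd u)) \<in> {1..n+m}" by auto
    show ?case
      by measurable
  qed
  show ?thesis unfolding s_tilde_sq_def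
    by (intro borel_measurable_add borel_measurable_diff borel_measurable_times borel_measurable_const 1 2 3)
qed

lemma rejects_measurable: "{z \<in> space PP. rejects \<alpha> z} \<in> sets PP"
  unfolding rejects_def s_pooled_def by measurable

lemma reject_prob_eq: "reject_prob p q n m (hom_test \<nu> \<alpha> n m) = K.P.prob {z \<in> space PP. rejects \<alpha> z}"
proof -
  note meas = measurable_pool[OF p_dens q_dens, of n m]
  have "K.P.prob {z \<in> space PP. rejects \<alpha> z} = 
     measure (distr (sample_law p q n m) PP (pool n m)) {z \<in> space PP. rejects \<alpha> z}"
    unfolding distr_pool[OF p_dens q_dens] ..
  also have "\<dots> = measure (sample_law p q n m) (pool n m -` {z \<in> space PP. rejects \<alpha> z} \<inter> space (sample_law p q n m))"
    by (rule measure_distr[OF meas rejects_measurable])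
  also have "pool n m -` {z \<in> space PP. rejects \<alpha> z} \<inter> space (sample_law p q n m) =
     {(x, y) \<in> space (sample_law p q n m). hom_test \<nu> \<alpha> n m x y}"
    using measurable_space[OF meas] by (auto simp: hom_test_pool)
  finally show ?thesis unfolding reject_prob_def ..
qed

lemma rate_pos: "0 < rate" using n2 m2 by (simp add: rate_def add_pos_pos)

lemma s_pooled_pos: "0 < s_pooled z"
proof -
  have "0 < 1 / (real n)\<^sup>2" using n2 by simp
  also have "\<dots> \<le> max (s_tilde_sq \<nu> (n+m) z) (1 / (real n)\<^sup>2)" by (rule max.cobounded2)
  finally show ?thesis unfolding s_pooled_def by (rule real_sqrt_gt_zero)
qed

text \<open>A deterministic sufficient condition: the estimate exceeds half of the energy, and the threshold does not. The
  quantile enters through its square.\<close>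

lemma rejects_if:
  assumes E: "energy > 0" and 1: "(mmd z - energy)\<^sup>2 < energy\<^sup>2 / 4"
    and 2: "8 * (normal_upper_quantile \<alpha>)\<^sup>2 * rate\<^sup>2 * s_bound z < energy\<^sup>2"
  shows "rejects \<alpha> z"
proof -
  define Z where "Z = normal_upper_quantile \<alpha>"
  define t where "t = sqrt 2 * rate * s_pooled z"
  have t: "t > 0" unfolding t_def by (intro mult_pos_pos rate_pos s_pooled_pos) simp
  have "\<bar>mmd z - energy\<bar> < energy / 2"
    by (rule power2_less_imp_less) (use 1 E in \<open>auto simp: power_divide\<close>)
  then have m: "mmd z > energy / 2" by linarith
  have "(s_pooled z)\<^sup>2 = max (s_tilde_sq \<nu> (n+m) z) (1 / (real n)\<^sup>2)"
    unfolding s_pooled_def by (rule real_sqrt_pow2[OF order_trans[OF _ max.cobounded2]]) simp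
  then have "(s_pooled z)\<^sup>2 \<le> s_bound z" using s_tilde_sq_le by simp
  then have "8 * Z\<^sup>2 * rate\<^sup>2 * (s_pooled z)\<^sup>2 \<le> 8 * Z\<^sup>2 * rate\<^sup>2 * s_bound z" by (intro mult_left_mono) auto
  then have "(2 * (Z * t))\<^sup>2 < energy\<^sup>2" using 2 by (simp add: t_def Z_def power_mult_distrib)
  then have "\<bar>2 * (Z * t)\<bar>\<^sup>2 < energy\<^sup>2" by simp
  then have "\<bar>2 * (Z * t)\<bar> < energy" by (rule power2_less_imp_less) (use E in simp)
  then have "Z * t < mmd z" using m by linarith
  then have "Z < mmd z / t" using t by (simp add: field_simps)
  then show ?thesis unfolding rejects_def Z_def t_def by (simp add: field_simps)
qed

text \<open>The two ways to fail are a large deviation of the estimate (Chebyshev) and a large studentisation (Markov). Both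
  probabilities are expressed through the ratio of noise and energy.\<close>

lemma reject_prob_ge:
  assumes E: "energy > 0" and small: "1 / (real n)\<^sup>2 \<le> kap * M\<^sup>2"
  shows "reject_prob p q n m (hom_test \<nu> \<alpha> n m) \<ge>
    1 - (16 * (noise / energy) + (16 + 24 * (normal_upper_quantile \<alpha>)\<^sup>2) * (noise / energy)\<^sup>2)"
proof -
  define Z where "Z = normal_upper_quantile \<alpha>"
  define A where "A = {z \<in> space PP. (mmd z - energy)\<^sup>2 \<ge> energy\<^sup>2 / 4}"
  define B where "B = {z \<in> space PP. 8 * Z\<^sup>2 * rate\<^sup>2 * s_bound z \<ge> energy\<^sup>2}"
  have [measurable]: "s_bound \<in> borel_measurable PP" using s_bound_integrable by auto
  have AB: "A \<in> sets PP" "B \<in> sets PP" unfolding A_def B_def by measurable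
  have e2: "energy\<^sup>2 > 0" "energy\<^sup>2 / 4 > 0" using E by auto
  have imm: "integrable PP (\<lambda>z. (mmd z - energy)\<^sup>2)"
  proof (rule K.P.integrable_bounded_on)
    fix z
    have "\<bar>mmd z\<bar> \<le> (\<Sum>(i, j)\<in>D. \<bar>mmd_weight n m i j\<bar>)"
      unfolding mmd_def case_prod_unfold
      by (intro order_trans[OF sum_abs] sum_mono) (auto simp: abs_mult gauss_kernel_le_1[OF \<nu>] mult_left_le)
    then have "\<bar>mmd z - energy\<bar> \<le> (\<Sum>(i, j)\<in>D. \<bar>mmd_weight n m i j\<bar>) + energy" using E by linarith
    then show "\<bar>(mmd z - energy)\<^sup>2\<bar> \<le> ((\<Sum>(i, j)\<in>D. \<bar>mmd_weight n m i j\<bar>) + energy)\<^sup>2"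
      using power_mono[of "\<bar>mmd z - energy\<bar>" _ 2] by simp
  qed measurable
  have "K.P.prob A \<le> (\<integral>z. (mmd z - energy)\<^sup>2 \<partial>PP) / (energy\<^sup>2 / 4)"
    unfolding A_def by (rule integral_Markov_inequality_measure[OF imm sets.empty_sets]) (use e2 in auto)
  also have "\<dots> \<le> (4 * (noise * energy) + 4 * noise\<^sup>2) / (energy\<^sup>2 / 4)"
    using e2 by (intro divide_right_mono variance_mmd) auto
  also have "\<dots> = 16 * (noise / energy) + 16 * (noise / energy)\<^sup>2"
    using E by (simp add: field_simps power2_eq_square)
  finally have A: "K.P.prob A \<le> 16 * (noise / energy) + 16 * (noise / energy)\<^sup>2" .
  have s0: "0 \<le> s_bound z" for z
    using s_tilde_sq_le[of z] order_trans[of 0 "1 / (real n)\<^sup>2"] by (auto simp: max.bounded_iff)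
  have "K.P.prob B \<le> (\<integral>z. 8 * Z\<^sup>2 * rate\<^sup>2 * s_bound z \<partial>PP) / energy\<^sup>2"
    unfolding B_def
    by (rule integral_Markov_inequality_measure[OF integrable_mult_right[OF s_bound_integrable] sets.empty_sets])
       (use e2 s0 in \<open>auto intro!: AE_I2 mult_nonneg_nonneg\<close>)
  also have "\<dots> = 8 * Z\<^sup>2 * rate\<^sup>2 * (\<integral>z. s_bound z \<partial>PP) / energy\<^sup>2" by simp
  also have "\<dots> \<le> 8 * Z\<^sup>2 * rate\<^sup>2 * (3 * (kap * M\<^sup>2)) / energy\<^sup>2"
    using s_bound_integral(2) small by (intro divide_right_mono mult_left_mono) auto
  also have "\<dots> = 24 * Z\<^sup>2 * (noise / energy)\<^sup>2"
    using kap_nonneg by (simp add: noise_def power_mult_distrib power_divide)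
  finally have B: "K.P.prob B \<le> 24 * Z\<^sup>2 * (noise / energy)\<^sup>2" .
  have sub: "space PP - {z \<in> space PP. rejects \<alpha> z} \<subseteq> A \<union> B"
    using rejects_if[OF E] unfolding A_def B_def Z_def by (auto simp: not_less[symmetric])
  have "1 - K.P.prob {z \<in> space PP. rejects \<alpha> z} = K.P.prob (space PP - {z \<in> space PP. rejects \<alpha> z})"
    by (rule K.P.prob_compl[OF rejects_measurable, symmetric])
  also have "\<dots> \<le> K.P.prob (A \<union> B)"
    using AB by (intro K.P.finite_measure_mono[OF sub]) auto
  also have "\<dots> \<le> K.P.prob A + K.P.prob B"
    using AB by (rule measure_Un_le)
  also have "\<dots> \<le> 16 * (noise / energy) + (16 + 24 * Z\<^sup>2) * (noise / energy)\<^sup>2"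
    using A B by (simp add: algebra_simps)
  finally show ?thesis unfolding reject_prob_eq Z_def by linarith
qed

end

section \<open>Asymptotic power\<close>

lemma sobolev_integrand_nonneg: "0 \<le> sobolev_integrand s f \<omega>"
  by (simp add: sobolev_integrand_def)

lemma sobolev_integrand_measurable [measurable]:
  fixes f :: "real ^ 'd::finite \<Rightarrow> real"
  assumes "f \<in> borel_measurable borel"
  shows "sobolev_integrand s f \<in> borel_measurable borel"
  unfolding sobolev_integrand_def[abs_def] using assms by measurable

lemma sobolev_integrand_add:
  fixes f g :: "real ^ 'd::finite \<Rightarrow> real"
  assumes "integrable lborel f" "integrable lborel g"
  shows "sobolev_integrand s (\<lambda>x. f x + c * g x) \<omega> \<le> 2 * sobolev_integrand s f \<omega> + 2 * c\<^sup>2 * sobolev_integrand s g \<omega>"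
proof -
  have "cmod (fourier f \<omega> + c * fourier g \<omega>) \<le> cmod (fourier f \<omega>) + \<bar>c\<bar> * cmod (fourier g \<omega>)"
    using norm_triangle_ineq[of "fourier f \<omega>" "c * fourier g \<omega>"] by (simp add: norm_mult)
  then have "(cmod (fourier f \<omega> + c * fourier g \<omega>))\<^sup>2 \<le> (cmod (fourier f \<omega>) + \<bar>c\<bar> * cmod (fourier g \<omega>))\<^sup>2"
    by (intro power_mono) auto
  also have "\<dots> \<le> 2 * (cmod (fourier f \<omega>))\<^sup>2 + 2 * (\<bar>c\<bar> * cmod (fourier g \<omega>))\<^sup>2"
    using sum_squares_bound[of "cmod (fourier f \<omega>)" "\<bar>c\<bar> * cmod (fourier g \<omega>)"]
    unfolding power2_sum by linarith
  finally have "(1 + (norm \<omega>)\<^sup>2) powr s * (cmod (fourier f \<omega> + c * fourier g \<omega>))\<^sup>2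
     \<le> (1 + (norm \<omega>)\<^sup>2) powr s * (2 * (cmod (fourier f \<omega>))\<^sup>2 + 2 * (\<bar>c\<bar> * cmod (fourier g \<omega>))\<^sup>2)"
    by (intro mult_left_mono) auto
  then show ?thesis
    unfolding sobolev_integrand_def fourier_linear[OF assms] by (simp add: power_mult_distrib algebra_simps)
qed

lemma
  fixes f g :: "real ^ 'd::finite \<Rightarrow> real"
  assumes f: "integrable lborel f" "integrable lborel (sobolev_integrand s f)"
    and g: "integrable lborel g" "integrable lborel (sobolev_integrand s g)"
  shows integrable_sobolev_integrand_add: "integrable lborel (sobolev_integrand s (\<lambda>x. f x + c * g x))"
    and integral_sobolev_integrand_add: "(LINT \<omega>|lborel. sobolev_integrand s (\<lambda>x. f x + c * g x) \<omega>) \<le>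
      2 * (LINT \<omega>|lborel. sobolev_integrand s f \<omega>) + 2 * c\<^sup>2 * (LINT \<omega>|lborel. sobolev_integrand s g \<omega>)"
proof -
  have [measurable]: "f \<in> borel_measurable borel" "g \<in> borel_measurable borel" using f g by auto
  have int: "integrable lborel (\<lambda>\<omega>. 2 * sobolev_integrand s f \<omega> + 2 * c\<^sup>2 * sobolev_integrand s g \<omega>)"
    using f g by simp
  show 1: "integrable lborel (sobolev_integrand s (\<lambda>x. f x + c * g x))"
  proof (rule Bochner_Integration.integrable_bound[OF int])
    show "AE \<omega> in lborel. norm (sobolev_integrand s (\<lambda>x. f x + c * g x) \<omega>)
        \<le> norm (2 * sobolev_integrand s f \<omega> + 2 * c\<^sup>2 * sobolev_integrand s g \<omega>)"
      using order_trans[OF sobolev_integrand_add[OF f(1) g(1), of s c] abs_ge_self]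
      by (auto simp: sobolev_integrand_nonneg)
  qed measurable
  have "(LINT \<omega>|lborel. sobolev_integrand s (\<lambda>x. f x + c * g x) \<omega>) \<le>
     (LINT \<omega>|lborel. 2 * sobolev_integrand s f \<omega> + 2 * c\<^sup>2 * sobolev_integrand s g \<omega>)"
    by (rule integral_mono[OF 1 int sobolev_integrand_add[OF f(1) g(1)]])
  also have "\<dots> = 2 * (LINT \<omega>|lborel. sobolev_integrand s f \<omega>) + 2 * c\<^sup>2 * (LINT \<omega>|lborel. sobolev_integrand s g \<omega>)"
    using f g by simp
  finally show "(LINT \<omega>|lborel. sobolev_integrand s (\<lambda>x. f x + c * g x) \<omega>) \<le> \<dots>" .
qed

lemma (in two_sample) energy_ge:
  assumes \<Delta>: "0 \<le> \<Delta>" "l2_norm (\<lambda>x. p x - q x) \<ge> \<Delta>"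
  shows "energy \<ge> kap * exp (- 1 / 4) * (\<Delta>\<^sup>2 - \<nu> powr (- s) * (4 * M\<^sup>2))"
proof -
  note P = sobolev_ballD[OF p_ball s] and Q = sobolev_ballD[OF q_ball s]
  have eq: "(\<lambda>x. p x - q x) = (\<lambda>x. p x + (- 1) * q x)" by simp
  have S: "integrable lborel (sobolev_integrand s (\<lambda>x. p x - q x))"
    unfolding eq by (rule integrable_sobolev_integrand_add[OF P(1) P(3) Q(1) Q(3)])
  have S_le: "(LINT \<omega>|lborel. sobolev_integrand s (\<lambda>x. p x - q x) \<omega>) \<le> 4 * M\<^sup>2"
    using integral_sobolev_integrand_add[OF P(1) P(3) Q(1) Q(3), of "- 1"] P(4) Q(4) unfolding eq by simp
  have cont: "AE x in lborel. isCont (\<lambda>x. p x - q x) x"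
    using P(2) Q(2) by eventually_elim (rule continuous_diff)
  have "\<Delta>\<^sup>2 \<le> (l2_norm (\<lambda>x. p x - q x))\<^sup>2" using \<Delta> by (intro power_mono) auto
  also have "\<dots> = (LINT x|lborel. (p x - q x)\<^sup>2)"
    unfolding l2_norm_def by (rule real_sqrt_pow2) simp
  finally have "\<Delta>\<^sup>2 - \<nu> powr (- s) * (4 * M\<^sup>2) \<le> 
      (LINT x|lborel. (p x - q x)\<^sup>2) - \<nu> powr (- s) * (LINT \<omega>|lborel. sobolev_integrand s (\<lambda>x. p x - q x) \<omega>)"
    using S_le by (intro diff_mono mult_left_mono) auto
  then have "kap * exp (- 1 / 4) * (\<Delta>\<^sup>2 - \<nu> powr (- s) * (4 * M\<^sup>2)) \<le> kap * exp (- 1 / 4) *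
      ((LINT x|lborel. (p x - q x)\<^sup>2) - \<nu> powr (- s) * (LINT \<omega>|lborel. sobolev_integrand s (\<lambda>x. p x - q x) \<omega>))"
    by (intro mult_left_mono) (auto simp: kap_def)
  also have "\<dots> \<le> energy"
    unfolding energy_def kap_def by (rule gauss_energy_lower_bound[OF diff_int cont S s \<nu>])
  finally show ?thesis .
qed

text \<open>The noise carries the root of \<open>kap\<close> and the energy carries \<open>kap\<close> itself, which leaves \<open>sqrt kap\<close> in the
  denominator.\<close>

lemma (in two_sample) noise_energy_ratio_le:
  assumes \<Delta>: "0 \<le> \<Delta>" "l2_norm (\<lambda>x. p x - q x) \<ge> \<Delta>"
    and w: "\<Delta>\<^sup>2 - \<nu> powr (- s) * (4 * M\<^sup>2) \<ge> w" "w > 0"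
    and r: "rate \<le> C / real n"
  shows "energy > 0" "noise / energy \<le> C * M * exp (1 / 4) / (real n * sqrt kap * w)"
proof -
  have k: "0 < kap" using \<nu> by (simp add: kap_def)
  have k': "kap = sqrt kap * sqrt kap" using k by simp
  have sk: "0 < sqrt kap" using k by simp
  have "kap * exp (- 1 / 4) * w \<le> kap * exp (- 1 / 4) * (\<Delta>\<^sup>2 - \<nu> powr (- s) * (4 * M\<^sup>2))"
    using w k by (intro mult_left_mono) auto
  then have e: "kap * exp (- 1 / 4) * w \<le> energy" using energy_ge[OF \<Delta>] by linarith
  have pos: "0 < kap * exp (- 1 / 4) * w" using k w by simp
  show E: "energy > 0" using e pos by linarith
  have "noise \<le> C / real n * M * sqrt kap"
    unfolding noise_def using r M_nonneg sk by (intro mult_right_mono) auto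
  then have "noise / energy \<le> C / real n * M * sqrt kap / energy"
    using E by (intro divide_right_mono) auto
  also have "\<dots> \<le> C / real n * M * sqrt kap / (kap * exp (- 1 / 4) * w)"
  proof (rule divide_left_mono[OF e])
    show "0 < energy * (kap * exp (- 1 / 4) * w)" by (rule mult_pos_pos[OF E pos])
    have "0 \<le> C / real n" using r rate_pos by linarith
    then show "0 \<le> C / real n * M * sqrt kap" using M_nonneg sk by (intro mult_nonneg_nonneg) auto
  qed
  also have "\<dots> = C * M * exp (1 / 4) / (real n * sqrt kap * w)"
  proof -
    have "C / real n * M * sqrt kap / (kap * exp (- 1 / 4) * w) = C / real n * M * sqrt kap / (sqrt kap * sqrt kap * exp (- 1 / 4) * w)"
      using k' by metis
    also have "\<dots> = C * M / (real n * sqrt kap * w * exp (- (1 / 4)))"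
      using sk by (simp add: divide_simps)
    also have "exp (- (1 / 4)) = inverse (exp (1 / 4 :: real))" by (rule exp_minus)
    finally show ?thesis by (simp add: divide_simps)
  qed
  finally show "noise / energy \<le> C * M * exp (1 / 4) / (real n * sqrt kap * w)" .
qed

lemma hom_power_bounds:
  shows "hom_power s M \<Delta> n m \<Phi> \<le> 1"
    and "(\<And>p q. (p, q) \<in> hom_alternative s M \<Delta> \<Longrightarrow> c \<le> reject_prob p q n m \<Phi>) \<Longrightarrow> c \<le> 1 \<Longrightarrow> c \<le> hom_power s M \<Delta> n m \<Phi>"
    and "(p, q) \<in> hom_alternative s M \<Delta> \<Longrightarrow> hom_power s M \<Delta> n m \<Phi> \<le> reject_prob p q n m \<Phi>"
proof -
  have bdd: "bdd_below (insert 1 ((\<lambda>(p, q). reject_prob p q n m \<Phi>) ` hom_alternative s M \<Delta>))"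
    by (rule bdd_belowI[of _ 0]) (auto simp: reject_prob_def)
  show "hom_power s M \<Delta> n m \<Phi> \<le> 1" unfolding hom_power_def by (rule cInf_lower[OF _ bdd]) simp
  show "c \<le> hom_power s M \<Delta> n m \<Phi>" if "\<And>p q. (p, q) \<in> hom_alternative s M \<Delta> \<Longrightarrow> c \<le> reject_prob p q n m \<Phi>" "c \<le> 1"
    unfolding hom_power_def by (rule cInf_greatest) (use that in auto)
  show "hom_power s M \<Delta> n m \<Phi> \<le> reject_prob p q n m \<Phi>" if "(p, q) \<in> hom_alternative s M \<Delta>"
    unfolding hom_power_def by (rule cInf_lower[OF _ bdd]) (use that in force)
qed

text \<open>For \<open>\<nu>\<close> of order \<open>n\<^sup>a\<close> with \<open>a = 4/(d+4s)\<close>, both \<open>n sqrt kap\<close> and \<open>\<nu>\<^sup>s\<close> are of order \<open>n\<^bsup>4s/(d+4s)\<^esup>\<close>: this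
  choice balances noise against smoothing bias. The bound \<open>R\<close> on the ratio of noise and energy depends on
  \<open>n\<close> only, so the power is bounded uniformly over the alternative.\<close>

lemma hom_test_power_tendsto_1:
  fixes s M c\<^sub>0 C\<^sub>0 :: real and m :: "nat \<Rightarrow> nat" and \<Delta> \<nu> :: "nat \<Rightarrow> real"
  assumes s: "s > 0" and M: "M > 0" and c0: "0 < c\<^sub>0"
    and m: "\<forall>n\<ge>1. c\<^sub>0 \<le> real (m n) / real n"
    and \<Delta>: "\<forall>n\<ge>1. \<Delta> n > 0"
    and lim: "filterlim (\<lambda>n. real n powr (2 * s / (real CARD('d::finite) + 4 * s)) * \<Delta> n) at_top sequentially"
    and \<nu>: "\<forall>n\<ge>1. \<nu> n > 0" "\<nu> \<in> \<Theta>(\<lambda>n. real n powr (4 / (real CARD('d) + 4 * s)))"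
  shows "(\<lambda>n. hom_power s M (\<Delta> n) n (m n) (hom_test (\<nu> n) \<alpha> n (m n) :: 'd two_sample_test)) \<longlonglongrightarrow> 1"
proof -
  define d where "d = real CARD('d)"
  have d: "d > 0" by (simp add: d_def)
  define a where "a = 4 / (d + 4 * s)"
  define b where "b = 2 * s / (d + 4 * s)"
  have ds: "d + 4 * s > 0" using d s by simp
  have a: "a > 0" and b: "b > 0" using d s by (auto simp: a_def b_def)
  have exps: "1 - a * (d / 4) = 2 * b" "a * s = 2 * b" "a * (d / 2) = 2 - 4 * b"
    using ds by (auto simp: a_def b_def field_simps)
  obtain c2 where c2: "c2 > 0" "eventually (\<lambda>n. \<nu> n \<le> c2 * real n powr a) sequentially"
  proof -
    from \<nu>(2) have "\<nu> \<in> O(\<lambda>n. real n powr a)" by (auto simp: bigtheta_def a_def d_def)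
    then obtain c where "c > 0" "eventually (\<lambda>n. norm (\<nu> n) \<le> c * norm (real n powr a)) sequentially"
      by (auto elim: landau_o.bigE)
    then show ?thesis by (intro that[of c]) (auto elim: eventually_mono)
  qed
  obtain c1 where c1: "c1 > 0" "eventually (\<lambda>n. c1 * real n powr a \<le> \<nu> n) sequentially"
  proof -
    from \<nu>(2) have "\<nu> \<in> \<Omega>(\<lambda>n. real n powr a)" by (auto simp: bigtheta_def a_def d_def)
    then obtain c where c: "c > 0" "eventually (\<lambda>n. norm (\<nu> n) \<ge> c * norm (real n powr a)) sequentially"
      by (auto elim: landau_omega.bigE)
    have "eventually (\<lambda>n. c * real n powr a \<le> \<nu> n) sequentially"
      using c(2) eventually_ge_at_top[of 1] by eventually_elim (use \<nu>(1) in \<open>auto simp: less_imp_le\<close>)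
    then show ?thesis using c(1) by (intro that[of c])
  qed
  define Z where "Z = normal_upper_quantile \<alpha>"
  (* K bounds the root of kn from below in units of n^(-a d/4), and L bounds the smoothing bias in units of n^(-2b) *)
  define K where "K = (pi / c2) powr (d / 4)"
  have K: "K > 0" using c2 by (simp add: K_def)
  define L where "L = 4 * M\<^sup>2 * c1 powr (- s)"
  define g where "g = (\<lambda>n. (real n powr b * \<Delta> n)\<^sup>2 - L)"
  define C where "C = 1 + 1 / c\<^sub>0"
  define R where "R = (\<lambda>n. C * M * exp (1 / 4) / (K * g n))"
  have g: "filterlim g at_top sequentially"
  proof -
    have "filterlim (\<lambda>n. (real n powr b * \<Delta> n)\<^sup>2) at_top sequentially"
      using lim unfolding b_def d_def by (intro filterlim_pow_at_top) auto
    then have "filterlim (\<lambda>n. - L + (real n powr b * \<Delta> n)\<^sup>2) at_top sequentially"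
      by (intro filterlim_tendsto_add_at_top[OF tendsto_const])
    then show ?thesis unfolding g_def by (simp add: algebra_simps)
  qed
  have R0: "R \<longlonglongrightarrow> 0"
  proof -
    have "filterlim (\<lambda>n. K * g n) at_top sequentially"
      by (rule filterlim_tendsto_pos_mult_at_top[OF tendsto_const K g])
    then show ?thesis unfolding R_def
      by (intro tendsto_divide_0[OF tendsto_const] filterlim_at_top_imp_at_infinity)
  qed
  define lb where "lb = (\<lambda>n. 1 - (16 * R n + (16 + 24 * Z\<^sup>2) * (R n)\<^sup>2))"
  have lb: "lb \<longlonglongrightarrow> 1 - (16 * 0 + (16 + 24 * Z\<^sup>2) * 0\<^sup>2)"
    unfolding lb_def by (intro tendsto_intros R0)
  have sm: "filterlim (\<lambda>n. K\<^sup>2 * M\<^sup>2 * real n powr (4 * b)) at_top sequentially"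
    using K M b by real_asymp
  have "eventually (\<lambda>n. lb n \<le> hom_power s M (\<Delta> n) n (m n) (hom_test (\<nu> n) \<alpha> n (m n) :: 'd two_sample_test)) sequentially"
    using c1(2) c2(2) eventually_ge_at_top[of 2] eventually_ge_at_top[of "nat \<lceil>2 / c\<^sub>0\<rceil>"]
      filterlim_at_top_dense[THEN iffD1, OF g, rule_format, of 0] filterlim_at_top[THEN iffD1, OF sm, rule_format, of 1]
  proof eventually_elim
    case (elim n)
    have n: "real n > 0" using elim by simp
    have nu: "\<nu> n > 0" using \<nu>(1) elim by auto
    have na: "real n powr a > 0" using n by simp
    have "real n \<ge> 2 / c\<^sub>0" using elim(4) by linarith
    then have "2 \<le> c\<^sub>0 * real n" using c0 by (simp add: field_simps)
    also have mn: "c\<^sub>0 * real n \<le> real (m n)" using m elim(3) n by (simp add: field_simps)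
    finally have m2: "m n \<ge> 2" by simp
    define w where "w = g n / real n powr (2 * b)"
    have w: "w > 0" using elim n by (simp add: w_def)
    have nus: "\<nu> n powr (- s) \<le> c1 powr (- s) * real n powr (- (2 * b))"
    proof -
      have "\<nu> n powr (- s) \<le> (c1 * real n powr a) powr (- s)"
        using elim(1) s c1 na by (intro powr_mono2') auto
      also have "\<dots> = c1 powr (- s) * real n powr (- (2 * b))"
        using c1 n exps(2) by (simp add: powr_mult powr_powr)
      finally show ?thesis .
    qed
    have w_le: "(\<Delta> n)\<^sup>2 - \<nu> n powr (- s) * (4 * M\<^sup>2) \<ge> w"
    proof -
      have p2: "(real n powr b)\<^sup>2 = real n powr (2 * b)"
        using n by (simp add: powr_power mult.commute)
      have gen: "(x * y - u) / x = y - u * inverse x" if "x > 0" for x y u :: real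
        using that by (simp add: field_simps)
      have "w = (real n powr (2 * b) * (\<Delta> n)\<^sup>2 - L) / real n powr (2 * b)"
        by (simp only: w_def g_def power_mult_distrib p2)
      also have "\<dots> = (\<Delta> n)\<^sup>2 - L * inverse (real n powr (2 * b))"
        by (rule gen) (use n in simp)
      also have "inverse (real n powr (2 * b)) = real n powr (- (2 * b))"
        by (simp only: powr_minus)
      finally have "w = (\<Delta> n)\<^sup>2 - 4 * M\<^sup>2 * (c1 powr (- s) * real n powr (- (2 * b)))"
        by (simp only: L_def mult.assoc)
      moreover have "\<nu> n powr (- s) * (4 * M\<^sup>2) \<le> (c1 powr (- s) * real n powr (- (2 * b))) * (4 * M\<^sup>2)"
        using nus by (intro mult_right_mono) auto
      ultimately show ?thesis by (simp add: algebra_simps)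
    qed
    define kn where "kn = (pi / \<nu> n) powr (d / 2)"
    have kn: "kn > 0" using nu by (simp add: kn_def)
    have skap: "sqrt kn \<ge> K * real n powr (- (a * (d / 4)))"
    proof -
      have "sqrt kn = (pi / \<nu> n) powr (d / 4)"
        unfolding kn_def using nu by (simp add: powr_half_sqrt[symmetric] powr_powr)
      also have "\<dots> \<ge> (pi / (c2 * real n powr a)) powr (d / 4)"
        using elim(2) nu c2 na d by (intro powr_mono2 divide_left_mono) auto
      also have "(pi / (c2 * real n powr a)) powr (d / 4) = K * real n powr (- (a * (d / 4)))"
      proof -
        have "pi / (c2 * real n powr a) = (pi / c2) * real n powr (- a)"
          by (simp add: powr_minus divide_inverse)
        then have "(pi / (c2 * real n powr a)) powr (d / 4) = ((pi / c2) * real n powr (- a)) powr (d / 4)"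
          by (simp only:)
        also have "\<dots> = (pi / c2) powr (d / 4) * (real n powr (- a)) powr (d / 4)"
          using c2 by (subst powr_mult) auto
        finally show ?thesis unfolding K_def by (simp add: powr_powr)
      qed
      finally show ?thesis .
    qed
    have nsk: "K * g n \<le> real n * sqrt kn * w"
    proof -
      have "K * g n = K * real n powr (2 * b) * w" using n by (simp add: w_def)
      also have "real n powr (2 * b) = real n * real n powr (- (a * (d / 4)))"
        using n exps(1) by (simp add: powr_mult_base)
      also have "K * (real n * real n powr (- (a * (d / 4)))) * w = real n * (K * real n powr (- (a * (d / 4)))) * w" by simp
      also have "\<dots> \<le> real n * sqrt kn * w"
        using skap w n by (intro mult_right_mono mult_left_mono) auto
      finally show ?thesis .
    qed
    have small: "1 / (real n)\<^sup>2 \<le> kn * M\<^sup>2"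
    proof -
      have "(K * real n powr (- (a * (d / 4))))\<^sup>2 \<le> (sqrt kn)\<^sup>2"
        using skap K n by (intro power_mono) auto
      then have k: "K\<^sup>2 * real n powr (- (a * (d / 2))) \<le> kn"
        using kn n by (simp add: power_mult_distrib powr_power)
      have "1 / (real n)\<^sup>2 = real n powr (- 2)" using n by (simp add: powr_minus divide_inverse)
      also have "\<dots> \<le> (K\<^sup>2 * M\<^sup>2 * real n powr (4 * b)) * real n powr (- 2)"
        using elim(6) by (simp add: mult_le_cancel_right1)
      also have "\<dots> = K\<^sup>2 * real n powr (- (a * (d / 2))) * M\<^sup>2"
      proof -
        have e: "- (a * (d / 2)) = 4 * b + - 2" using exps(3) by linarith
        show ?thesis unfolding e powr_add by (simp only: mult_ac)
      qed
      also have "\<dots> \<le> kn * M\<^sup>2" using k by (intro mult_right_mono) auto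
      finally show ?thesis .
    qed
    have rate_le: "1 / real n + 1 / real (m n) \<le> C / real n"
    proof -
      have "1 / real (m n) \<le> 1 / (c\<^sub>0 * real n)" using mn c0 n m2 by (intro divide_left_mono) auto
      then show ?thesis by (simp add: C_def add_divide_distrib)
    qed
    show "lb n \<le> hom_power s M (\<Delta> n) n (m n) (hom_test (\<nu> n) \<alpha> n (m n) :: 'd two_sample_test)"
    proof (rule hom_power_bounds(2))
      have "0 \<le> C" using c0 by (simp add: C_def)
      then have Rn: "0 \<le> R n" unfolding R_def using M K elim(5) by simp
      have "0 \<le> (16 + 24 * Z\<^sup>2) * (R n)\<^sup>2" by (intro mult_nonneg_nonneg) auto
      then show "lb n \<le> 1" using Rn unfolding lb_def by linarith
      fix p q :: "real ^ 'd \<Rightarrow> real"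
      assume pq: "(p, q) \<in> hom_alternative s M (\<Delta> n)"
      interpret two_sample p q s M "\<nu> n" n "m n"
        using pq s nu elim(3) m2 by unfold_locales (auto simp: hom_alternative_def)
      have kk: "kap = kn" by (simp add: kn_def kap_def d_def)
      have l2: "l2_norm (\<lambda>x. p x - q x) \<ge> \<Delta> n" using pq by (auto simp: hom_alternative_def)
      have D0: "0 \<le> \<Delta> n" using \<Delta> elim(3) by (simp add: less_imp_le)
      have r: "rate \<le> C / real n" using rate_le by (simp add: rate_def)
      note ne = noise_energy_ratio_le[OF D0 l2 w_le w r]
      have "noise / energy \<le> C * M * exp (1 / 4) / (real n * sqrt kn * w)" using ne(2) unfolding kk .
      also have "\<dots> \<le> R n"
        unfolding R_def using nsk K elim(5) \<open>0 \<le> C\<close> M n kn w by (intro divide_left_mono) auto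
      finally have le: "noise / energy \<le> R n" .
      have ne0: "0 \<le> noise / energy" using ne(1) rate_pos M_nonneg kap_nonneg by (simp add: noise_def)
      have "1 - (16 * R n + (16 + 24 * Z\<^sup>2) * (R n)\<^sup>2) \<le> 1 - (16 * (noise / energy) + (16 + 24 * Z\<^sup>2) * (noise / energy)\<^sup>2)"
        using le ne0 by (intro diff_left_mono add_mono mult_left_mono power_mono) auto
      also have "\<dots> \<le> reject_prob p q n (m n) (hom_test (\<nu> n) \<alpha> n (m n))"
        unfolding Z_def using small by (intro reject_prob_ge ne(1)) (simp add: kk)
      finally show "lb n \<le> reject_prob p q n (m n) (hom_test (\<nu> n) \<alpha> n (m n))" by (simp add: lb_def)
    qed
  qed
  moreover have "eventually (\<lambda>n. hom_power s M (\<Delta> n) n (m n) (hom_test (\<nu> n) \<alpha> n (m n) :: 'd two_sample_test) \<le> 1) sequentially"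
    by (intro always_eventually allI hom_power_bounds(1))
  moreover have "lb \<longlonglongrightarrow> 1" using lb by simp
  ultimately show ?thesis by (rule tendsto_sandwich[OF _ _ _ tendsto_const])
qed

section \<open>Smooth bumps with small Sobolev norm\<close>

text \<open>Bumps are polynomials restricted to the unit interval. Divisibility by a power of \<open>t (1 - t)\<close> encodes that
  derivatives vanish at both ends, and it makes integration by parts free of boundary terms.\<close>

definition edge_poly :: "real poly" where "edge_poly = [:0, 1, -1:]"

definition bump1 :: "real poly \<Rightarrow> real \<Rightarrow> real" where "bump1 P t = indicator {0..1} t * poly P t"

text \<open>The operator \<open>1 - D\<^sup>2\<close>, which acts as multiplication by \<open>1 + u\<^sup>2\<close> on Fourier transforms. Its powers replace the
  fractional derivatives in the Sobolev norm.\<close>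

definition one_minus_D2 :: "real poly \<Rightarrow> real poly" where "one_minus_D2 P = P - pderiv (pderiv P)"

lemma edge_power_dvd_pderiv: "edge_poly ^ Suc k dvd P \<Longrightarrow> edge_poly ^ k dvd pderiv P"
proof -
  assume "edge_poly ^ Suc k dvd P"
  then obtain Q where Q: "P = edge_poly ^ Suc k * Q" by (rule dvdE)
  show ?thesis unfolding Q pderiv_mult pderiv_power_Suc
    by (intro dvd_add) (auto simp: mult.assoc intro!: dvd_smult)
qed

lemma edge_power_dvd_one_minus_D2: "edge_poly ^ (k + 2) dvd P \<Longrightarrow> edge_poly ^ k dvd one_minus_D2 P"
  unfolding one_minus_D2_def
  by (intro dvd_diff edge_power_dvd_pderiv) (auto intro: dvd_trans[OF le_imp_power_dvd])

lemma edge_power_dvd_one_minus_D2_funpow: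
  "edge_poly ^ (k + 2 * r) dvd P \<Longrightarrow> edge_poly ^ k dvd (one_minus_D2 ^^ r) P"
proof (induction r arbitrary: k)
  case (Suc r)
  then have "edge_poly ^ (k + 2) dvd (one_minus_D2 ^^ r) P" by (intro Suc.IH) simp
  then show ?case using edge_power_dvd_one_minus_D2 by simp
qed simp

lemma edge_dvd_poly_0: "edge_poly dvd P \<Longrightarrow> poly P 0 = 0 \<and> poly P 1 = 0"
  by (elim dvdE) (simp add: edge_poly_def)

lemma bump1_measurable [measurable]: "bump1 P \<in> borel_measurable borel"
  unfolding bump1_def[abs_def] by (intro borel_measurable_times borel_measurable_indicator borel_measurable_continuous_onI continuous_intros) auto

lemma bump1_integrable: "integrable lborel (bump1 P)"
  using borel_integrable_atLeastAtMost'[of 0 1 "poly P"]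
  by (simp add: bump1_def[abs_def] set_integrable_def continuous_on_poly)

lemma bump1_sq: "(bump1 P t)\<^sup>2 = bump1 (P * P) t"
  by (simp add: bump1_def power2_eq_square indicator_def)

lemma bump1_bounded: "\<exists>B>0. \<forall>t. \<bar>bump1 P t\<bar> \<le> B"
proof -
  have "compact (poly P ` {0..1})" by (intro compact_continuous_image continuous_intros) auto
  then obtain B where "B > 0" "\<forall>y\<in>poly P ` {0..1}. norm y \<le> B"
    using compact_imp_bounded bounded_pos by blast
  then show ?thesis by (intro exI[of _ B]) (auto simp: bump1_def indicator_def)
qed

lemma bump1_continuous:
  assumes "edge_poly dvd P"
  shows "continuous_on UNIV (bump1 P)"
proof -
  have "bump1 P = (\<lambda>t. poly P (max 0 (min 1 t)))"
    using edge_dvd_poly_0[OF assms] by (auto simp: bump1_def indicator_def fun_eq_iff max_def min_def)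
  then show ?thesis by (auto intro!: continuous_intros)
qed

lemma bump1_nonzeroD:
  assumes "edge_poly dvd P" "bump1 P t \<noteq> 0"
  shows "0 < t" "t < 1"
proof -
  have "0 \<le> t" "t \<le> 1" "t \<noteq> 0" "t \<noteq> 1"
    using assms edge_dvd_poly_0[OF assms(1)] by (auto simp: bump1_def indicator_def split: if_splits)
  then show "0 < t" "t < 1" by auto
qed

lemma bump1_integral_pderiv: "(LINT t|lborel. bump1 (pderiv Q) t) = poly Q 1 - poly Q 0"
  using integral_FTC_Icc_real[of 0 1 "poly Q" "poly (pderiv Q)"]
  by (simp add: bump1_def[abs_def] poly_DERIV mult.commute)

lemma bump1_sq_integral_pos:
  assumes "P \<noteq> 0"
  shows "0 < (LINT t|lborel. (bump1 P t)\<^sup>2)"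
proof -
  have int: "integrable lborel (\<lambda>t. (bump1 P t)\<^sup>2)" unfolding bump1_sq by (rule bump1_integrable)
  have "(LINT t|lborel. (bump1 P t)\<^sup>2) \<noteq> 0"
  proof
    assume "(LINT t|lborel. (bump1 P t)\<^sup>2) = 0"
    then have "AE t in lborel. (bump1 P t)\<^sup>2 = 0"
      using integral_nonneg_eq_0_iff_AE[OF int] by simp
    then have "AE t in lborel. t \<notin> {0..1} \<or> poly P t = 0"
      by eventually_elim (auto simp: bump1_def indicator_def)
    moreover have "AE t in lborel. t \<notin> {t. poly P t = 0}"
      using poly_roots_finite[OF assms] by (intro AE_not_in finite_imp_null_set_lborel)
    ultimately have "AE t in lborel. t \<notin> {0..1::real}" by eventually_elim auto
    then have "{0..1::real} \<in> null_sets lborel" by (subst AE_iff_null_sets) auto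
    then show False by (auto simp: null_sets_def)
  qed
  moreover have "0 \<le> (LINT t|lborel. (bump1 P t)\<^sup>2)" by simp
  ultimately show ?thesis by linarith
qed

definition bump1_fourier :: "real poly \<Rightarrow> real \<Rightarrow> complex" where
  "bump1_fourier P u = (LINT t|lborel. complex_of_real (bump1 P t) * exp (- (\<i> * complex_of_real (t * u))))"

lemma bump1_fourier_integrable:
  "integrable lborel (\<lambda>t. complex_of_real (bump1 P t) * exp (- (\<i> * complex_of_real (t * u))))"
  by (rule Bochner_Integration.integrable_bound[OF bump1_integrable[of P]]) (auto simp: norm_mult)

text \<open>Two integrations by parts, in one step: \<open>(P' + \<i> u P) e\<^bsup>-\<i>ut\<^esup>\<close> is an antiderivative of
  \<open>(P'' + u\<^sup>2 P) e\<^bsup>-\<i>ut\<^esup>\<close> and vanishes at both ends.\<close>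

lemma bump1_fourier_one_minus_D2:
  assumes "edge_poly ^ 2 dvd P"
  shows "bump1_fourier (one_minus_D2 P) u = complex_of_real (1 + u\<^sup>2) * bump1_fourier P u"
proof -
  have P: "poly P 0 = 0" "poly P 1 = 0"
    using edge_dvd_poly_0 dvd_trans[OF dvd_power[of 2 edge_poly] assms] by auto
  have "edge_poly ^ 1 dvd pderiv P" using assms by (intro edge_power_dvd_pderiv) (simp add: numeral_2_eq_2)
  then have P': "poly (pderiv P) 0 = 0" "poly (pderiv P) 1 = 0"
    using edge_dvd_poly_0 by auto
  let ?e = "\<lambda>t::real. exp (- (\<i> * complex_of_real (t * u)))"
  let ?F = "\<lambda>t. (complex_of_real (poly (pderiv P) t) + \<i> * complex_of_real u * complex_of_real (poly P t)) * ?e t"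
  let ?f = "\<lambda>t. (complex_of_real (poly (pderiv (pderiv P)) t) + complex_of_real (u\<^sup>2) * complex_of_real (poly P t)) * ?e t"
  have "(\<integral>t. indicator {0..1} t *\<^sub>R ?f t \<partial>lborel) = ?F 1 - ?F 0"
  proof (rule integral_FTC_Icc)
    fix t :: real
    have e: "(?e has_vector_derivative (- \<i> * complex_of_real u) * ?e t) (at t)"
      using exp_scaleR_has_vector_derivative_right[of "- (\<i> * complex_of_real u)" t UNIV]
      by (simp add: scaleR_conv_of_real algebra_simps)
    have p: "((\<lambda>t. complex_of_real (poly P t)) has_vector_derivative complex_of_real (poly (pderiv P) t)) (at t)" for P
      by (intro has_vector_derivative_of_real) (simp add: poly_DERIV flip: has_real_derivative_iff_has_vector_derivative)
    have "(?F has_vector_derivative ((complex_of_real (poly (pderiv P) t) + \<i> * complex_of_real u * complex_of_real (poly P t)) * ((- \<i> * complex_of_real u) * ?e t) +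
        (complex_of_real (poly (pderiv (pderiv P)) t) + \<i> * complex_of_real u * complex_of_real (poly (pderiv P) t)) * ?e t)) (at t)"
      by (intro has_vector_derivative_mult has_vector_derivative_add has_vector_derivative_mult_right p e)
    also have "((complex_of_real (poly (pderiv P) t) + \<i> * complex_of_real u * complex_of_real (poly P t)) * ((- \<i> * complex_of_real u) * ?e t) +
        (complex_of_real (poly (pderiv (pderiv P)) t) + \<i> * complex_of_real u * complex_of_real (poly (pderiv P) t)) * ?e t) = ?f t"
      by (simp add: algebra_simps power2_eq_square)
    finally show "(?F has_vector_derivative ?f t) (at t within {0..1})" by (rule has_vector_derivative_at_within)
  next
    show "continuous_on {0..1} ?f" by (intro continuous_intros)
  qed simp
  also have "?F 1 - ?F 0 = 0" using P P' by simp
  finally have z: "(\<integral>t. indicator {0..1} t *\<^sub>R ?f t \<partial>lborel) = 0" .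
  have "bump1_fourier (one_minus_D2 P) u - complex_of_real (1 + u\<^sup>2) * bump1_fourier P u = 
     (LINT t|lborel. complex_of_real (bump1 (one_minus_D2 P) t) * ?e t - complex_of_real (1 + u\<^sup>2) * (complex_of_real (bump1 P t) * ?e t))"
    unfolding bump1_fourier_def
    by (subst integral_mult_right_zero[symmetric], subst Bochner_Integration.integral_diff)
       (intro bump1_fourier_integrable integrable_mult_right refl)+
  also have "\<dots> = (\<integral>t. - (indicator {0..1} t *\<^sub>R ?f t) \<partial>lborel)"
    by (intro Bochner_Integration.integral_cong refl) (auto simp: bump1_def one_minus_D2_def indicator_def algebra_simps)
  also have "\<dots> = 0" using z by simp
  finally show ?thesis by simp
qed

lemma bump1_fourier_one_minus_D2_funpow:
  assumes "edge_poly ^ (2 * r) dvd P"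
  shows "bump1_fourier ((one_minus_D2 ^^ r) P) u = complex_of_real ((1 + u\<^sup>2) ^ r) * bump1_fourier P u"
  using assms
proof (induction r)
  case (Suc r)
  have "edge_poly ^ 2 dvd (one_minus_D2 ^^ r) P"
    using Suc.prems by (intro edge_power_dvd_one_minus_D2_funpow) (simp add: add.commute)
  then have "bump1_fourier ((one_minus_D2 ^^ Suc r) P) u = complex_of_real (1 + u\<^sup>2) * bump1_fourier ((one_minus_D2 ^^ r) P) u"
    by (simp add: bump1_fourier_one_minus_D2)
  also have "bump1_fourier ((one_minus_D2 ^^ r) P) u = complex_of_real ((1 + u\<^sup>2) ^ r) * bump1_fourier P u"
    using Suc.prems by (intro Suc.IH) (auto intro: dvd_trans[OF le_imp_power_dvd])
  finally show ?case by simp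
qed simp

lemma
  assumes "L > 0"
  shows bump1_affine_fourier_integrable: "integrable lborel (\<lambda>t. complex_of_real (bump1 P (L * t - k)) * exp (- (\<i> * complex_of_real (t * u))))"
    and bump1_affine_fourier: "(LINT t|lborel. complex_of_real (bump1 P (L * t - k)) * exp (- (\<i> * complex_of_real (t * u))))
      = exp (- (\<i> * complex_of_real (k * (u / L)))) / complex_of_real L * bump1_fourier P (u / L)"
proof -
  let ?g = "\<lambda>v. complex_of_real (bump1 P v) * exp (- (\<i> * complex_of_real (v * (u / L))))"
  let ?c = "exp (- (\<i> * complex_of_real (k * (u / L))))"
  have eq: "complex_of_real (bump1 P (L * t - k)) * exp (- (\<i> * complex_of_real (t * u))) = ?c * ?g (- k + L * t)" for t
  proof -
    have "(k * (u / L)) + ((- k + L * t) * (u / L)) = t * u" using assms by (simp add: field_simps)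
    then have "exp (- (\<i> * complex_of_real (t * u))) = exp (- (\<i> * complex_of_real (k * (u / L)))) * exp (- (\<i> * complex_of_real ((- k + L * t) * (u / L))))"
      by (simp only: exp_add[symmetric] minus_add_distrib[symmetric] distrib_left[symmetric] of_real_add[symmetric])
    then show ?thesis by (simp add: algebra_simps)
  qed
  have "integrable lborel (\<lambda>t. ?g (- k + L * t))"
    using bump1_fourier_integrable[of P "u / L"] lborel_integrable_real_affine_iff[of L ?g "- k"] assms by simp
  then show "integrable lborel (\<lambda>t. complex_of_real (bump1 P (L * t - k)) * exp (- (\<i> * complex_of_real (t * u))))"
    unfolding eq by (rule integrable_mult_right)
  have "bump1_fourier P (u / L) = \<bar>L\<bar> *\<^sub>R (LINT t|lborel. ?g (- k + L * t))"
    unfolding bump1_fourier_def using assms by (intro lborel_integral_real_affine) auto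
  then have "(LINT t|lborel. ?g (- k + L * t)) = bump1_fourier P (u / L) / complex_of_real L"
    using assms by (simp add: scaleR_conv_of_real)
  then show "(LINT t|lborel. complex_of_real (bump1 P (L * t - k)) * exp (- (\<i> * complex_of_real (t * u))))
      = ?c / complex_of_real L * bump1_fourier P (u / L)"
    unfolding eq by simp
qed

lemma
  assumes "L > 0"
  shows bump1_affine_integrable: "integrable lborel (\<lambda>t. bump1 P (L * t - k))"
    and bump1_affine_integral: "(LINT t|lborel. bump1 P (L * t - k)) = (LINT t|lborel. bump1 P t) / L"
proof -
  have eq: "L * t - k = - k + L * t" for t by simp
  show "integrable lborel (\<lambda>t. bump1 P (L * t - k))"
    unfolding eq using bump1_integrable lborel_integrable_real_affine_iff[of L "bump1 P" "- k"] assms by simp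
  show "(LINT t|lborel. bump1 P (L * t - k)) = (LINT t|lborel. bump1 P t) / L"
    unfolding eq using lborel_integral_real_affine[of L "bump1 P" "- k"] assms by (simp add: field_simps)
qed

text \<open>The bump in the cell with corner \<open>k/L\<close> of the grid of mesh \<open>1/L\<close> in the unit cube.\<close>

definition cell_bump :: "real poly \<Rightarrow> nat \<Rightarrow> ('d \<Rightarrow> nat) \<Rightarrow> real ^ 'd \<Rightarrow> real" where
  "cell_bump P L k x = (\<Prod>i\<in>UNIV. bump1 P (real L * x $ i - real (k i)))"

definition cells :: "nat \<Rightarrow> ('d::finite \<Rightarrow> nat) set" where
  "cells L = (\<Pi>\<^sub>E i\<in>UNIV. {..<L})"

lemma finite_cells: "finite (cells L)" and card_cells: "card (cells L :: ('d::finite \<Rightarrow> nat) set) = L ^ CARD('d)"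
  by (auto simp: cells_def card_PiE intro!: finite_PiE)

lemma
  fixes k :: "'d::finite \<Rightarrow> nat"
  assumes "L > 0"
  shows cell_bump_integrable: "integrable lborel (cell_bump P L k)"
    and cell_bump_integral: "(LINT x|lborel. cell_bump P L k x) = ((LINT t|lborel. bump1 P t) / real L) ^ CARD('d)"
proof -
  have L: "real L > 0" using assms by simp
  show "integrable lborel (cell_bump P L k)"
    unfolding cell_bump_def[abs_def] by (intro integrable_coordinate_product bump1_affine_integrable L)
  show "(LINT x|lborel. cell_bump P L k x) = ((LINT t|lborel. bump1 P t) / real L) ^ CARD('d)"
    unfolding cell_bump_def
    by (subst integral_coordinate_product[OF bump1_affine_integrable[OF L]]) (simp add: bump1_affine_integral[OF L])
qed

lemma cell_bump_sq: "(cell_bump P L k x)\<^sup>2 = cell_bump (P * P) L k x"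
  unfolding cell_bump_def prod_power_distrib bump1_sq ..

text \<open>The factor relating the two transforms is the same for every cell, so it also relates the transforms of
  arbitrary combinations of bumps.\<close>

lemma cell_bump_fourier_one_minus_D2:
  fixes k :: "'d::finite \<Rightarrow> nat"
  assumes L: "L > 0" and P: "edge_poly ^ (2 * r) dvd P"
  shows "fourier (cell_bump ((one_minus_D2 ^^ r) P) L k) \<omega> =
     complex_of_real ((\<Prod>i\<in>UNIV. 1 + (\<omega> $ i / real L)\<^sup>2) ^ r) * fourier (cell_bump P L k) \<omega>"
proof -
  have L': "real L > 0" using L by simp
  let ?c = "complex_of_real ((2 * pi) powr (- real CARD('d) / 2))"
  let ?e = "\<lambda>i. exp (- (\<i> * complex_of_real (real (k i) * (\<omega> $ i / real L)))) / complex_of_real (real L)"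
  have *: "fourier (cell_bump P L k) \<omega> = ?c * (\<Prod>i\<in>UNIV. ?e i * bump1_fourier P (\<omega> $ i / real L))" for P
  proof -
    have "complex_of_real (cell_bump P L k x) * exp (- (\<i> * complex_of_real (x \<bullet> \<omega>))) =
      (\<Prod>i\<in>UNIV. complex_of_real (bump1 P (real L * x $ i - real (k i))) * exp (- (\<i> * complex_of_real (x $ i * \<omega> $ i))))" for x
      by (simp add: cell_bump_def prod.distrib inner_vec_def sum_distrib_left exp_sum flip: sum_negf)
    then show ?thesis unfolding fourier_def
      by (simp only:, subst integral_coordinate_product[OF bump1_affine_fourier_integrable[OF L']])
         (simp only: bump1_affine_fourier[OF L'])
  qed
  show ?thesis unfolding * bump1_fourier_one_minus_D2_funpow[OF P]
    unfolding mult.left_commute[of "?e _"] prod.distrib[of "\<lambda>i. complex_of_real _"] prod_power_distrib of_real_prod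
    by (simp only: prod.distrib mult.left_commute)
qed

lemma cell_bump_nonzeroD:
  assumes "edge_poly dvd P" "cell_bump P L k x \<noteq> 0"
  shows "real (k i) < real L * x $ i" "real L * x $ i < real (k i) + 1"
proof -
  have "bump1 P (real L * x $ i - real (k i)) \<noteq> 0" using assms(2) by (auto simp: cell_bump_def)
  from bump1_nonzeroD[OF assms(1) this] show "real (k i) < real L * x $ i" "real L * x $ i < real (k i) + 1" by auto
qed

lemma cell_bump_disjoint:
  fixes k k' :: "'d::finite \<Rightarrow> nat"
  assumes P: "edge_poly dvd P" and "k \<noteq> k'" "cell_bump P L k x \<noteq> 0"
  shows "cell_bump P L k' x = 0"
proof (rule ccontr)
  assume n: "cell_bump P L k' x \<noteq> 0"
  obtain i where i: "k i \<noteq> k' i" using assms(2) by auto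
  show False using cell_bump_nonzeroD[OF P assms(3), of i] cell_bump_nonzeroD[OF P n, of i] i by linarith
qed

lemma cell_bump_support:
  fixes k :: "'d::finite \<Rightarrow> nat"
  assumes P: "edge_poly dvd P" and k: "k \<in> cells L" and L: "L > 0" and n: "cell_bump P L k x \<noteq> 0"
  shows "0 < x $ i" "x $ i < 1"
proof -
  have "k i < L" using k by (auto simp: cells_def)
  then have "real (k i) + 1 \<le> real L" by simp
  then have "real L * x $ i < real L * 1" "0 < real L * x $ i" 
    using cell_bump_nonzeroD[OF P n, of i] by linarith+
  then show "0 < x $ i" "x $ i < 1" using L by (auto simp: zero_less_mult_iff)
qed

text \<open>The cells are disjoint, so every linear combination has at most one term at a given point. The second copy of the identity is for
  the squared bumps.\<close>

lemma sum_cell_bump_cases: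
  fixes x :: "real ^ 'd::finite"
  assumes P: "edge_poly dvd P"
  obtains "\<And>k. k \<in> cells L \<Longrightarrow> cell_bump P L k x = 0"
  | k0 where "k0 \<in> cells L" "\<And>c. (\<Sum>k\<in>cells L. c k * cell_bump P L k x) = c k0 * cell_bump P L k0 x"
     "cell_bump P L k0 x \<noteq> 0" "\<And>c. (\<Sum>k\<in>cells L. c k * (cell_bump P L k x)\<^sup>2) = c k0 * (cell_bump P L k0 x)\<^sup>2"
proof (cases "\<exists>k0\<in>cells L. cell_bump P L k0 x \<noteq> 0")
  case True
  then obtain k0 :: "'d \<Rightarrow> nat" where k0: "k0 \<in> cells L" "cell_bump P L k0 x \<noteq> 0" by auto
  have z: "cell_bump P L k x = 0" if "k \<noteq> k0" for k
    using cell_bump_disjoint[OF P _ k0(2), of k] that by auto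
  show ?thesis
  proof (rule that(2)[OF k0(1) _ k0(2)])
    fix c
    show "(\<Sum>k\<in>cells L. c k * cell_bump P L k x) = c k0 * cell_bump P L k0 x"
      using z k0(1) by (subst sum.remove[OF finite_cells k0(1)]) (auto intro!: sum.neutral)
    show "(\<Sum>k\<in>cells L. c k * (cell_bump P L k x)\<^sup>2) = c k0 * (cell_bump P L k0 x)\<^sup>2"
      using z k0(1) by (subst sum.remove[OF finite_cells k0(1)]) (auto intro!: sum.neutral)
  qed
qed (use that(1) in auto)

definition perturbation :: "real poly \<Rightarrow> nat \<Rightarrow> (('d::finite \<Rightarrow> nat) \<Rightarrow> real) \<Rightarrow> real ^ 'd \<Rightarrow> real" where
  "perturbation P L c x = (\<Sum>k\<in>cells L. c k * cell_bump P L k x)"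

lemma perturbation_integrable: "L > 0 \<Longrightarrow> integrable lborel (perturbation P L c)"
  unfolding perturbation_def[abs_def] by (intro Bochner_Integration.integrable_sum integrable_mult_right cell_bump_integrable)

lemma perturbation_mult:
  assumes "edge_poly dvd P"
  shows "perturbation P L c x * perturbation P L c' x = perturbation (P * P) L (\<lambda>k. c k * c' k) x"
proof (rule sum_cell_bump_cases[OF assms, of L x])
  assume "\<And>k. k \<in> cells L \<Longrightarrow> cell_bump P L k x = 0"
  then show ?thesis unfolding perturbation_def cell_bump_sq[symmetric] by simp
next
  fix k0
  assume 1: "\<And>c. (\<Sum>k\<in>cells L. c k * cell_bump P L k x) = c k0 * cell_bump P L k0 x"
    and 2: "\<And>c. (\<Sum>k\<in>cells L. c k * (cell_bump P L k x)\<^sup>2) = c k0 * (cell_bump P L k0 x)\<^sup>2"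
  show ?thesis
    unfolding perturbation_def cell_bump_sq[symmetric] 1 2 by (simp add: power2_eq_square)
qed

lemma perturbation_sq_integral:
  fixes c :: "('d::finite \<Rightarrow> nat) \<Rightarrow> real"
  assumes P: "edge_poly dvd P" and L: "L > 0" and c: "\<And>k. (c k)\<^sup>2 = a\<^sup>2"
  shows "integrable lborel (\<lambda>x. (perturbation P L c x)\<^sup>2)"
    and "(LINT x|lborel. (perturbation P L c x)\<^sup>2) = a\<^sup>2 * (LINT t|lborel. (bump1 P t)\<^sup>2) ^ CARD('d)"
proof -
  have eq: "(perturbation P L c x)\<^sup>2 = perturbation (P * P) L (\<lambda>k. a\<^sup>2) x" for x
    using perturbation_mult[OF P, of L c x c] c by (simp add: power2_eq_square)
  show "integrable lborel (\<lambda>x. (perturbation P L c x)\<^sup>2)" unfolding eq by (rule perturbation_integrable[OF L])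
  have "(LINT x|lborel. (perturbation P L c x)\<^sup>2) = (\<Sum>k\<in>(cells L :: ('d \<Rightarrow> nat) set). a\<^sup>2 * (LINT x|lborel. cell_bump (P * P) L k x))"
    unfolding eq unfolding perturbation_def
    by (subst Bochner_Integration.integral_sum) (auto intro!: integrable_mult_right cell_bump_integrable L)
  also have "\<dots> = real (L ^ CARD('d)) * (a\<^sup>2 * ((LINT t|lborel. bump1 (P * P) t) / real L) ^ CARD('d))"
    by (simp add: cell_bump_integral[OF L] card_cells)
  also have "\<dots> = a\<^sup>2 * (LINT t|lborel. bump1 (P * P) t) ^ CARD('d)"
    using L by (simp add: power_divide)
  finally show "(LINT x|lborel. (perturbation P L c x)\<^sup>2) = a\<^sup>2 * (LINT t|lborel. (bump1 P t)\<^sup>2) ^ CARD('d)"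
    unfolding bump1_sq .
qed

lemma perturbation_fourier:
  fixes c :: "('d::finite \<Rightarrow> nat) \<Rightarrow> real"
  assumes L: "L > 0"
  shows "fourier (perturbation P L c) \<omega> = (\<Sum>k\<in>cells L. complex_of_real (c k) * fourier (cell_bump P L k) \<omega>)"
proof -
  have *: "integrable lborel (\<lambda>x. \<Sum>k\<in>A. c k * cell_bump P L k x) \<and>
      fourier (\<lambda>x. \<Sum>k\<in>A. c k * cell_bump P L k x) \<omega> = (\<Sum>k\<in>A. complex_of_real (c k) * fourier (cell_bump P L k) \<omega>)"
    if "finite A" for A :: "('d \<Rightarrow> nat) set"
    using that
  proof (induction A rule: finite_induct)
    case empty
    then show ?case by (simp add: fourier_def)
  next
    case (insert k A)
    have "fourier (\<lambda>x. (\<Sum>k\<in>A. c k * cell_bump P L k x) + c k * cell_bump P L k x) \<omega> =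
      fourier (\<lambda>x. \<Sum>k\<in>A. c k * cell_bump P L k x) \<omega> + complex_of_real (c k) * fourier (cell_bump P L k) \<omega>"
      using insert.IH by (intro fourier_linear cell_bump_integrable L) auto
    then show ?case using insert cell_bump_integrable[OF L, of P k] by (simp add: add.commute)
  qed
  show ?thesis unfolding perturbation_def[abs_def] using *[OF finite_cells] by simp
qed

lemma one_plus_sum_le_prod:
  fixes f :: "'a \<Rightarrow> real"
  assumes "finite A" "\<And>i. i \<in> A \<Longrightarrow> 0 \<le> f i"
  shows "1 + sum f A \<le> (\<Prod>i\<in>A. 1 + f i)"
  using assms
proof (induction A rule: finite_induct)
  case (insert i A)
  have "1 + sum f (insert i A) \<le> 1 + sum f A + f i * (1 + sum f A)"
    using insert by (simp add: sum_nonneg algebra_simps)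
  also have "\<dots> = (1 + f i) * (1 + sum f A)" by (simp add: algebra_simps)
  also have "\<dots> \<le> (1 + f i) * (\<Prod>i\<in>A. 1 + f i)" using insert by (intro mult_left_mono) auto
  finally show ?case using insert by simp
qed simp

text \<open>Since \<open>(1 + |\<omega>|\<^sup>2)\<^sup>s\<close> is at most \<open>L\<^bsup>2s\<^esup> \<Prod>\<^sub>i (1 + (\<omega>\<^sub>i/L)\<^sup>2)\<^bsup>2r\<^esup>\<close> for \<open>s \<le> 2r\<close>, the integrand is dominated
  by \<open>L\<^bsup>2s\<^esup> |F h|\<^sup>2\<close>, where \<open>h\<close> is the same combination of the bumps to which \<open>1 - D\<^sup>2\<close> has been applied \<open>r\<close>
  times. The inequality between the norms of \<open>F h\<close> and \<open>h\<close> then bounds it by an integral of disjoint bumps,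
  whatever the signs are.\<close>

lemma perturbation_sobolev:
  fixes c :: "('d::finite \<Rightarrow> nat) \<Rightarrow> real"
  assumes P: "edge_poly ^ (2 * r + 1) dvd P" and L: "L > 0" and c: "\<And>k. (c k)\<^sup>2 = a\<^sup>2" and s: "s > 0" "s \<le> 2 * real r"
  shows "integrable lborel (sobolev_integrand s (perturbation P L c))"
    and "(LINT \<omega>|lborel. sobolev_integrand s (perturbation P L c) \<omega>) \<le>
      real L powr (2 * s) * (a\<^sup>2 * (LINT t|lborel. (bump1 ((one_minus_D2 ^^ r) P) t)\<^sup>2) ^ CARD('d))"
proof -
  let ?R = "(one_minus_D2 ^^ r) P"
  let ?g = "perturbation P L c" and ?h = "perturbation ?R L c"
  have R: "edge_poly dvd ?R" using edge_power_dvd_one_minus_D2_funpow[of 1 r P] P by (simp add: add.commute)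
  have P2: "edge_poly ^ (2 * r) dvd P" using P by (auto intro: dvd_trans[OF le_imp_power_dvd])
  have ig: "integrable lborel ?g" "integrable lborel ?h" by (rule perturbation_integrable[OF L])+
  then have [measurable]: "?g \<in> borel_measurable borel" by auto
  have F: "fourier ?h \<omega> = complex_of_real ((\<Prod>i\<in>UNIV. 1 + (\<omega> $ i / real L)\<^sup>2) ^ r) * fourier ?g \<omega>" for \<omega>
    unfolding perturbation_fourier[OF L] cell_bump_fourier_one_minus_D2[OF L P2] by (simp add: sum_distrib_left mult.left_commute)
  note h2 = perturbation_sq_integral[OF R L c]
  have ih: "integrable lborel (\<lambda>\<omega>. real L powr (2 * s) * (cmod (fourier ?h \<omega>))\<^sup>2)"
    by (intro integrable_mult_right integrable_fourier_sq ig h2)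
  have le: "sobolev_integrand s ?g \<omega> \<le> real L powr (2 * s) * (cmod (fourier ?h \<omega>))\<^sup>2" for \<omega>
  proof -
    define Q where "Q = (\<Prod>i\<in>UNIV. 1 + (\<omega> $ i / real L)\<^sup>2)"
    have Q1: "1 \<le> Q" unfolding Q_def by (rule prod_ge_1) simp
    have "1 + (norm \<omega>)\<^sup>2 \<le> (real L)\<^sup>2 * (1 + (\<Sum>i\<in>UNIV. (\<omega> $ i / real L)\<^sup>2))"
      using L by (simp add: norm_sq_eq_sum_sq distrib_left sum_distrib_left power_divide)
    also have "\<dots> \<le> (real L)\<^sup>2 * Q" unfolding Q_def by (intro mult_left_mono one_plus_sum_le_prod) auto
    finally have "(1 + (norm \<omega>)\<^sup>2) powr s \<le> ((real L)\<^sup>2 * Q) powr s" using s by (intro powr_mono2) auto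
    also have "\<dots> = real L powr (2 * s) * Q powr s"
    proof -
      have "(real L)\<^sup>2 = real L powr 2" using L by simp
      then show ?thesis using L Q1 by (simp only: powr_mult powr_powr)
    qed
    also have "Q powr s \<le> Q powr (2 * real r)" using Q1 s by (intro powr_mono) auto
    also have "Q powr (2 * real r) = (Q ^ r)\<^sup>2"
    proof -
      have "Q powr (2 * real r) = Q powr real (2 * r)" by simp
      also have "\<dots> = Q ^ (2 * r)" using Q1 by (subst powr_realpow) auto
      also have "\<dots> = (Q ^ r)\<^sup>2" by (simp add: power_mult mult.commute)
      finally show ?thesis .
    qed
    finally have "(1 + (norm \<omega>)\<^sup>2) powr s \<le> real L powr (2 * s) * (Q ^ r)\<^sup>2" by (simp add: mult_left_mono)
    then have "sobolev_integrand s ?g \<omega> \<le> real L powr (2 * s) * (Q ^ r)\<^sup>2 * (cmod (fourier ?g \<omega>))\<^sup>2"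
      unfolding sobolev_integrand_def by (rule mult_right_mono) simp
    also have "\<dots> = real L powr (2 * s) * (cmod (fourier ?h \<omega>))\<^sup>2"
      unfolding F norm_mult Q_def[symmetric] using Q1 by (simp add: power_mult_distrib norm_power)
    finally show ?thesis .
  qed
  have nn: "0 \<le> sobolev_integrand s ?g \<omega>" for \<omega> by (simp add: sobolev_integrand_def)
  show 1: "integrable lborel (sobolev_integrand s ?g)"
  proof (rule Bochner_Integration.integrable_bound[OF ih])
    show "AE \<omega> in lborel. norm (sobolev_integrand s ?g \<omega>) \<le> norm (real L powr (2 * s) * (cmod (fourier ?h \<omega>))\<^sup>2)"
      using order_trans[OF le abs_ge_self] nn by (intro AE_I2) auto
    show "sobolev_integrand s ?g \<in> borel_measurable lborel"
      unfolding sobolev_integrand_def[abs_def] by measurable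
  qed
  have "(LINT \<omega>|lborel. sobolev_integrand s ?g \<omega>) \<le> (LINT \<omega>|lborel. real L powr (2 * s) * (cmod (fourier ?h \<omega>))\<^sup>2)"
    by (rule integral_mono[OF 1 ih le])
  also have "\<dots> = real L powr (2 * s) * (LINT \<omega>|lborel. (cmod (fourier ?h \<omega>))\<^sup>2)" by simp
  also have "\<dots> \<le> real L powr (2 * s) * (LINT x|lborel. (?h x)\<^sup>2)"
    by (intro mult_left_mono integral_fourier_sq_le ig h2) auto
  finally show "(LINT \<omega>|lborel. sobolev_integrand s ?g \<omega>) \<le>
      real L powr (2 * s) * (a\<^sup>2 * (LINT t|lborel. (bump1 ?R t)\<^sup>2) ^ CARD('d))"
    unfolding h2(2) .
qed

section \<open>Mixtures of alternatives\<close>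

text \<open>On the positive axis \<open>cosh y exp(-y\<^sup>2/2)\<close> decreases, because \<open>sinh y \<le> y cosh y\<close>.\<close>

lemma cosh_le_exp_half_square: "cosh x \<le> exp (x\<^sup>2 / 2)" for x :: real
proof -
  have sinh_le: "sinh y \<le> y * cosh y" if "0 \<le> y" for y :: real
  proof -
    have "0 * cosh 0 - sinh 0 \<le> y * cosh y - sinh y"
    proof (rule DERIV_nonneg_imp_nondecreasing[OF that])
      fix t :: real assume "0 \<le> t" "t \<le> y"
      then show "\<exists>D. ((\<lambda>y. y * cosh y - sinh y) has_real_derivative D) (at t) \<and> 0 \<le> D"
        by (intro exI[of _ "t * sinh t"]) (auto intro!: derivative_eq_intros)
    qed
    then show ?thesis by simp
  qed
  have nn: "cosh y * exp (- (y\<^sup>2 / 2)) \<le> 1" if "0 \<le> y" for y :: real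
  proof -
    have "cosh y * exp (- (y\<^sup>2 / 2)) \<le> cosh 0 * exp (- (0\<^sup>2 / 2))"
    proof (rule DERIV_nonpos_imp_nonincreasing[OF that])
      fix t :: real assume t: "0 \<le> t" "t \<le> y"
      have "(sinh t - t * cosh t) * exp (- (t\<^sup>2 / 2)) \<le> 0"
        using sinh_le[OF t(1)] by (intro mult_nonpos_nonneg) auto
      then show "\<exists>D. ((\<lambda>y. cosh y * exp (- (y\<^sup>2 / 2))) has_real_derivative D) (at t) \<and> D \<le> 0"
        by (intro exI[of _ "(sinh t - t * cosh t) * exp (- (t\<^sup>2 / 2))"])
           (auto intro!: derivative_eq_intros simp: algebra_simps)
    qed
    then show ?thesis by simp
  qed
  show ?thesis using nn[of "\<bar>x\<bar>"] by (simp add: exp_minus field_simps)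
qed

text \<open>The exponential moment of a sum of independent random signs factorises into hyperbolic cosines.\<close>

lemma sum_signs_exp_le:
  fixes b :: "'k \<Rightarrow> real"
  assumes K: "finite K"
  shows "(\<Sum>\<theta>\<in>PiE K (\<lambda>_. {-1, 1::real}). exp (\<Sum>k\<in>K. b k * \<theta> k)) \<le> 2 ^ card K * exp ((\<Sum>k\<in>K. (b k)\<^sup>2) / 2)"
proof -
  have "(\<Sum>\<theta>\<in>PiE K (\<lambda>_. {-1, 1::real}). exp (\<Sum>k\<in>K. b k * \<theta> k)) = (\<Sum>\<theta>\<in>PiE K (\<lambda>_. {-1, 1::real}). \<Prod>k\<in>K. exp (b k * \<theta> k))"
    using K by (simp add: exp_sum)
  also have "\<dots> = (\<Prod>k\<in>K. \<Sum>e\<in>{-1, 1::real}. exp (b k * e))"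
    using K by (intro prod_sum_PiE[symmetric]) auto
  also have "\<dots> = (\<Prod>k\<in>K. 2 * cosh (b k))"
    by (intro prod.cong refl) (simp add: cosh_field_def add.commute)
  also have "\<dots> \<le> (\<Prod>k\<in>K. 2 * exp ((b k)\<^sup>2 / 2))"
    using cosh_le_exp_half_square by (intro prod_mono) auto
  also have "\<dots> = 2 ^ card K * exp ((\<Sum>k\<in>K. (b k)\<^sup>2) / 2)"
    using K by (simp add: prod.distrib exp_sum sum_divide_distrib)
  finally show ?thesis .
qed

locale likelihood_base =
  fixes p0 :: "real ^ 'd::finite \<Rightarrow> real"
  assumes p0: "prob_density p0" and p0_pos: "\<And>x. 0 < p0 x"
begin

abbreviation "P0 \<equiv> density lborel (\<lambda>x. ennreal (p0 x))"

definition likelihood :: "(real ^ 'd \<Rightarrow> real) \<Rightarrow> nat \<Rightarrow> (nat \<Rightarrow> real ^ 'd) \<Rightarrow> real" where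
  "likelihood p m y = (\<Prod>j\<in>{1..m}. p (y j) / p0 (y j))"

lemma p0_measurable [measurable]: "p0 \<in> borel_measurable borel" and prob_P0: "prob_space P0"
  using p0 by (auto simp: prob_density_def)

lemma integral_P0:
  fixes g :: "real ^ 'd \<Rightarrow> real"
  assumes [measurable]: "g \<in> borel_measurable borel"
  shows "(\<integral>x. g x \<partial>P0) = (LINT x|lborel. p0 x * g x)"
    and "integrable P0 g \<longleftrightarrow> integrable lborel (\<lambda>x. p0 x * g x)"
  using p0_pos by (auto simp: integral_density integrable_density less_imp_le)

lemma density_P0:
  assumes p: "prob_density p"
  shows "density P0 (\<lambda>x. ennreal (p x / p0 x)) = density lborel (\<lambda>x. ennreal (p x))"
proof -
  have [measurable]: "p \<in> borel_measurable borel" using p by (simp add: prob_density_def)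
  have "density P0 (\<lambda>x. ennreal (p x / p0 x)) = density lborel (\<lambda>x. ennreal (p0 x) * ennreal (p x / p0 x))"
    by (rule density_density_eq) auto
  also have "(\<lambda>x. ennreal (p0 x) * ennreal (p x / p0 x)) = (\<lambda>x. ennreal (p x))"
  proof
    fix x
    show "ennreal (p0 x) * ennreal (p x / p0 x) = ennreal (p x)"
      using p0_pos[of x] p by (simp add: prob_density_def flip: ennreal_mult)
  qed
  finally show ?thesis .
qed

lemma PiM_density_likelihood:
  assumes p: "prob_density p"
  shows "(\<Pi>\<^sub>M j\<in>{1..m}. density lborel (\<lambda>x. ennreal (p x))) =
    density (\<Pi>\<^sub>M j\<in>{1..m}. P0) (\<lambda>y. ennreal (likelihood p m y))"
proof -
  have pm [measurable]: "p \<in> borel_measurable borel" and p_nn: "\<And>x. 0 \<le> p x" 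
    and pp: "prob_space (density lborel (\<lambda>x. ennreal (p x)))"
    using p by (auto simp: prob_density_def)
  interpret P: product_prob_space "\<lambda>_::nat. density lborel (\<lambda>x. ennreal (p x))" "{1..m}"
    by (rule product_prob_spaceI) (rule pp)
  interpret P0: product_prob_space "\<lambda>_::nat. P0" "{1..m}"
    by (rule product_prob_spaceI) (rule prob_P0)
  have meas: "(\<lambda>y. ennreal (likelihood p m y)) \<in> borel_measurable (\<Pi>\<^sub>M j\<in>{1..m}. P0)"
    unfolding likelihood_def by measurable
  have "density (\<Pi>\<^sub>M j\<in>{1..m}. P0) (\<lambda>y. ennreal (likelihood p m y)) = (\<Pi>\<^sub>M j\<in>{1..m}. density lborel (\<lambda>x. ennreal (p x)))"
  proof (rule P.PiM_eqI)
    show "finite {1..m}" by simp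
    show "sets (density (\<Pi>\<^sub>M j\<in>{1..m}. P0) (\<lambda>y. ennreal (likelihood p m y))) = sets (\<Pi>\<^sub>M j\<in>{1..m}. density lborel (\<lambda>x. ennreal (p x)))"
      by (simp cong: sets_PiM_cong)
    fix A assume "\<And>j. j \<in> {1..m} \<Longrightarrow> A j \<in> sets (density lborel (\<lambda>x. ennreal (p x)))"
    then have A: "A j \<in> sets borel" if "j \<in> {1..m}" for j using that by simp
    have box: "Pi\<^sub>E {1..m} A \<in> sets (\<Pi>\<^sub>M j\<in>{1..m}. P0)"
      using A by (intro sets_PiM_I_finite) auto
    let ?h = "\<lambda>j x. ennreal (p x / p0 x) * indicator (A j) x"
    have "emeasure (density (\<Pi>\<^sub>M j\<in>{1..m}. P0) (\<lambda>y. ennreal (likelihood p m y))) (Pi\<^sub>E {1..m} A) =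
       (\<integral>\<^sup>+y. ennreal (likelihood p m y) * indicator (Pi\<^sub>E {1..m} A) y \<partial>(\<Pi>\<^sub>M j\<in>{1..m}. P0))"
      by (rule emeasure_density[OF meas box])
    also have "\<dots> = (\<integral>\<^sup>+y. (\<Prod>j\<in>{1..m}. ?h j (y j)) \<partial>(\<Pi>\<^sub>M j\<in>{1..m}. P0))"
    proof (rule nn_integral_cong)
      fix y assume y: "y \<in> space (\<Pi>\<^sub>M j\<in>{1..m}. P0)"
      have ext: "y \<in> extensional {1..m}" using y by (auto simp: space_PiM PiE_def)
      have "indicator (Pi\<^sub>E {1..m} A) y = (\<Prod>j\<in>{1..m}. indicator (A j) (y j) :: ennreal)"
      proof (cases "y \<in> Pi\<^sub>E {1..m} A")
        case True
        then show ?thesis by (auto simp: PiE_def Pi_def intro!: prod.neutral[symmetric])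
      next
        case False
        then obtain j where "j \<in> {1..m}" "y j \<notin> A j" using ext by (auto simp: PiE_def Pi_def)
        then have "(\<Prod>j\<in>{1..m}. indicator (A j) (y j) :: ennreal) = 0"
          by (intro prod_zero bexI[of _ j]) auto
        then show ?thesis using False by simp
      qed
      moreover have "ennreal (likelihood p m y) = (\<Prod>j\<in>{1..m}. ennreal (p (y j) / p0 (y j)))"
        unfolding likelihood_def using p_nn p0_pos by (intro prod_ennreal[symmetric]) (simp add: less_imp_le)
      ultimately show "ennreal (likelihood p m y) * indicator (Pi\<^sub>E {1..m} A) y = (\<Prod>j\<in>{1..m}. ?h j (y j))"
        by (simp add: prod.distrib)
    qed
    also have "\<dots> = (\<Prod>j\<in>{1..m}. \<integral>\<^sup>+x. ?h j x \<partial>P0)"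
      using A by (intro P0.product_nn_integral_prod) auto
    also have "\<dots> = (\<Prod>j\<in>{1..m}. emeasure (density lborel (\<lambda>x. ennreal (p x))) (A j))"
    proof (rule prod.cong[OF refl])
      fix j assume j: "j \<in> {1..m}"
      show "(\<integral>\<^sup>+x. ?h j x \<partial>P0) = emeasure (density lborel (\<lambda>x. ennreal (p x))) (A j)"
        unfolding density_P0[OF p, symmetric] using A[OF j] by (subst emeasure_density) auto
    qed
    finally show "emeasure (density (\<Pi>\<^sub>M j\<in>{1..m}. P0) (\<lambda>y. ennreal (likelihood p m y))) (Pi\<^sub>E {1..m} A) =
      (\<Prod>j\<in>{1..m}. emeasure (density lborel (\<lambda>x. ennreal (p x))) (A j))" .
  qed
  then show ?thesis ..
qed

lemma likelihood_nonneg: "prob_density p \<Longrightarrow> 0 \<le> likelihood p m y"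
  unfolding likelihood_def using p0_pos by (intro prod_nonneg) (auto simp: prob_density_def less_imp_le)

lemma likelihood_measurable:
  assumes "prob_density p"
  shows "likelihood p m \<in> borel_measurable (\<Pi>\<^sub>M j\<in>{1..m}. P0)"
proof -
  have [measurable]: "p \<in> borel_measurable borel" using assms by (simp add: prob_density_def)
  show ?thesis unfolding likelihood_def by measurable
qed

text \<open>Only the second sample changes its law, so the likelihood ratio is a function of that sample alone.\<close>

lemma sample_law_likelihood:
  assumes p: "prob_density p"
  shows "sample_law p0 p n m = density (sample_law p0 p0 n m) (\<lambda>w. ennreal (likelihood p m (snd w)))"
proof -
  let ?X = "\<Pi>\<^sub>M i\<in>{1..n}. P0" and ?Y = "\<Pi>\<^sub>M j\<in>{1..m}. P0"
  interpret X: prob_space ?X by (rule prob_space_PiM) (rule prob_P0)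
  interpret Y: prob_space ?Y by (rule prob_space_PiM) (rule prob_P0)
  interpret D: prob_space "density ?Y (\<lambda>y. ennreal (likelihood p m y))"
    unfolding PiM_density_likelihood[OF p, symmetric]
    by (rule prob_space_PiM) (use p in \<open>simp add: prob_density_def\<close>)
  have "sample_law p0 p n m = density ?X (\<lambda>_. 1) \<Otimes>\<^sub>M density ?Y (\<lambda>y. ennreal (likelihood p m y))"
    unfolding sample_law_def PiM_density_likelihood[OF p] by (simp add: density_1)
  also have "\<dots> = density (?X \<Otimes>\<^sub>M ?Y) (\<lambda>(x, y). 1 * ennreal (likelihood p m y))"
    using likelihood_measurable[OF p] Y.sigma_finite_measure_axioms D.sigma_finite_measure_axioms
    by (intro pair_measure_density) auto
  finally show ?thesis unfolding sample_law_def by (simp add: case_prod_unfold)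
qed

lemma
  assumes p: "prob_density p" and q: "prob_density q"
    and int: "integrable lborel (\<lambda>x. p x * q x / p0 x)"
  shows likelihood_mult_integrable: "integrable (sample_law p0 p0 n m) (\<lambda>w. likelihood p m (snd w) * likelihood q m (snd w))"
    and likelihood_mult_integral: "(\<integral>w. likelihood p m (snd w) * likelihood q m (snd w) \<partial>sample_law p0 p0 n m)
       = (LINT x|lborel. p x * q x / p0 x) ^ m"
proof -
  let ?X = "\<Pi>\<^sub>M i\<in>{1..n}. P0" and ?Y = "\<Pi>\<^sub>M j\<in>{1..m}. P0"
  have [measurable]: "p \<in> borel_measurable borel" "q \<in> borel_measurable borel" using p q by (auto simp: prob_density_def)
  interpret X: prob_space ?X by (rule prob_space_PiM) (rule prob_P0)
  interpret P: product_prob_space "\<lambda>_::nat. P0" "{1..m}" by (rule product_prob_spaceI) (rule prob_P0)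
  interpret XY: pair_prob_space ?X ?Y ..
  define g where "g = (\<lambda>x. (p x / p0 x) * (q x / p0 x))"
  have [measurable]: "g \<in> borel_measurable borel" unfolding g_def by measurable
  have g: "p0 x * g x = p x * q x / p0 x" for x using p0_pos[of x] by (simp add: g_def)
  have gi: "integrable P0 g" and gI: "(\<integral>x. g x \<partial>P0) = (LINT x|lborel. p x * q x / p0 x)"
    using int integral_P0[of g] by (simp_all add: g)
  have eq: "likelihood p m y * likelihood q m y = (\<Prod>j\<in>{1..m}. g (y j))" for y
    unfolding likelihood_def g_def prod.distrib ..
  have i: "integrable ?Y (\<lambda>y. \<Prod>j\<in>{1..m}. g (y j))"
    using gi by (intro P.product_integrable_prod) auto
  have I: "(\<integral>y. (\<Prod>j\<in>{1..m}. g (y j)) \<partial>?Y) = (LINT x|lborel. p x * q x / p0 x) ^ m"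
    using gi by (subst P.product_integral_prod) (auto simp: gI)
  have sl: "sample_law p0 p0 n m = ?X \<Otimes>\<^sub>M ?Y" by (simp add: sample_law_def)
  have full: "integrable (?X \<Otimes>\<^sub>M ?Y) (\<lambda>(x, y). \<Prod>j\<in>{1..m}. g (y j))"
    using XY.integrable_mult_prod[OF X.integrable_const[of 1] i] by simp
  show "integrable (sample_law p0 p0 n m) (\<lambda>w. likelihood p m (snd w) * likelihood q m (snd w))"
    unfolding sl eq using full by (simp add: case_prod_unfold)
  have "(\<integral>w. likelihood p m (snd w) * likelihood q m (snd w) \<partial>sample_law p0 p0 n m) = (\<integral>x. (\<integral>y. (\<Prod>j\<in>{1..m}. g (y j)) \<partial>?Y) \<partial>?X)"
    unfolding sl eq using XY.integral_fst[OF full] by (simp add: case_prod_unfold)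
  also have "\<dots> = (LINT x|lborel. p x * q x / p0 x) ^ m"
    unfolding I by (simp add: X.prob_space del: One_nat_def)
  finally show "(\<integral>w. likelihood p m (snd w) * likelihood q m (snd w) \<partial>sample_law p0 p0 n m)
       = (LINT x|lborel. p x * q x / p0 x) ^ m" .
qed

text \<open>The second moment method of Le Cam. For the averaged likelihood ratio \<open>G\<close> and the indicator \<open>\<phi>\<close> of rejection,
  \<open>\<phi> G \<le> (t \<phi> + G\<^sup>2/t)/2\<close> bounds the average rejection probability by the level and by \<open>D\<close>, a bound on the
  second moment of \<open>G\<close>; some member of the mixture does not exceed the average.\<close>

lemma reject_prob_mixture_le:
  fixes P :: "'t \<Rightarrow> real ^ 'd \<Rightarrow> real" and D t :: real
  assumes T: "finite T" "T \<noteq> {}" and test: "is_test n m \<Phi>"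
    and P: "\<And>\<theta>. \<theta> \<in> T \<Longrightarrow> prob_density (P \<theta>)"
    and int: "\<And>\<theta> \<theta>'. \<theta> \<in> T \<Longrightarrow> \<theta>' \<in> T \<Longrightarrow> integrable lborel (\<lambda>x. P \<theta> x * P \<theta>' x / p0 x)"
    and chi: "\<And>\<theta>. \<theta> \<in> T \<Longrightarrow> (\<Sum>\<theta>'\<in>T. (LINT x|lborel. P \<theta> x * P \<theta>' x / p0 x) ^ m) \<le> real (card T) * D"
    and t: "t > 0"
  shows "\<exists>\<theta>\<in>T. reject_prob p0 (P \<theta>) n m \<Phi> \<le> (t * reject_prob p0 p0 n m \<Phi> + D / t) / 2"
proof -
  let ?S = "sample_law p0 p0 n m"
  let ?X = "\<Pi>\<^sub>M i\<in>{1..n}. P0" and ?Y = "\<Pi>\<^sub>M j\<in>{1..m}. P0"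
  interpret X: prob_space ?X by (rule prob_space_PiM) (rule prob_P0)
  interpret Y: prob_space ?Y by (rule prob_space_PiM) (rule prob_P0)
  interpret XY: pair_prob_space ?X ?Y ..
  interpret S: prob_space ?S unfolding sample_law_def by (rule XY.P.prob_space_axioms)
  define N where "N = real (card T)"
  have N: "N > 0" using T by (simp add: N_def card_gt_0_iff)
  define A where "A = {w \<in> space ?S. case_prod \<Phi> w}"
  have A: "A \<in> sets ?S"
  proof -
    have "case_prod \<Phi> \<in> measurable ?S (count_space UNIV)"
    proof -
      have "sets ?S = sets ((\<Pi>\<^sub>M i\<in>{1..n}. borel) \<Otimes>\<^sub>M (\<Pi>\<^sub>M j\<in>{1..m}. borel))"
        unfolding sample_law_def by (intro sets_pair_measure_cong sets_PiM_cong) auto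
      then show ?thesis using test unfolding is_test_def by (subst measurable_cong_sets) auto
    qed
    then have "case_prod \<Phi> -` {True} \<inter> space ?S \<in> sets ?S" by (rule measurable_sets) simp
    also have "case_prod \<Phi> -` {True} \<inter> space ?S = A" by (auto simp: A_def)
    finally show ?thesis .
  qed
  have LL: "integrable ?S (\<lambda>w. likelihood (P \<theta>) m (snd w) * likelihood (P \<theta>') m (snd w))" if "\<theta> \<in> T" "\<theta>' \<in> T" for \<theta> \<theta>'
    using that by (intro likelihood_mult_integrable P int)
  have Lm: "(\<lambda>w. likelihood (P \<theta>) m (snd w)) \<in> borel_measurable ?S" if "\<theta> \<in> T" for \<theta>
    unfolding sample_law_def by (rule measurable_compose[OF measurable_snd likelihood_measurable[OF P[OF that]]])
  have Li: "integrable ?S (\<lambda>w. likelihood (P \<theta>) m (snd w))" if "\<theta> \<in> T" for \<theta>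
  proof (rule Bochner_Integration.integrable_bound[OF _ Lm[OF that]])
    show "integrable ?S (\<lambda>w. 1 + likelihood (P \<theta>) m (snd w) * likelihood (P \<theta>) m (snd w))"
      using LL[OF that that] by simp
    (* square integrability of the likelihood ratio gives integrability *)
  have "l \<le> 1 + l * l" if "0 \<le> l" for l :: real
    proof -
      have "0 \<le> (l - 1)\<^sup>2" by simp
      then show ?thesis using that by (simp add: power2_eq_square algebra_simps)
    qed
    then show "AE w in ?S. norm (likelihood (P \<theta>) m (snd w)) \<le> norm (1 + likelihood (P \<theta>) m (snd w) * likelihood (P \<theta>) m (snd w))"
      using likelihood_nonneg[OF P[OF that], of m] by (intro AE_I2) auto
  qed
  have rej: "reject_prob p0 (P \<theta>) n m \<Phi> = (\<integral>w. indicator A w * likelihood (P \<theta>) m (snd w) \<partial>?S)" if "\<theta> \<in> T" for \<theta>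
  proof -
    let ?D = "density ?S (\<lambda>w. ennreal (likelihood (P \<theta>) m (snd w)))"
    have "reject_prob p0 (P \<theta>) n m \<Phi> = measure ?D A"
      unfolding reject_prob_def sample_law_likelihood[OF P[OF that]] A_def by (simp add: case_prod_unfold)
    also have "\<dots> = (\<integral>w. indicator A w \<partial>?D)" using A by simp
    also have "\<dots> = (\<integral>w. likelihood (P \<theta>) m (snd w) * indicator A w \<partial>?S)"
      using A Lm[OF that] likelihood_nonneg[OF P[OF that]] by (subst integral_density) auto
    finally show ?thesis by (simp add: mult.commute)
  qed
  have rej0: "reject_prob p0 p0 n m \<Phi> = (\<integral>w. indicator A w \<partial>?S)"
    using A by (simp add: reject_prob_def A_def case_prod_unfold)
  define G :: "(nat \<Rightarrow> real ^ 'd) \<times> (nat \<Rightarrow> real ^ 'd) \<Rightarrow> real" where "G = (\<lambda>w. (\<Sum>\<theta>\<in>T. likelihood (P \<theta>) m (snd w)) / N)"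
  have iA: "integrable ?S (indicator A :: _ \<Rightarrow> real)"
    by (rule S.integrable_bounded_on[of _ 1]) (use A in \<open>auto simp: indicator_def\<close>)
  have iAL: "integrable ?S (\<lambda>w. indicator A w * likelihood (P \<theta>) m (snd w))" if "\<theta> \<in> T" for \<theta>
    using integrable_mult_indicator[OF A Li[OF that]] by simp
  have iAG: "integrable ?S (\<lambda>w. indicator A w * G w)"
    using integrable_mult_indicator[OF A, of G] Li unfolding G_def by simp
  have G2: "(G w)\<^sup>2 = (\<Sum>\<theta>\<in>T. \<Sum>\<theta>'\<in>T. likelihood (P \<theta>) m (snd w) * likelihood (P \<theta>') m (snd w)) / N\<^sup>2" for w
    by (simp add: G_def power_divide power2_eq_square sum_product)
  have iG2: "integrable ?S (\<lambda>w. (G w)\<^sup>2)"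
    unfolding G2 by (intro integrable_divide Bochner_Integration.integrable_sum LL) auto
  have "(\<integral>w. (G w)\<^sup>2 \<partial>?S) = (\<Sum>\<theta>\<in>T. \<Sum>\<theta>'\<in>T. (LINT x|lborel. P \<theta> x * P \<theta>' x / p0 x) ^ m) / N\<^sup>2"
    unfolding G2
    by (simp add: Bochner_Integration.integral_sum LL likelihood_mult_integral P int Bochner_Integration.integrable_sum)
  also have "\<dots> \<le> (\<Sum>\<theta>\<in>T. N * D) / N\<^sup>2"
    using chi unfolding N_def by (intro divide_right_mono sum_mono) auto
  also have "\<dots> = D" using N by (simp add: N_def power2_eq_square)
  finally have G2_le: "(\<integral>w. (G w)\<^sup>2 \<partial>?S) \<le> D" .
  have "(\<Sum>\<theta>\<in>T. reject_prob p0 (P \<theta>) n m \<Phi>) / N = (\<integral>w. indicator A w * G w \<partial>?S)"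
    using iAL by (simp add: rej G_def sum_distrib_left Bochner_Integration.integral_sum)
  also have "\<dots> \<le> (\<integral>w. (t * indicator A w + (G w)\<^sup>2 / t) / 2 \<partial>?S)"
  proof (rule integral_mono[OF iAG])
    show "integrable ?S (\<lambda>w. (t * indicator A w + (G w)\<^sup>2 / t) / 2)"
      using iA iG2 by simp
    fix w
    have "0 \<le> (t * indicator A w - G w)\<^sup>2" by simp
    then have "2 * (t * indicator A w * G w) \<le> (t * indicator A w)\<^sup>2 + (G w)\<^sup>2"
      by (simp add: power2_diff)
    then have "2 * (t * indicator A w * G w) / t \<le> ((t * indicator A w)\<^sup>2 + (G w)\<^sup>2) / t"
      using t by (intro divide_right_mono) auto
    then show "indicator A w * G w \<le> (t * indicator A w + (G w)\<^sup>2 / t) / 2"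
      using t by (cases "w \<in> A") (auto simp: add_divide_distrib power2_eq_square)
  qed
  also have "\<dots> = (t * reject_prob p0 p0 n m \<Phi> + (\<integral>w. (G w)\<^sup>2 \<partial>?S) / t) / 2"
    using iA iG2 by (simp add: rej0)
  also have "\<dots> \<le> (t * reject_prob p0 p0 n m \<Phi> + D / t) / 2"
    using G2_le t by (intro divide_right_mono add_left_mono) auto
  finally have avg: "(\<Sum>\<theta>\<in>T. reject_prob p0 (P \<theta>) n m \<Phi>) \<le> N * ((t * reject_prob p0 p0 n m \<Phi> + D / t) / 2)"
    using N by (simp add: field_simps)
  show ?thesis
  proof (rule ccontr)
    assume "\<not> ?thesis"
    then have "\<And>\<theta>. \<theta> \<in> T \<Longrightarrow> (t * reject_prob p0 p0 n m \<Phi> + D / t) / 2 < reject_prob p0 (P \<theta>) n m \<Phi>"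
      by (auto simp: not_le)
    then have "(\<Sum>\<theta>\<in>T. (t * reject_prob p0 p0 n m \<Phi> + D / t) / 2) < (\<Sum>\<theta>\<in>T. reject_prob p0 (P \<theta>) n m \<Phi>)"
      using T by (intro sum_strict_mono) auto
    then show False using avg by (simp add: N_def)
  qed
qed

end

section \<open>The lower bound\<close>

lemma prob_densityI:
  fixes p :: "real ^ 'd::finite \<Rightarrow> real"
  assumes int: "integrable lborel p" and nn: "\<And>x. 0 \<le> p x" and one: "(LINT x|lborel. p x) = 1"
  shows "prob_density p"
proof -
  have [measurable]: "p \<in> borel_measurable borel" using int by auto
  have "emeasure (density lborel (\<lambda>x. ennreal (p x))) UNIV = ennreal (LINT x|lborel. p x)"
    using int nn by (subst emeasure_density) (auto simp: nn_integral_eq_integral)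
  then show ?thesis using nn one by (auto simp: prob_density_def intro!: prob_spaceI)
qed

text \<open>Parametrised by the coefficient in the exponent instead of the variance, in line with the kernel; small \<open>b\<close> means a flat density.\<close>

definition gauss_density :: "real \<Rightarrow> real ^ 'd \<Rightarrow> real" where
  "gauss_density b x = (b / pi) powr (real CARD('d) / 2) * exp (- b * (norm x)\<^sup>2)"

lemma
  fixes x :: "real ^ 'd::finite"
  assumes b: "b > 0"
  shows gauss_density_pos: "0 < gauss_density b x"
    and gauss_density_integrable: "integrable lborel (gauss_density b :: real ^ 'd \<Rightarrow> real)"
    and gauss_density_integral: "(LINT x|lborel. gauss_density b (x :: real ^ 'd)) = 1"
proof -
  show "0 < gauss_density b x" using b by (simp add: gauss_density_def)
  show "integrable lborel (gauss_density b :: real ^ 'd \<Rightarrow> real)"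
    unfolding gauss_density_def[abs_def] by (intro integrable_mult_right integrable_gauss_vec b)
  have "(LINT x|lborel. gauss_density b (x :: real ^ 'd)) = (b / pi) powr (real CARD('d) / 2) * (pi / b) powr (real CARD('d) / 2)"
    unfolding gauss_density_def using integral_gauss_vec[OF b, where 'd='d] by simp
  also have "\<dots> = 1" using b by (simp flip: powr_mult)
  finally show "(LINT x|lborel. gauss_density b (x :: real ^ 'd)) = 1" .
qed

lemma fourier_gauss_density:
  fixes \<omega> :: "real ^ 'd::finite"
  assumes b: "b > 0"
  shows "fourier (gauss_density b) \<omega> = complex_of_real ((2 * pi) powr (- real CARD('d) / 2) * exp (- (norm \<omega>)\<^sup>2 / (4 * b)))"
proof -
  let ?c = "(b / pi) powr (real CARD('d) / 2)"
  have "complex_of_real (gauss_density b x) * exp (- (\<i> * complex_of_real (x \<bullet> \<omega>))) =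
     complex_of_real ?c * (complex_of_real (exp (- b * (norm x)\<^sup>2)) * cis ((- \<omega>) \<bullet> x))" for x
    by (simp add: gauss_density_def cis_conv_exp inner_commute)
  then have "fourier (gauss_density b) \<omega> = complex_of_real ((2 * pi) powr (- real CARD('d) / 2)) *
     (complex_of_real ?c * complex_of_real ((pi / b) powr (real CARD('d) / 2) * exp (- (norm (- \<omega>))\<^sup>2 / (4 * b))))"
    unfolding fourier_def integral_gauss_cis_vec[OF b, of "- \<omega>", symmetric] by simp
  also have "?c * (pi / b) powr (real CARD('d) / 2) = 1" using b by (simp flip: powr_mult)
  then have "complex_of_real ?c * complex_of_real ((pi / b) powr (real CARD('d) / 2) * exp (- (norm (- \<omega>))\<^sup>2 / (4 * b)))
      = complex_of_real (exp (- (norm \<omega>)\<^sup>2 / (4 * b)))"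
    unfolding of_real_mult[symmetric] mult.assoc[symmetric] by simp
  finally show ?thesis by simp
qed

text \<open>The transform of a flat Gaussian is concentrated near the origin. The weight is absorbed by \<open>y \<le> exp y\<close> at
  \<open>y = (1 + |\<omega>|\<^sup>2)/2s\<close>, which costs half of \<open>|\<omega>|\<^sup>2\<close> in the exponent.\<close>

lemma exists_gauss_density_small_sobolev:
  assumes s: "s > 0" and e: "e > 0"
  shows "\<exists>b>0. integrable lborel (sobolev_integrand s (gauss_density b :: real ^ 'd::finite \<Rightarrow> real)) \<and>
     (LINT \<omega>|lborel. sobolev_integrand s (gauss_density b :: real ^ 'd \<Rightarrow> real) \<omega>) \<le> e"
proof -
  define d where "d = real CARD('d)"
  have d: "d > 0" by (simp add: d_def)
  define C where "C = (2 * s) powr s * exp (1 / 2) * (2 * pi) powr (- d)"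
  have "(\<lambda>n. C * (pi / real n) powr (d / 2)) \<longlonglongrightarrow> 0"
    using d by real_asymp
  then have "eventually (\<lambda>n. C * (pi / real n) powr (d / 2) < e) sequentially"
    using e by (intro order_tendstoD) auto
  then have "eventually (\<lambda>n. C * (pi / real n) powr (d / 2) < e \<and> n > 0) sequentially"
    using eventually_gt_at_top[of 0] by eventually_elim auto
  then obtain n where n: "C * (pi / real n) powr (d / 2) < e" "n > 0"
    using eventually_happens[of _ sequentially] by auto
  (* chosen such that 1 / (2 b) - 1 / 2 = n is the remaining exponent *)
  define b where "b = 1 / (2 * real n + 1)"
  have b: "b > 0" by (simp add: b_def add_pos_pos)
  have ib: "1 / (2 * b) = real n + 1 / 2" by (simp add: b_def)
  let ?f = "gauss_density b :: real ^ 'd \<Rightarrow> real"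
  have le: "sobolev_integrand s ?f \<omega> \<le> C * exp (- real n * (norm \<omega>)\<^sup>2)" for \<omega>
  proof -
    define t where "t = (norm \<omega>)\<^sup>2"
    have t: "0 \<le> t" by (simp add: t_def)
    have "(1 + t) powr s = (2 * s) powr s * ((1 + t) / (2 * s)) powr s"
      using s t by (simp add: powr_divide)
    also have "((1 + t) / (2 * s)) powr s \<le> exp ((1 + t) / (2 * s)) powr s"
    proof (rule powr_mono2)
      show "(1 + t) / (2 * s) \<le> exp ((1 + t) / (2 * s))"
        using exp_ge_add_one_self[of "(1 + t) / (2 * s)"] by linarith
    qed (use s t in auto)
    also have "exp ((1 + t) / (2 * s)) powr s = exp (1 / 2 + t / 2)"
      using s by (simp add: powr_def field_simps)
    finally have 1: "(1 + t) powr s \<le> (2 * s) powr s * exp (1 / 2 + t / 2)" by (simp add: mult_left_mono)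
    have c: "cmod (fourier ?f \<omega>) = (2 * pi) powr (- d / 2) * exp (- t / (4 * b))"
      unfolding fourier_gauss_density[OF b] norm_of_real by (simp add: d_def t_def)
    have p2: "((2 * pi) powr (- d / 2))\<^sup>2 = (2 * pi) powr (- d)" by (simp add: powr_power)
    have e2: "(exp (- t / (4 * b)))\<^sup>2 = exp (- t * (1 / (2 * b)))"
      by (simp add: power2_eq_square flip: exp_add)
    have "sobolev_integrand s ?f \<omega> = (1 + t) powr s * ((2 * pi) powr (- d) * exp (- t * (real n + 1 / 2)))"
      unfolding sobolev_integrand_def c power_mult_distrib p2 e2 ib t_def[symmetric] ..
    also have "\<dots> \<le> (2 * s) powr s * exp (1 / 2 + t / 2) * ((2 * pi) powr (- d) * exp (- t * (real n + 1 / 2)))"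
      by (intro mult_right_mono 1) auto
    also have "\<dots> = (2 * s) powr s * (2 * pi) powr (- d) * (exp (1 / 2 + t / 2) * exp (- t * (real n + 1 / 2)))"
      by (simp only: mult_ac)
    also have "exp (1 / 2 + t / 2) * exp (- t * (real n + 1 / 2)) = exp (1 / 2) * exp (- real n * t)"
      by (simp add: algebra_simps flip: exp_add)
    also have "(2 * s) powr s * (2 * pi) powr (- d) * (exp (1 / 2) * exp (- real n * t)) = C * exp (- real n * t)"
      by (simp add: C_def mult_ac)
    finally show ?thesis by (simp add: t_def)
  qed
  have n0: "real n > 0" using n by simp
  have int: "integrable lborel (\<lambda>\<omega>::real^'d. C * exp (- real n * (norm \<omega>)\<^sup>2))"
    by (intro integrable_mult_right integrable_gauss_vec n0)
  have m [measurable]: "?f \<in> borel_measurable borel" using gauss_density_integrable[OF b] by auto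
  have 1: "integrable lborel (sobolev_integrand s ?f)"
  proof (rule Bochner_Integration.integrable_bound[OF int])
    show "AE \<omega> in lborel. norm (sobolev_integrand s ?f \<omega>) \<le> norm (C * exp (- real n * (norm \<omega>)\<^sup>2))"
      using order_trans[OF le abs_ge_self] by (intro AE_I2) (auto simp: sobolev_integrand_nonneg)
  qed measurable
  have "(LINT \<omega>|lborel. sobolev_integrand s ?f \<omega>) \<le> (LINT \<omega>|lborel. C * exp (- real n * (norm (\<omega>::real^'d))\<^sup>2))"
    by (rule integral_mono[OF 1 int le])
  also have "\<dots> = C * (LINT \<omega>|lborel. exp (- real n * (norm (\<omega>::real^'d))\<^sup>2))" by (rule integral_mult_right_zero)
  also have "\<dots> = C * (pi / real n) powr (d / 2)" unfolding integral_gauss_vec[OF n0] d_def ..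
  finally have "(LINT \<omega>|lborel. sobolev_integrand s ?f \<omega>) \<le> e" using n by linarith
  then show ?thesis using b 1 by blast
qed

lemma gauss_density_lower_bound:
  fixes x :: "real ^ 'd::finite"
  assumes b: "b > 0" and x: "\<And>i. 0 < x $ i" "\<And>i. x $ i < 1"
  shows "(b / pi) powr (real CARD('d) / 2) * exp (- b * real CARD('d)) \<le> gauss_density b x"
proof -
  have "(norm x)\<^sup>2 \<le> (\<Sum>i\<in>(UNIV::'d set). 1)"
    unfolding norm_sq_eq_sum_sq using x by (intro sum_mono) (simp add: power_le_one less_imp_le)
  then show ?thesis using b unfolding gauss_density_def by (intro mult_left_mono) auto
qed

lemma gauss_density_isCont: "isCont (gauss_density b :: real ^ 'd::finite \<Rightarrow> real) x"
  unfolding gauss_density_def[abs_def] by (intro continuous_intros)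

lemma prob_density_gauss_density:
  assumes b: "b > 0"
  shows "prob_density (gauss_density b :: real ^ 'd::finite \<Rightarrow> real)"
  by (rule prob_densityI[OF gauss_density_integrable[OF b] less_imp_le[OF gauss_density_pos[OF b]] gauss_density_integral[OF b]])

lemma gauss_density_in_ball:
  assumes b: "b > 0" and M: "M > 0"
    and int: "integrable lborel (sobolev_integrand s (gauss_density b :: real ^ 'd::finite \<Rightarrow> real))"
    and le: "(LINT \<omega>|lborel. sobolev_integrand s (gauss_density b :: real ^ 'd \<Rightarrow> real) \<omega>) \<le> M\<^sup>2 / 4"
  shows "(gauss_density b :: real ^ 'd \<Rightarrow> real) \<in> sobolev_ball s M"
proof -
  have "(LINT \<omega>|lborel. sobolev_integrand s (gauss_density b :: real ^ 'd \<Rightarrow> real) \<omega>) \<le> M\<^sup>2"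
    using le zero_le_power2[of M] by linarith
  then have "sobolev_norm s (gauss_density b :: real ^ 'd \<Rightarrow> real) \<le> M"
    unfolding sobolev_norm_def using M by (intro real_le_lsqrt) auto
  then show ?thesis
    unfolding sobolev_ball_def sobolev_def using gauss_density_integrable[OF b] int gauss_density_isCont by auto
qed

lemma perturbation_isCont:
  fixes x :: "real ^ 'd::finite"
  assumes "edge_poly dvd P"
  shows "isCont (perturbation P L c) x"
proof -
  have b: "isCont (bump1 P) t" for t
    using bump1_continuous[OF assms] by (simp add: continuous_on_eq_continuous_at)
  have "isCont (\<lambda>x::real^'d. bump1 P (real L * x $ i - real (k i))) x" for i k
    by (rule isCont_o2[OF _ b]) (intro continuous_intros)
  then show ?thesis unfolding perturbation_def[abs_def] cell_bump_def
    by (intro continuous_sum continuous_mult continuous_const continuous_prod)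
qed

lemma perturbation_integral:
  fixes c :: "('d::finite \<Rightarrow> nat) \<Rightarrow> real"
  assumes "L > 0"
  shows "(LINT x|lborel. perturbation P L c x) = (\<Sum>k\<in>cells L. c k) * ((LINT t|lborel. bump1 P t) / real L) ^ CARD('d)"
  unfolding perturbation_def using assms
  by (subst Bochner_Integration.integral_sum)
     (auto intro!: integrable_mult_right cell_bump_integrable simp: cell_bump_integral sum_distrib_right)

lemma perturbation_abs_le:
  fixes x :: "real ^ 'd::finite"
  assumes P: "edge_poly dvd P" and L: "L > 0" and B: "\<And>t. \<bar>bump1 P t\<bar> \<le> B" and c: "\<And>k. \<bar>c k\<bar> = a"
    and nz: "perturbation P L c x \<noteq> 0"
  shows "\<bar>perturbation P L c x\<bar> \<le> a * B ^ CARD('d)" "0 < x $ i" "x $ i < 1"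
proof -
  obtain k0 where k0: "k0 \<in> cells L" "perturbation P L c x = c k0 * cell_bump P L k0 x" "cell_bump P L k0 x \<noteq> 0"
    using sum_cell_bump_cases[OF P, of L x] nz unfolding perturbation_def by (metis (no_types, lifting) mult_zero_right sum.neutral)
  have "\<bar>cell_bump P L k0 x\<bar> \<le> (\<Prod>i\<in>(UNIV::'d set). B)"
    unfolding cell_bump_def abs_prod by (intro prod_mono) (auto intro: B)
  then have "\<bar>c k0\<bar> * \<bar>cell_bump P L k0 x\<bar> \<le> a * B ^ CARD('d)"
    unfolding c by (intro mult_left_mono) (auto simp: c[of k0, symmetric])
  then show "\<bar>perturbation P L c x\<bar> \<le> a * B ^ CARD('d)" by (simp add: k0(2) abs_mult)
  show "0 < x $ i" "x $ i < 1" using cell_bump_support[OF P k0(1) L k0(3)] by auto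
qed

text \<open>The hypotheses collect what the choice of \<open>L\<close> and \<open>a\<close> has to achieve: \<open>small\<close> keeps the densities positive, \<open>sob\<close>
  keeps them in the ball, \<open>sep\<close> separates them from \<open>p\<^sub>0\<close>, and \<open>D\<close> bounds the second moment of the averaged likelihood ratio.
  Since the bumps integrate to zero and are disjoint, \<open>\<integral> p\<^sub>\<theta> p\<^bsub>\<theta>'\<^esub> / p\<^sub>0\<close> is one plus a sum over the cells of the
  products of signs with weights \<open>a\<^sup>2 w k\<close>.\<close>

lemma hom_power_le_mixture:
  fixes P :: "real poly" and \<Phi> :: "'d::finite two_sample_test"
  assumes P: "P = pderiv (edge_poly ^ (2 * r + 2))" and s: "s > 0" "s \<le> 2 * real r" and b: "b > 0"
    and B: "\<And>t. \<bar>bump1 P t\<bar> \<le> B"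
    and L: "L > 0" and a: "a > 0" and t: "t > 0" and M: "M > 0" and test: "is_test n m \<Phi>"
    and p0_int: "integrable lborel (sobolev_integrand s (gauss_density b :: real ^ 'd \<Rightarrow> real))"
    and p0_le: "(LINT \<omega>|lborel. sobolev_integrand s (gauss_density b :: real ^ 'd \<Rightarrow> real) \<omega>) \<le> M\<^sup>2 / 4"
    and cp: "cp = (b / pi) powr (real CARD('d) / 2) * exp (- b * real CARD('d))"
    and I2: "I2 = (LINT t|lborel. (bump1 P t)\<^sup>2) ^ CARD('d)"
    and small: "a * B ^ CARD('d) \<le> cp"
    and sob: "real L powr (2 * s) * (a\<^sup>2 * (LINT t|lborel. (bump1 ((one_minus_D2 ^^ r) P) t)\<^sup>2) ^ CARD('d)) \<le> M\<^sup>2 / 4"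
    and sep: "0 \<le> \<Delta>" "\<Delta>\<^sup>2 \<le> a\<^sup>2 * I2"
    and D: "exp ((real m)\<^sup>2 * (a\<^sup>2 * I2 / cp)\<^sup>2 / real L ^ CARD('d) / 2) \<le> D"
  shows "hom_power s M \<Delta> n m \<Phi> \<le> (t * reject_prob (gauss_density b) (gauss_density b) n m \<Phi> + D / t) / 2"
proof -
  let ?p0 = "gauss_density b :: real ^ 'd \<Rightarrow> real"
  have p0d: "prob_density ?p0" by (rule prob_density_gauss_density[OF b])
  interpret likelihood_base ?p0 by unfold_locales (auto intro: p0d gauss_density_pos[OF b])
  have p0i: "integrable lborel ?p0" by (rule gauss_density_integrable[OF b])
  have cp0: "cp > 0" using b by (simp add: cp)
  have W: "edge_poly ^ (2 * r + 1) dvd P" unfolding P by (rule edge_power_dvd_pderiv) simp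
  have W1: "edge_poly dvd P" by (rule dvd_trans[OF dvd_power W]) simp
  have WW: "edge_poly dvd P * P" using W1 by simp
  have P0: "(LINT t|lborel. bump1 P t) = 0"
    unfolding P bump1_integral_pderiv by (simp add: edge_poly_def)
  (* sign vectors are extensional on the cells; the conditional gives every cell index a sign *)
  define sg where "sg = (\<lambda>(\<theta> :: ('d \<Rightarrow> nat) \<Rightarrow> real) k. a * (if \<theta> k = 1 then 1 else - 1))"
  have sg2: "(sg \<theta> k)\<^sup>2 = a\<^sup>2" and sga: "\<bar>sg \<theta> k\<bar> = a" for \<theta> k using a by (auto simp: sg_def)
  define G where "G = (\<lambda>\<theta>. perturbation P L (sg \<theta>))"
  define Q where "Q = (\<lambda>\<theta> x. ?p0 x + 1 * G \<theta> x)"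
  have Gi: "integrable lborel (G \<theta>)" for \<theta> unfolding G_def by (rule perturbation_integrable[OF L])
  have G0: "(LINT x|lborel. G \<theta> x) = 0" for \<theta>
    unfolding G_def perturbation_integral[OF L] P0 by simp
  have Qi: "integrable lborel (Q \<theta>)" for \<theta> unfolding Q_def using p0i Gi by simp
  have Q_nn: "0 \<le> Q \<theta> x" for \<theta> x
  proof (cases "G \<theta> x = 0")
    case False
    note A = perturbation_abs_le[OF W1 L B sga False[unfolded G_def]]
    have "cp \<le> ?p0 x" unfolding cp by (rule gauss_density_lower_bound[OF b A(2,3)])
    then show ?thesis using A(1) small unfolding Q_def G_def by linarith
  qed (use gauss_density_pos[OF b, of x] in \<open>simp add: Q_def\<close>)
  have Qd: "prob_density (Q \<theta>)" for \<theta>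
  proof (rule prob_densityI[OF Qi Q_nn])
    show "(LINT x|lborel. Q \<theta> x) = 1" unfolding Q_def using p0i Gi G0 gauss_density_integral[OF b, where 'd='d] by simp
  qed
  have p0_ball: "?p0 \<in> sobolev_ball s M" by (rule gauss_density_in_ball[OF b M p0_int p0_le])
  have Q_ball: "Q \<theta> \<in> sobolev_ball s M" for \<theta>
  proof -
    have Ge: "perturbation P L (sg \<theta>) = G \<theta>" by (simp add: G_def)
    note S = perturbation_sobolev[where c="sg \<theta>", OF W L sg2 s, unfolded Ge]
    have i: "integrable lborel (sobolev_integrand s (Q \<theta>))"
      unfolding Q_def by (rule integrable_sobolev_integrand_add[OF p0i p0_int Gi S(1)])
    have "(LINT \<omega>|lborel. sobolev_integrand s (Q \<theta>) \<omega>) \<le> 2 * (LINT \<omega>|lborel. sobolev_integrand s ?p0 \<omega>) + 2 * 1\<^sup>2 * (LINT \<omega>|lborel. sobolev_integrand s (G \<theta>) \<omega>)"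
      unfolding Q_def by (rule integral_sobolev_integrand_add[OF p0i p0_int Gi S(1)])
    also have "\<dots> \<le> M\<^sup>2" using S(2) sob p0_le by simp
    finally have "sobolev_norm s (Q \<theta>) \<le> M" unfolding sobolev_norm_def using M by (intro real_le_lsqrt) auto
    moreover have "isCont (Q \<theta>) x" for x
      unfolding Q_def G_def using perturbation_isCont[OF W1] gauss_density_isCont by (intro continuous_intros)
    ultimately show ?thesis unfolding sobolev_ball_def sobolev_def using Qi i by auto
  qed
  have alt: "(?p0, Q \<theta>) \<in> hom_alternative s M \<Delta>" for \<theta>
  proof -
    have "(LINT x|lborel. (?p0 x - Q \<theta> x)\<^sup>2) = (LINT x|lborel. (G \<theta> x)\<^sup>2)"
      by (intro Bochner_Integration.integral_cong) (auto simp: Q_def)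
    also have "\<dots> = a\<^sup>2 * I2" unfolding G_def perturbation_sq_integral(2)[OF W1 L sg2] I2 ..
    finally have "l2_norm (\<lambda>x. ?p0 x - Q \<theta> x) = sqrt (a\<^sup>2 * I2)" by (simp add: l2_norm_def)
    then have "\<Delta> \<le> l2_norm (\<lambda>x. ?p0 x - Q \<theta> x)" using sep by (simp add: real_le_rsqrt)
    then show ?thesis using p0_ball Q_ball p0d Qd by (auto simp: hom_alternative_def)
  qed
  define w where "w = (\<lambda>k :: 'd \<Rightarrow> nat. LINT x|lborel. cell_bump (P * P) L k x / ?p0 x)"
  have [measurable]: "?p0 \<in> borel_measurable borel" using p0i by auto
  have cb_le: "\<bar>cell_bump (P * P) L k x / ?p0 x\<bar> \<le> cell_bump (P * P) L k x / cp" if k: "k \<in> cells L" for k x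
  proof (cases "cell_bump (P * P) L k x = 0")
    case False
    have "cp \<le> ?p0 x" unfolding cp using cell_bump_support[OF WW k L False] by (intro gauss_density_lower_bound b) auto
    moreover have "0 \<le> cell_bump (P * P) L k x" unfolding cell_bump_sq[symmetric] by simp
    ultimately show ?thesis using cp0 by (auto simp: abs_div intro!: divide_left_mono mult_pos_pos)
  qed simp
  have cb_int: "integrable lborel (\<lambda>x. cell_bump (P * P) L k x / ?p0 x)" if k: "k \<in> cells L" for k
  proof (rule Bochner_Integration.integrable_bound)
    show "integrable lborel (\<lambda>x. cell_bump (P * P) L k x / cp)"
      by (intro integrable_divide cell_bump_integrable L)
    have [measurable]: "cell_bump (P * P) L k \<in> borel_measurable borel" using cell_bump_integrable[OF L, of "P * P" k] by auto
    show "(\<lambda>x. cell_bump (P * P) L k x / ?p0 x) \<in> borel_measurable lborel" by measurable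
    show "AE x in lborel. norm (cell_bump (P * P) L k x / ?p0 x) \<le> norm (cell_bump (P * P) L k x / cp)"
      using order_trans[OF cb_le[OF k] abs_ge_self] by (intro AE_I2) (simp only: real_norm_def)
  qed
  have w_le: "(w k)\<^sup>2 \<le> (I2 / real L ^ CARD('d) / cp)\<^sup>2" if k: "k \<in> cells L" for k
  proof -
    have "\<bar>w k\<bar> \<le> (LINT x|lborel. \<bar>cell_bump (P * P) L k x / ?p0 x\<bar>)" unfolding w_def by (rule integral_abs_bound)
    also have "\<dots> \<le> (LINT x|lborel. cell_bump (P * P) L k x / cp)"
      by (intro integral_mono integrable_abs cb_int k cb_le integrable_divide cell_bump_integrable L)
    also have "\<dots> = I2 / real L ^ CARD('d) / cp"
      unfolding I2 bump1_sq by (simp add: cell_bump_integral[OF L] power_divide)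
    finally show ?thesis using power_mono[of "\<bar>w k\<bar>" _ 2] by simp
  qed
  have QQ: "Q \<theta> x * Q \<theta>' x / ?p0 x = ?p0 x + G \<theta> x + G \<theta>' x + (\<Sum>k\<in>cells L. sg \<theta> k * sg \<theta>' k * (cell_bump (P * P) L k x / ?p0 x))" for \<theta> \<theta>' x
  proof -
    have "G \<theta> x * G \<theta>' x = (\<Sum>k\<in>cells L. sg \<theta> k * sg \<theta>' k * cell_bump (P * P) L k x)"
      unfolding G_def perturbation_mult[OF W1] unfolding perturbation_def ..
    then have "G \<theta> x * G \<theta>' x / ?p0 x = (\<Sum>k\<in>cells L. sg \<theta> k * sg \<theta>' k * (cell_bump (P * P) L k x / ?p0 x))"
      by (simp add: sum_divide_distrib)
    moreover have "Q \<theta> x * Q \<theta>' x / ?p0 x = ?p0 x + G \<theta> x + G \<theta>' x + G \<theta> x * G \<theta>' x / ?p0 x"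
      using gauss_density_pos[OF b, of x] by (simp add: Q_def field_simps)
    ultimately show ?thesis by simp
  qed
  have sumi: "integrable lborel (\<lambda>x. \<Sum>k\<in>cells L. sg \<theta> k * sg \<theta>' k * (cell_bump (P * P) L k x / ?p0 x))" for \<theta> \<theta>'
    by (rule Bochner_Integration.integrable_sum) (intro integrable_mult_right cb_int)
  have QQi: "integrable lborel (\<lambda>x. Q \<theta> x * Q \<theta>' x / ?p0 x)" for \<theta> \<theta>'
    unfolding QQ by (intro Bochner_Integration.integrable_add p0i Gi sumi)
  have QQI: "(LINT x|lborel. Q \<theta> x * Q \<theta>' x / ?p0 x) = 1 + (\<Sum>k\<in>cells L. sg \<theta> k * sg \<theta>' k * w k)" for \<theta> \<theta>'
  proof -
    have "(LINT x|lborel. (\<Sum>k\<in>cells L. sg \<theta> k * sg \<theta>' k * (cell_bump (P * P) L k x / ?p0 x))) = (\<Sum>k\<in>cells L. sg \<theta> k * sg \<theta>' k * w k)"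
      unfolding w_def integral_mult_right_zero[symmetric]
      by (rule Bochner_Integration.integral_sum) (intro integrable_mult_right cb_int)
    then show ?thesis
      unfolding QQ using p0i Gi[of \<theta>] Gi[of \<theta>'] sumi[of \<theta> \<theta>'] G0 gauss_density_integral[OF b, where 'd='d] by simp
  qed
  define T where "T = (PiE (cells L) (\<lambda>_. {-1, 1}) :: (('d \<Rightarrow> nat) \<Rightarrow> real) set)"
  have finT: "finite T" unfolding T_def using finite_cells by (intro finite_PiE) auto
  have cardT: "card T = 2 ^ card (cells L :: ('d \<Rightarrow> nat) set)"
    unfolding T_def by (subst card_PiE[OF finite_cells]) (simp add: numeral_2_eq_2)
  have T0: "T \<noteq> {}" using cardT by (metis card.empty power_not_zero zero_neq_numeral)
  have chi: "(\<Sum>\<theta>'\<in>T. (LINT x|lborel. Q \<theta> x * Q \<theta>' x / ?p0 x) ^ m) \<le> real (card T) * D" for \<theta>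
  proof -
    define bb where "bb = (\<lambda>k. real m * (sg \<theta> k * a * w k))"
    have "(LINT x|lborel. Q \<theta> x * Q \<theta>' x / ?p0 x) ^ m \<le> exp (\<Sum>k\<in>cells L. bb k * \<theta>' k)" if th: "\<theta>' \<in> T" for \<theta>'
    proof -
      define z where "z = (\<Sum>k\<in>cells L. sg \<theta> k * sg \<theta>' k * w k)"
      have "0 \<le> (LINT x|lborel. Q \<theta> x * Q \<theta>' x / ?p0 x)"
        by (intro Bochner_Integration.integral_nonneg divide_nonneg_pos mult_nonneg_nonneg Q_nn gauss_density_pos b)
      then have "0 \<le> 1 + z" unfolding QQI z_def .
      then have "(1 + z) ^ m \<le> exp z ^ m" using exp_ge_add_one_self[of z] by (intro power_mono) auto
      also have "\<dots> = exp (real m * z)" by (simp add: exp_of_nat_mult)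
      also have "real m * z = (\<Sum>k\<in>cells L. bb k * \<theta>' k)"
        unfolding z_def sum_distrib_left
      proof (intro sum.cong refl)
        fix k :: "'d \<Rightarrow> nat" assume "k \<in> cells L"
        then have "\<theta>' k = -1 \<or> \<theta>' k = 1" using th by (auto simp: T_def)
        then have "sg \<theta>' k = a * \<theta>' k" by (auto simp: sg_def)
        then show "real m * (sg \<theta> k * sg \<theta>' k * w k) = bb k * \<theta>' k" by (simp add: bb_def)
      qed
      finally show ?thesis unfolding QQI z_def .
    qed
    then have "(\<Sum>\<theta>'\<in>T. (LINT x|lborel. Q \<theta> x * Q \<theta>' x / ?p0 x) ^ m) \<le> (\<Sum>\<theta>'\<in>T. exp (\<Sum>k\<in>cells L. bb k * \<theta>' k))"
      by (rule sum_mono)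
    also have "\<dots> \<le> 2 ^ card (cells L :: ('d \<Rightarrow> nat) set) * exp ((\<Sum>k\<in>cells L. (bb k)\<^sup>2) / 2)"
      unfolding T_def by (rule sum_signs_exp_le[OF finite_cells])
    also have "\<dots> \<le> 2 ^ card (cells L :: ('d \<Rightarrow> nat) set) * D"
    proof (rule mult_left_mono)
      have "(\<Sum>k\<in>cells L. (bb k)\<^sup>2) \<le> (\<Sum>k\<in>(cells L :: ('d \<Rightarrow> nat) set). (real m)\<^sup>2 * (a\<^sup>2)\<^sup>2 * (I2 / real L ^ CARD('d) / cp)\<^sup>2)"
      proof (rule sum_mono)
        fix k :: "'d \<Rightarrow> nat" assume k: "k \<in> cells L"
        have "(bb k)\<^sup>2 = (real m)\<^sup>2 * (a\<^sup>2)\<^sup>2 * (w k)\<^sup>2"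
          unfolding bb_def power_mult_distrib sg2 by (simp add: power2_eq_square)
        also have "\<dots> \<le> (real m)\<^sup>2 * (a\<^sup>2)\<^sup>2 * (I2 / real L ^ CARD('d) / cp)\<^sup>2"
          by (intro mult_left_mono w_le k) auto
        finally show "(bb k)\<^sup>2 \<le> (real m)\<^sup>2 * (a\<^sup>2)\<^sup>2 * (I2 / real L ^ CARD('d) / cp)\<^sup>2" .
      qed
      also have "\<dots> = (real m)\<^sup>2 * (a\<^sup>2 * I2 / cp)\<^sup>2 / real L ^ CARD('d)"
        using L by (simp add: card_cells power_divide power_mult_distrib power2_eq_square mult_ac)
      finally have "exp ((\<Sum>k\<in>cells L. (bb k)\<^sup>2) / 2) \<le> exp ((real m)\<^sup>2 * (a\<^sup>2 * I2 / cp)\<^sup>2 / real L ^ CARD('d) / 2)" by simp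
      then show "exp ((\<Sum>k\<in>cells L. (bb k)\<^sup>2) / 2) \<le> D" using D by linarith
    qed simp
    finally show ?thesis unfolding cardT by simp
  qed
  obtain \<theta> where "\<theta> \<in> T" "reject_prob ?p0 (Q \<theta>) n m \<Phi> \<le> (t * reject_prob ?p0 ?p0 n m \<Phi> + D / t) / 2"
    using reject_prob_mixture_le[OF finT T0 test Qd QQi chi t] by auto
  then show ?thesis using hom_power_bounds(3)[OF alt, of n m \<Phi> \<theta>] by linarith
qed

text \<open>The number \<open>L\<close> of cells per axis is as large as the separation allows: \<open>\<kappa>\<close> is chosen such that
  \<open>a sqrt I2 \<ge> K n\<^bsup>-2s/(d+4s)\<^esup>\<close>, which exceeds \<open>\<Delta> n\<close> infinitely often. Then \<open>m\<^sup>2 a\<^sup>4 L\<^bsup>-d\<^esup>\<close> stays bounded because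
  \<open>L\<^bsup>4s+d\<^esup>\<close> is of order \<open>n\<^sup>2\<close>. With \<open>\<alpha> = 1/4D\<close> and \<open>t = 2D\<close> the mixture bound becomes \<open>3/4\<close> as soon as the
  rejection probability under \<open>p\<^sub>0\<close> is below \<open>2\<alpha>\<close>; the factor 2 leaves room for the asymptotic notion of
  level.\<close>

lemma minimax_lower_bound:
  fixes s M C\<^sub>0 :: real and m :: "nat \<Rightarrow> nat" and \<Delta> :: "nat \<Rightarrow> real"
  assumes s: "s > 0" and M: "M > 0"
    and m: "\<forall>n\<ge>1. real (m n) / real n \<le> C\<^sub>0"
    and \<Delta>: "\<forall>n\<ge>1. \<Delta> n > 0"
    and lim: "liminf (\<lambda>n. ereal (real n powr (2 * s / (real CARD('d::finite) + 4 * s)) * \<Delta> n)) < \<infinity>"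
  shows "\<exists>\<alpha>\<in>{0<..<1}. \<forall>\<Phi> :: nat \<Rightarrow> 'd two_sample_test.
           (\<forall>n\<ge>1. is_test n (m n) (\<Phi> n)) \<and> asymptotic_level s M m \<alpha> \<Phi> \<longrightarrow>
           liminf (\<lambda>n. ereal (hom_power s M (\<Delta> n) n (m n) (\<Phi> n))) < 1"
proof -
  define d where "d = real CARD('d)"
  have d: "d > 0" by (simp add: d_def)
  define b0 where "b0 = 2 * s / (d + 4 * s)"
  define e where "e = 2 / (d + 4 * s)"
  have ds: "d + 4 * s > 0" using d s by simp
  have e: "e > 0" using ds by (simp add: e_def)
  have exps: "e * s = b0" "e * (4 * s + d) = 2" using ds by (auto simp: e_def b0_def field_simps)
  obtain K where K: "K > 0" "frequently (\<lambda>n. real n powr b0 * \<Delta> n < K) sequentially"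
  proof -
    obtain k :: real where k: "liminf (\<lambda>n. ereal (real n powr b0 * \<Delta> n)) < ereal k"
      using less_PInf_Ex_of_nat[THEN iffD1, OF less_imp_neq[OF lim]] unfolding b0_def d_def by auto
    have "frequently (\<lambda>n. real n powr b0 * \<Delta> n < max k 1) sequentially"
    proof (rule ccontr)
      assume "\<not> ?thesis"
      then have "eventually (\<lambda>n. ereal (max k 1) \<le> ereal (real n powr b0 * \<Delta> n)) sequentially"
        by (simp add: not_frequently not_less)
      then have "ereal (max k 1) \<le> liminf (\<lambda>n. ereal (real n powr b0 * \<Delta> n))"
        by (rule Liminf_bounded)
      also have "\<dots> < ereal k" by (rule k)
      finally show False by simp
    qed
    then show ?thesis by (intro that[of "max k 1"]) auto
  qed
  define r where "r = nat \<lceil>s\<rceil>"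
  have r: "s \<le> 2 * real r" using s unfolding r_def by linarith
  define P where "P = pderiv (edge_poly ^ (2 * r + 2))"
  have P0: "P \<noteq> 0"
  proof -
    have "degree (edge_poly ^ (2 * r + 2)) = (2 * r + 2) * 2"
      by (subst degree_power_eq) (auto simp: edge_poly_def)
    then show ?thesis unfolding P_def by (simp add: pderiv_eq_0_iff del: power_Suc)
  qed
  obtain b where b: "b > 0" and p0_int: "integrable lborel (sobolev_integrand s (gauss_density b :: real ^ 'd \<Rightarrow> real))"
    and p0_le: "(LINT \<omega>|lborel. sobolev_integrand s (gauss_density b :: real ^ 'd \<Rightarrow> real) \<omega>) \<le> M\<^sup>2 / 4"
    using exists_gauss_density_small_sobolev[OF s, of "M\<^sup>2 / 4", where 'd='d] M by auto
  let ?p0 = "gauss_density b :: real ^ 'd \<Rightarrow> real"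
  define cp where "cp = (b / pi) powr (real CARD('d) / 2) * exp (- b * real CARD('d))"
  have cp: "cp > 0" using b by (simp add: cp_def)
  obtain B where B: "B > 0" "\<And>t. \<bar>bump1 P t\<bar> \<le> B" using bump1_bounded[of P] by auto
  define I2 where "I2 = (LINT t|lborel. (bump1 P t)\<^sup>2) ^ CARD('d)"
  have I2: "I2 > 0" unfolding I2_def by (intro zero_less_power bump1_sq_integral_pos P0)
  define Ct where "Ct = (LINT t|lborel. (bump1 ((one_minus_D2 ^^ r) P) t)\<^sup>2) ^ CARD('d)"
  have Ct: "Ct \<ge> 0" unfolding Ct_def by (intro zero_le_power) simp
  (* the squared Sobolev norm of the perturbation may be a quarter of M^2; the summand 1 avoids a division by zero *)
  define c1 where "c1 = M / (2 * sqrt (Ct + 1))"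
  have c1: "c1 > 0" using M Ct by (simp add: c1_def)
  have c1_sq: "c1\<^sup>2 * Ct \<le> M\<^sup>2 / 4"
  proof -
    have "c1\<^sup>2 = M\<^sup>2 / (4 * (Ct + 1))" using Ct by (simp add: c1_def power_divide power_mult_distrib)
    moreover have "M\<^sup>2 / (4 * (Ct + 1)) * Ct \<le> M\<^sup>2 / 4"
    proof -
      have "M\<^sup>2 * Ct \<le> M\<^sup>2 * (Ct + 1)" by (intro mult_left_mono) auto
      then show ?thesis using Ct by (simp add: field_simps)
    qed
    ultimately show ?thesis by simp
  qed
  (* the number of cells per axis, in units of n^e, at which the separation of the alternatives meets the bound K on the rescaled Delta *)
  define \<kappa> where "\<kappa> = (c1 * sqrt I2 / K) powr (1 / s)"
  have \<kappa>: "\<kappa> > 0" using c1 I2 K by (simp add: \<kappa>_def)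
  have \<kappa>s: "\<kappa> powr (- s) * (c1 * sqrt I2) = K"
    using s c1 I2 K by (simp add: \<kappa>_def powr_powr powr_minus)
  define L where "L = (\<lambda>n. nat \<lfloor>\<kappa> * real n powr e\<rfloor>)"
  define a where "a = (\<lambda>n. c1 * real (L n) powr (- s))"
  (* the exponent m^2 a^4 L^(-d) up to constants, evaluated at the smallest L that occurs *)
  define E where "E = C\<^sub>0\<^sup>2 * (c1\<^sup>2 * I2 / cp)\<^sup>2 * (\<kappa> / 2) powr (- (4 * s + d))"
  define D where "D = exp (E / 2)"
  have E0: "0 \<le> E" unfolding E_def by simp
  have D: "D \<ge> 1" using E0 by (simp add: D_def)
  have L_le: "real (L n) \<le> \<kappa> * real n powr e" for n
    using \<kappa> unfolding L_def by (simp add: of_nat_nat)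
  have big: "filterlim (\<lambda>n. \<kappa> * real n powr e) at_top sequentially"
    using \<kappa> e by real_asymp
  have evL: "eventually (\<lambda>n. L n > 0 \<and> real (L n) \<ge> \<kappa> / 2 * real n powr e) sequentially"
    using filterlim_at_top[THEN iffD1, OF big, rule_format, of 2]
  proof eventually_elim
    case (elim n)
    have "real (L n) = real_of_int \<lfloor>\<kappa> * real n powr e\<rfloor>" using elim unfolding L_def by (subst of_nat_nat) auto
    also have "\<dots> \<ge> \<kappa> * real n powr e - 1" by linarith
    finally show ?case using elim by linarith
  qed
  have ev_small: "eventually (\<lambda>n. a n * B ^ CARD('d) \<le> cp) sequentially"
  proof -
    have "(\<lambda>n. c1 * (\<kappa> / 2 * real n powr e) powr (- s) * B ^ CARD('d)) \<longlonglongrightarrow> 0"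
      using \<kappa> e s c1 B by real_asymp
    then have "eventually (\<lambda>n. c1 * (\<kappa> / 2 * real n powr e) powr (- s) * B ^ CARD('d) < cp) sequentially"
      using cp by (intro order_tendstoD) auto
    then show ?thesis using evL eventually_ge_at_top[of 1]
    proof eventually_elim
      case (elim n)
      have "real (L n) powr (- s) \<le> (\<kappa> / 2 * real n powr e) powr (- s)"
        using elim s \<kappa> by (intro powr_mono2') auto
      then have "a n * B ^ CARD('d) \<le> c1 * (\<kappa> / 2 * real n powr e) powr (- s) * B ^ CARD('d)"
        unfolding a_def using c1 B by (intro mult_right_mono mult_left_mono) auto
      then show ?case using elim by linarith
    qed
  qed
  define \<alpha> where "\<alpha> = 1 / (4 * D)"
  have \<alpha>: "\<alpha> > 0" "\<alpha> < 1" "\<alpha> < 2 * \<alpha>" using D by (auto simp: \<alpha>_def divide_less_eq)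
  show ?thesis
  proof (intro bexI[of _ \<alpha>] allI impI)
    show "\<alpha> \<in> {0<..<1}" using \<alpha> by simp
    fix \<Phi> :: "nat \<Rightarrow> 'd two_sample_test"
    assume \<Phi>: "(\<forall>n\<ge>1. is_test n (m n) (\<Phi> n)) \<and> asymptotic_level s M m \<alpha> \<Phi>"
    have "limsup (\<lambda>n. ereal (reject_prob ?p0 ?p0 n (m n) (\<Phi> n))) \<le> ereal \<alpha>"
      using \<Phi> gauss_density_in_ball[OF b M p0_int p0_le] prob_density_gauss_density[OF b]
      unfolding asymptotic_level_def by blast
    also have "\<dots> < ereal (2 * \<alpha>)" using \<alpha> by simp
    finally have ev_rej: "eventually (\<lambda>n. ereal (reject_prob ?p0 ?p0 n (m n) (\<Phi> n)) < ereal (2 * \<alpha>)) sequentially"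
      by (rule Limsup_lessD)
    have "frequently (\<lambda>n. hom_power s M (\<Delta> n) n (m n) (\<Phi> n) \<le> 3 / 4) sequentially"
    proof (rule frequently_rev_mp[OF K(2)])
      show "eventually (\<lambda>n. real n powr b0 * \<Delta> n < K \<longrightarrow> hom_power s M (\<Delta> n) n (m n) (\<Phi> n) \<le> 3 / 4) sequentially"
        using ev_rej ev_small evL eventually_ge_at_top[of 1]
      proof eventually_elim
        case (elim n)
        have n: "real n > 0" using elim by simp
        have Ln: "L n > 0" "real (L n) > 0" using elim by auto
        have an: "a n > 0" using c1 Ln by (simp add: a_def)
        have a_sq: "(a n)\<^sup>2 = c1\<^sup>2 * real (L n) powr (- (2 * s))"
          using Ln by (simp add: a_def power_mult_distrib powr_power mult.commute)
        show ?case
        proof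
          assume Kn: "real n powr b0 * \<Delta> n < K"
          have sob: "real (L n) powr (2 * s) * ((a n)\<^sup>2 * Ct) \<le> M\<^sup>2 / 4"
          proof -
            have "real (L n) powr (2 * s) * ((a n)\<^sup>2 * Ct) = (real (L n) powr (2 * s) * real (L n) powr (- (2 * s))) * (c1\<^sup>2 * Ct)"
              unfolding a_sq by (simp only: mult_ac)
            also have "real (L n) powr (2 * s) * real (L n) powr (- (2 * s)) = 1"
              using Ln unfolding powr_add[symmetric] by simp
            finally show ?thesis using c1_sq by (simp only: mult_1)
          qed
          have sep: "(\<Delta> n)\<^sup>2 \<le> (a n)\<^sup>2 * I2"
          proof -
            have "\<Delta> n \<le> K * real n powr (- b0)"
            proof -
              have "\<Delta> n = (real n powr b0 * \<Delta> n) * real n powr (- b0)" using n by (simp add: powr_minus)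
              also have "\<dots> \<le> K * real n powr (- b0)" using Kn by (intro mult_right_mono) auto
              finally show ?thesis .
            qed
            also have "K * real n powr (- b0) = c1 * sqrt I2 * (\<kappa> powr (- s) * real n powr (- b0))"
              unfolding \<kappa>s[symmetric] by (simp only: mult_ac)
            also have "\<kappa> powr (- s) * real n powr (- b0) = (\<kappa> * real n powr e) powr (- s)"
            proof -
              have "(\<kappa> * real n powr e) powr (- s) = \<kappa> powr (- s) * (real n powr e) powr (- s)"
                using \<kappa> by (subst powr_mult) auto
              then show ?thesis using exps(1) by (simp add: powr_powr)
            qed
            also have "c1 * sqrt I2 * (\<kappa> * real n powr e) powr (- s) \<le> c1 * sqrt I2 * real (L n) powr (- s)"
              using L_le[of n] Ln s c1 I2 by (intro mult_left_mono powr_mono2') auto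
            also have "\<dots> = a n * sqrt I2" by (simp add: a_def)
            finally have "(\<Delta> n)\<^sup>2 \<le> (a n * sqrt I2)\<^sup>2" using \<Delta> elim by (intro power_mono) (auto simp: less_imp_le)
            then show ?thesis using I2 by (simp add: power_mult_distrib)
          qed
          have DD: "exp ((real (m n))\<^sup>2 * ((a n)\<^sup>2 * I2 / cp)\<^sup>2 / real (L n) ^ CARD('d) / 2) \<le> D"
          proof -
            have m_le: "(real (m n))\<^sup>2 \<le> (C\<^sub>0 * real n)\<^sup>2"
            proof (rule power_mono)
              have "real (m n) / real n \<le> C\<^sub>0" using m elim(4) by blast
              then show "real (m n) \<le> C\<^sub>0 * real n" using n by (simp add: divide_le_eq)
            qed simp
            have pw: "(real (L n) powr (- (2 * s)))\<^sup>2 / real (L n) ^ CARD('d) = real (L n) powr (- (4 * s + d))"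
            proof -
              have "real (L n) ^ CARD('d) = real (L n) powr d" using Ln by (simp add: d_def powr_realpow)
              moreover have "(real (L n) powr (- (2 * s)))\<^sup>2 = real (L n) powr (- (4 * s))"
                using Ln by (simp add: powr_power)
              moreover have "- (4 * s + d) = - (4 * s) - d" by simp
              ultimately show ?thesis by (simp only: powr_diff)
            qed
            have "(real (m n))\<^sup>2 * ((a n)\<^sup>2 * I2 / cp)\<^sup>2 / real (L n) ^ CARD('d) =
                (real (m n))\<^sup>2 * (c1\<^sup>2 * I2 / cp)\<^sup>2 * ((real (L n) powr (- (2 * s)))\<^sup>2 / real (L n) ^ CARD('d))"
              unfolding a_sq by (simp add: power_mult_distrib power_divide)
            also have "\<dots> = (real (m n))\<^sup>2 * (c1\<^sup>2 * I2 / cp)\<^sup>2 * real (L n) powr (- (4 * s + d))"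
              unfolding pw ..
            also have "\<dots> \<le> (C\<^sub>0 * real n)\<^sup>2 * (c1\<^sup>2 * I2 / cp)\<^sup>2 * (\<kappa> / 2 * real n powr e) powr (- (4 * s + d))"
              using elim s d \<kappa> n by (intro mult_mono m_le powr_mono2') auto
            also have "(\<kappa> / 2 * real n powr e) powr (- (4 * s + d)) = (\<kappa> / 2) powr (- (4 * s + d)) * real n powr (- 2)"
            proof -
              have "(\<kappa> / 2 * real n powr e) powr (- (4 * s + d)) = (\<kappa> / 2) powr (- (4 * s + d)) * (real n powr e) powr (- (4 * s + d))"
                using \<kappa> by (subst powr_mult) auto
              also have "(real n powr e) powr (- (4 * s + d)) = real n powr (- 2)"
                unfolding powr_powr mult_minus_right exps(2) ..
              finally show ?thesis .
            qed
            also have "real n powr (- 2) = 1 / (real n)\<^sup>2" using n by (simp add: powr_minus divide_inverse)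
            also have "(C\<^sub>0 * real n)\<^sup>2 * (c1\<^sup>2 * I2 / cp)\<^sup>2 * ((\<kappa> / 2) powr (- (4 * s + d)) * (1 / (real n)\<^sup>2)) = E"
              using n by (simp add: E_def power_mult_distrib)
            finally show ?thesis unfolding D_def by simp
          qed
          have test: "is_test n (m n) (\<Phi> n)" using \<Phi> elim by simp
          have t: "2 * D > 0" using D by simp
          have \<Delta>0: "0 \<le> \<Delta> n" using \<Delta> elim by (simp add: less_imp_le)
          have "hom_power s M (\<Delta> n) n (m n) (\<Phi> n) \<le> (2 * D * reject_prob ?p0 ?p0 n (m n) (\<Phi> n) + D / (2 * D)) / 2"
            by (rule hom_power_le_mixture[OF P_def s r b B(2) Ln(1) an t M test p0_int p0_le cp_def I2_def elim(2) sob[unfolded Ct_def] \<Delta>0 sep DD])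
          also have "\<dots> \<le> (2 * D * (2 * \<alpha>) + D / (2 * D)) / 2"
            using elim(1) D by (intro divide_right_mono add_right_mono mult_left_mono) auto
          also have "\<dots> = 3 / 4" using D by (simp add: \<alpha>_def)
          finally show "hom_power s M (\<Delta> n) n (m n) (\<Phi> n) \<le> 3 / 4" .
        qed
      qed
    qed
    then have fr: "frequently (\<lambda>n. ereal (hom_power s M (\<Delta> n) n (m n) (\<Phi> n)) \<le> ereal (3 / 4)) sequentially" by simp
    show "liminf (\<lambda>n. ereal (hom_power s M (\<Delta> n) n (m n) (\<Phi> n))) < 1"
    proof (rule ccontr)
      assume "\<not> ?thesis"
      then have "ereal (3 / 4) < liminf (\<lambda>n. ereal (hom_power s M (\<Delta> n) n (m n) (\<Phi> n)))"
        by (auto simp: not_less intro: less_le_trans[of _ 1])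
      then have "eventually (\<lambda>n. ereal (3 / 4) < ereal (hom_power s M (\<Delta> n) n (m n) (\<Phi> n))) sequentially"
        by (rule less_LiminfD)
      then show False using fr unfolding frequently_def by (simp add: not_le)
    qed
  qed
qed

theorem theorem5:
  fixes s M c\<^sub>0 C\<^sub>0 :: real and m :: "nat \<Rightarrow> nat" and \<Delta> :: "nat \<Rightarrow> real"
  assumes "s > 0" and "M > 0"
    and "0 < c\<^sub>0" and "c\<^sub>0 \<le> C\<^sub>0"
    and "\<forall>n\<ge>1. c\<^sub>0 \<le> real (m n) / real n \<and> real (m n) / real n \<le> C\<^sub>0"
    and "\<forall>n\<ge>1. \<Delta> n > 0"
  shows
    "(filterlim (\<lambda>n. real n powr (2 * s / (real CARD('d::finite) + 4 * s)) * \<Delta> n) at_top sequentially \<longrightarrow>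
        (\<forall>\<alpha>\<in>{0<..<1}. \<forall>\<nu>.
           (\<forall>n\<ge>1. \<nu> n > 0) \<and> \<nu> \<in> \<Theta>(\<lambda>n. real n powr (4 / (real CARD('d) + 4 * s))) \<longrightarrow>
           (\<lambda>n. hom_power s M (\<Delta> n) n (m n) (hom_test (\<nu> n) \<alpha> n (m n) :: 'd two_sample_test))
             \<longlonglongrightarrow> 1))
   \<and> (liminf (\<lambda>n. ereal (real n powr (2 * s / (real CARD('d) + 4 * s)) * \<Delta> n)) < \<infinity> \<longrightarrow>
        (\<exists>\<alpha>\<in>{0<..<1}. \<forall>\<Phi> :: nat \<Rightarrow> 'd two_sample_test.
           (\<forall>n\<ge>1. is_test n (m n) (\<Phi> n)) \<and> asymptotic_level s M m \<alpha> \<Phi> \<longrightarrow>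
           liminf (\<lambda>n. ereal (hom_power s M (\<Delta> n) n (m n) (\<Phi> n))) < 1))"
proof (intro conjI impI ballI allI)
  fix \<alpha> :: real and \<nu> :: "nat \<Rightarrow> real"
  assume "filterlim (\<lambda>n. real n powr (2 * s / (real CARD('d::finite) + 4 * s)) * \<Delta> n) at_top sequentially"
    and "(\<forall>n\<ge>1. \<nu> n > 0) \<and> \<nu> \<in> \<Theta>(\<lambda>n. real n powr (4 / (real CARD('d) + 4 * s)))"
  then show "(\<lambda>n. hom_power s M (\<Delta> n) n (m n) (hom_test (\<nu> n) \<alpha> n (m n) :: 'd two_sample_test)) \<longlonglongrightarrow> 1"
    using assms by (intro hom_test_power_tendsto_1[of s M c\<^sub>0 m \<Delta> \<nu>]) auto
next
  assume "liminf (\<lambda>n. ereal (real n powr (2 * s / (real CARD('d) + 4 * s)) * \<Delta> n)) < \<infinity>"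
  then show "\<exists>\<alpha>\<in>{0<..<1}. \<forall>\<Phi> :: nat \<Rightarrow> 'd two_sample_test.
           (\<forall>n\<ge>1. is_test n (m n) (\<Phi> n)) \<and> asymptotic_level s M m \<alpha> \<Phi> \<longrightarrow>
           liminf (\<lambda>n. ereal (hom_power s M (\<Delta> n) n (m n) (\<Phi> n))) < 1"
    using assms by (intro minimax_lower_bound[of s M m C\<^sub>0 \<Delta>]) auto
qed

end
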